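(* Let $x\subseteq\omega$ be $ITRM$-recognizable and let $y\subseteq\omega$ be $ITRM$-random with $x\leq_{ITRM}y$. Then $x$ is $ITRM$-computable.
   Context: An infinite time register machine ($ITRM$) has finitely many registers, each holding a natural number, and runs a program of the same kind as a classical unlimited register machine (with an additional instruction querying membership of a number in an oracle), but in transfinite ordinal time: successor steps are as for register machines; at limit times the active program line is the limit inferior of earlier program lines and each register holds the limit inferior of its earlier contents, reset to $0$ if that limit inferior is infinite. $x\leq_{ITRM}y$ iff there is a program $P$ which, with oracle $y$, halts on every input $i\in\omega$ and outputs $1$ iff $i\in x$ and $0$ otherwise; $x$ is $ITRM$-computable iff $x\leq_{ITRM}\emptyset$. $X\subseteq\mathfrak{P}(\omega)$ is $ITRM$-decidable iff some program $P$, with any oracle $z$, halts with output $1$ if $z\in X$ and $0$ otherwise. $y$ is $ITRM$-random iff no $ITRM$-decidable meager set contains $y$. $x$ is $ITRM$-recognizable iff there is a program $P$ such that, for every $y\subseteq\omega$, $P$ with oracle $y$ halts with output $1$ if $y=x$ and with output $0$ otherwise. *)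

theory Defs
  imports "HOL-Analysis.Analysis" "HOL-Library.Countable_Set_Type"
begin

section \<open>Programs and single steps\<close>

datatype instr =
    Zero nat
  | Succ nat
  | Copy nat nat
  | JumpEq nat nat nat
  | Oracle nat

type_synonym program = "instr list"

text \<open>
  A configuration is the active program line together with the register contents. A program is a
  finite list and so mentions only finitely many registers; all others keep their initial
  content throughout, also at limit times.
\<close>

type_synonym config = "nat \<times> (nat \<Rightarrow> nat)"

definition halted :: "program \<Rightarrow> config \<Rightarrow> bool"
  where "halted P c \<longleftrightarrow> length P \<le> fst c"

fun exec :: "nat set \<Rightarrow> instr \<Rightarrow> config \<Rightarrow> config" where
  "exec z (Zero m) (l, R) = (Suc l, R(m := 0))"
| "exec z (Succ m) (l, R) = (Suc l, R(m := Suc (R m)))"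
| "exec z (Copy m n) (l, R) = (Suc l, R(n := R m))"
| "exec z (JumpEq m n k) (l, R) = (if R m = R n then k else Suc l, R)"
| "exec z (Oracle m) (l, R) = (Suc l, R(m := (if R m \<in> z then 1 else 0)))"

definition step :: "program \<Rightarrow> nat set \<Rightarrow> config \<Rightarrow> config"
  where "step P z c = (if halted P c then c else exec z (P ! fst c) c)"

definition init :: "nat \<Rightarrow> config"
  where "init i = (0, (\<lambda>_. 0)(0 := i))"

section \<open>Transfinite computations\<close>

definition liminf_below :: "('t::wellorder \<Rightarrow> nat) \<Rightarrow> 't \<Rightarrow> enat"
  where "liminf_below f t = (SUP s\<in>{..<t}. INF u\<in>{s..<t}. enat (f u))"

definition limit_value :: "('t::wellorder \<Rightarrow> nat) \<Rightarrow> 't \<Rightarrow> nat"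
  where "limit_value f t = (case liminf_below f t of enat n \<Rightarrow> n | \<infinity> \<Rightarrow> 0)"

definition is_succ :: "'t::wellorder \<Rightarrow> 't \<Rightarrow> bool"
  where "is_succ s t \<longleftrightarrow> s < t \<and> (\<forall>u. \<not> (s < u \<and> u < t))"

definition is_limit :: "'t::wellorder \<Rightarrow> bool"
  where "is_limit t \<longleftrightarrow> (\<exists>s. s < t) \<and> (\<nexists>s. is_succ s t)"

text \<open>
  The reset to 0 in \<^const>\<open>limit_value\<close> never affects the program line: its values are bounded
  by the length of the program and the jump targets.
\<close>

definition is_run :: "program \<Rightarrow> nat set \<Rightarrow> nat \<Rightarrow> ('t::wellorder \<Rightarrow> config) \<Rightarrow> bool" where
  "is_run P z i C \<longleftrightarrow>
     (\<forall>t. (\<forall>s. t \<le> s) \<longrightarrow> C t = init i) \<and>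
     (\<forall>s t. is_succ s t \<longrightarrow> C t = step P z (C s)) \<and>
     (\<forall>t. is_limit t \<longrightarrow>
        C t = (limit_value (\<lambda>s. fst (C s)) t, \<lambda>m. limit_value (\<lambda>s. snd (C s) m) t))"

text \<open>
  The time axis is the first uncountable ordinal, realised as the cardinal successor of the
  order of the natural numbers. This is no restriction: see theorem \<open>halts_with_any_time\<close> below.
\<close>

typedef time = "Field (cardSuc natLeq)"
proof -
  have "Field (cardSuc natLeq) \<noteq> {}"
    using cardSuc_finite[OF natLeq_Card_order] by (auto simp: Field_natLeq)
  then show ?thesis by blast
qed

setup_lifting type_definition_time

instantiation time :: wellorder
begin

lift_definition less_eq_time :: "time \<Rightarrow> time \<Rightarrow> bool"
  is "\<lambda>a b. (a, b) \<in> cardSuc natLeq" .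

definition less_time :: "time \<Rightarrow> time \<Rightarrow> bool"
  where "less_time a b \<longleftrightarrow> a \<le> b \<and> a \<noteq> b"

instance
proof -
  have wo: "Well_order (cardSuc natLeq)"
    using cardSuc_Card_order[OF natLeq_Card_order] card_order_on_well_order_on by blast
  then have lin: "Linear_order (cardSuc natLeq)" and wf: "wf (cardSuc natLeq - Id)"
    by (auto simp: well_order_on_def)
  have refl: "(Rep_time a, Rep_time a) \<in> cardSuc natLeq" for a
    using lin Rep_time[of a]
    by (auto simp: linear_order_on_def partial_order_on_def preorder_on_def refl_on_def)
  have trans: "trans (cardSuc natLeq)" and antisym: "antisym (cardSuc natLeq)"
    using lin by (auto simp: linear_order_on_def partial_order_on_def preorder_on_def)
  have tot: "(Rep_time a, Rep_time b) \<in> cardSuc natLeq \<or> (Rep_time b, Rep_time a) \<in> cardSuc natLeq"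
    for a b
    using lin refl Rep_time[of a] Rep_time[of b]
    by (metis linear_order_on_def total_on_def)
  have anti: "a = b" if "a \<le> b" "b \<le> a" for a b :: time
    using that antisym by (auto simp: less_eq_time.rep_eq Rep_time_inject dest: antisymD)
  show "OFCLASS(time, wellorder_class)"
  proof
    fix x y z :: time
    show "(x < y) = (x \<le> y \<and> \<not> y \<le> x)"
      using anti refl by (auto simp: less_time_def less_eq_time.rep_eq)
    show "x \<le> x" using refl by (simp add: less_eq_time.rep_eq)
    show "x \<le> z" if "x \<le> y" "y \<le> z"
      using that trans by (auto simp: less_eq_time.rep_eq dest: transD)
    show "x = y" if "x \<le> y" "y \<le> x" using anti that .
    show "x \<le> y \<or> y \<le> x" using tot by (simp add: less_eq_time.rep_eq)
  next
    fix Q :: "time \<Rightarrow> bool" and a :: time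
    assume step: "\<And>x. (\<And>y. y < x \<Longrightarrow> Q y) \<Longrightarrow> Q x"
    have "wf (inv_image (cardSuc natLeq - Id) Rep_time)" using wf by simp
    then show "Q a"
      by (induction a rule: wf_induct_rule)
        (rule step, auto simp: less_time_def less_eq_time.rep_eq Rep_time_inject)
  qed
qed

end

definition halts_with :: "program \<Rightarrow> nat set \<Rightarrow> nat \<Rightarrow> nat \<Rightarrow> bool" where
  "halts_with P z i out \<longleftrightarrow>
     (\<exists>(C :: time \<Rightarrow> config) t. is_run P z i C \<and> halted P (C t) \<and> snd (C t) 0 = out)"

section \<open>Computability, decidability, recognizability and randomness\<close>

definition itrm_reducible :: "nat set \<Rightarrow> nat set \<Rightarrow> bool"  (infix "\<le>\<^sub>I\<^sub>T\<^sub>R\<^sub>M" 50)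
  where "x \<le>\<^sub>I\<^sub>T\<^sub>R\<^sub>M y \<longleftrightarrow> (\<exists>P. \<forall>i. halts_with P y i (if i \<in> x then 1 else 0))"

definition itrm_computable :: "nat set \<Rightarrow> bool"
  where "itrm_computable x \<longleftrightarrow> x \<le>\<^sub>I\<^sub>T\<^sub>R\<^sub>M {}"

text \<open>Computations without input start with all registers 0.\<close>

definition itrm_decidable :: "nat set set \<Rightarrow> bool"
  where "itrm_decidable X \<longleftrightarrow> (\<exists>P. \<forall>z. halts_with P z 0 (if z \<in> X then 1 else 0))"

definition itrm_recognizable :: "nat set \<Rightarrow> bool"
  where "itrm_recognizable x \<longleftrightarrow> (\<exists>P. \<forall>y. halts_with P y 0 (if y = x then 1 else 0))"

definition nowhere_dense :: "'a::topological_space set \<Rightarrow> bool"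
  where "nowhere_dense A \<longleftrightarrow> interior (closure A) = {}"

definition meager :: "'a::topological_space set \<Rightarrow> bool"
  where "meager A \<longleftrightarrow> (\<exists>N :: nat \<Rightarrow> 'a set. (\<forall>n. nowhere_dense (N n)) \<and> A = (\<Union>n. N n))"

text \<open>
  Subsets of \<open>\<omega>\<close> are identified with their characteristic functions, so that meagerness refers to
  the product topology on \<^typ>\<open>nat \<Rightarrow> bool\<close> (Cantor space).
\<close>

definition itrm_random :: "nat set \<Rightarrow> bool"
  where "itrm_random y \<longleftrightarrow>
    \<not> (\<exists>X. itrm_decidable X \<and> meager ((\<lambda>z n. n \<in> z) ` X) \<and> y \<in> X)"

section \<open>Independence of the time axis\<close>

text \<open>
  Runs exist uniquely along every well-order, and a run halting along an arbitrary well-order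
  halts with the same output along \<^typ>\<open>time\<close>.
\<close>

lemma limit_value_cong:
  assumes "\<And>s. s < t \<Longrightarrow> f s = g s" shows "limit_value f t = limit_value g t"
proof -
  have "liminf_below f t = liminf_below g t"
    unfolding liminf_below_def by (intro SUP_cong INF_cong refl) (use assms in auto)
  then show ?thesis by (simp add: limit_value_def)
qed

lemma limit_value_eqI:
  fixes t s1 :: "'t::wellorder"
  assumes "s1 < t" "\<And>u. s1 \<le> u \<Longrightarrow> u < t \<Longrightarrow> n \<le> g u"
    and cof: "\<And>s. s < t \<Longrightarrow> \<exists>u. s \<le> u \<and> u < t \<and> g u = n"
  shows "limit_value g t = n"
proof -
  have "liminf_below g t \<le> enat n"
    unfolding liminf_below_def
  proof (rule SUP_least)
    fix s assume "s \<in> {..<t}"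
    then obtain u where "s \<le> u" "u < t" "g u = n" using cof by blast
    then show "(INF u\<in>{s..<t}. enat (g u)) \<le> enat n"
      by (intro INF_lower2[of u]) auto
  qed
  moreover have "enat n \<le> liminf_below g t"
    unfolding liminf_below_def
    by (rule SUP_upper2[of s1]) (use assms in \<open>auto intro!: INF_greatest\<close>)
  ultimately have "liminf_below g t = enat n" by simp
  then show ?thesis by (simp add: limit_value_def)
qed

lemma liminf_below_mono:
  assumes "\<And>s. s < a \<Longrightarrow> \<exists>s'<b. \<forall>u. s' \<le> u \<and> u < b \<longrightarrow> (\<exists>u'. s \<le> u' \<and> u' < a \<and> f u' = g u)"
  shows "liminf_below f a \<le> liminf_below g b"
  unfolding liminf_below_def
proof (rule SUP_least)
  fix s assume "s \<in> {..<a}"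
  then obtain s' where "s' < b" and s': "\<And>u. s' \<le> u \<Longrightarrow> u < b \<Longrightarrow> \<exists>u'. s \<le> u' \<and> u' < a \<and> f u' = g u"
    using assms[of s] by auto
  have "(INF u\<in>{s..<a}. enat (f u)) \<le> (INF u\<in>{s'..<b}. enat (g u))"
  proof (rule INF_greatest)
    fix u assume "u \<in> {s'..<b}"
    then obtain u' where "s \<le> u'" "u' < a" "f u' = g u" using s' by auto
    then show "(INF u\<in>{s..<a}. enat (f u)) \<le> enat (g u)"
      by (intro INF_lower2[of u']) auto
  qed
  then show "(INF u\<in>{s..<a}. enat (f u)) \<le> (SUP s\<in>{..<b}. INF u\<in>{s..<b}. enat (g u))"
    using \<open>s' < b\<close> by (intro SUP_upper2[of s']) auto
qed

lemma is_succ_le: "is_succ s t \<Longrightarrow> u < t \<Longrightarrow> u \<le> s"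
  by (meson is_succ_def not_le)

lemma is_succ_unique: "is_succ s t \<Longrightarrow> is_succ s' t \<Longrightarrow> s = s'"
  unfolding is_succ_def by (meson linorder_cases)

lemma is_runD:
  assumes "is_run P z i C"
  shows "(\<forall>s. t \<le> s) \<Longrightarrow> C t = init i" "is_succ s t \<Longrightarrow> C t = step P z (C s)"
    "is_limit t \<Longrightarrow> fst (C t) = limit_value (\<lambda>s. fst (C s)) t"
    "is_limit t \<Longrightarrow> snd (C t) m = limit_value (\<lambda>s. snd (C s) m) t"
  using assms unfolding is_run_def by auto

lemma time_cases:
  fixes t :: "'t::wellorder"
  obtains (least) "\<forall>s. t \<le> s" | (succ) s where "is_succ s t" | (limit) "is_limit t"
  unfolding is_limit_def by (meson not_le)

lemma run_ex1: "\<exists>!C :: 't::wellorder \<Rightarrow> config. is_run P z i C"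
proof (rule ex_ex1I)
  define F :: "('t \<Rightarrow> config) \<Rightarrow> 't \<Rightarrow> config" where
    "F f t = (if \<forall>s. t \<le> s then init i
       else if \<exists>s. is_succ s t then step P z (f (THE s. is_succ s t))
       else (limit_value (\<lambda>s. fst (f s)) t, \<lambda>m. limit_value (\<lambda>s. snd (f s) m) t))" for f t
  define C where "C = wfrec {(s, t). s < t} F"
  have adm: "adm_wf {(s, t). s < t} F"
    unfolding adm_wf_def
  proof (intro allI impI)
    fix f g :: "'t \<Rightarrow> config" and t
    assume fg: "\<forall>s. (s, t) \<in> {(s, t). s < t} \<longrightarrow> f s = g s"
    have "f (THE s. is_succ s t) = g (THE s. is_succ s t)" if "is_succ s t" for s
    proof -
      have "(THE s. is_succ s t) = s" using that is_succ_unique by blast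
      then show ?thesis using that fg by (auto simp: is_succ_def)
    qed
    moreover have "limit_value (\<lambda>s. fst (f s)) t = limit_value (\<lambda>s. fst (g s)) t"
      by (rule limit_value_cong) (use fg in auto)
    moreover have "limit_value (\<lambda>s. snd (f s) m) t = limit_value (\<lambda>s. snd (g s) m) t" for m
      by (rule limit_value_cong) (use fg in auto)
    ultimately show "F f t = F g t" by (auto simp: F_def)
  qed
  have C: "C t = F C t" for t
    unfolding C_def using wfrec_fixpoint[OF _ adm] wf by metis
  have "C t = init i" if "\<forall>s. t \<le> s" for t using that by (subst C) (simp add: F_def)
  moreover have "C t = step P z (C s)" if "is_succ s t" for s t
  proof -
    have "(THE s. is_succ s t) = s" using that is_succ_unique by blast
    moreover have "\<not> (\<forall>s. t \<le> s)" using that by (auto simp: is_succ_def not_le)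
    ultimately show ?thesis using that by (subst C) (auto simp: F_def)
  qed
  moreover have "C t = (limit_value (\<lambda>s. fst (C s)) t, \<lambda>m. limit_value (\<lambda>s. snd (C s) m) t)"
    if "is_limit t" for t
  proof -
    have "(\<forall>s. t \<le> s) = False" "(\<exists>s. is_succ s t) = False"
      using that by (auto simp: is_limit_def not_le)
    then show ?thesis by (subst C) (simp only: F_def if_False)
  qed
  ultimately show "\<exists>C :: 't \<Rightarrow> config. is_run P z i C" unfolding is_run_def by blast
next
  fix C D :: "'t \<Rightarrow> config"
  assume C: "is_run P z i C" and D: "is_run P z i D"
  have "C t = D t" for t
  proof (induction t rule: less_induct)
    case (less t)
    show ?case
    proof (cases t rule: time_cases)
      case least
      then show ?thesis using C D is_runD(1) by metis
    next
      case (succ s)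
      then show ?thesis using is_runD(2)[OF C succ] is_runD(2)[OF D succ] less[of s]
        by (auto simp: is_succ_def)
    next
      case limit
      then show ?thesis
        using C D less unfolding is_run_def
        by (auto intro!: limit_value_cong ext)
    qed
  qed
  then show "C = D" by blast
qed

text \<open>Equality of the order types of the intervals from \<open>a0\<close> to \<open>a\<close> and from \<open>b0\<close> to \<open>b\<close>.\<close>

inductive same_type :: "'a::wellorder \<Rightarrow> 'b::wellorder \<Rightarrow> 'a \<Rightarrow> 'b \<Rightarrow> bool" for a0 b0 where
  "a0 \<le> a \<Longrightarrow> b0 \<le> b
   \<Longrightarrow> (\<And>a'. a0 \<le> a' \<Longrightarrow> a' < a \<Longrightarrow> \<exists>b'. b0 \<le> b' \<and> b' < b \<and> same_type a0 b0 a' b')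
   \<Longrightarrow> (\<And>b'. b0 \<le> b' \<Longrightarrow> b' < b \<Longrightarrow> \<exists>a'. a0 \<le> a' \<and> a' < a \<and> same_type a0 b0 a' b')
   \<Longrightarrow> same_type a0 b0 a b"

lemma same_typeD:
  assumes "same_type a0 b0 a b"
  shows "a0 \<le> a" "b0 \<le> b"
    "a0 \<le> a' \<Longrightarrow> a' < a \<Longrightarrow> \<exists>b'. b0 \<le> b' \<and> b' < b \<and> same_type a0 b0 a' b'"
    "b0 \<le> b' \<Longrightarrow> b' < b \<Longrightarrow> \<exists>a'. a0 \<le> a' \<and> a' < a \<and> same_type a0 b0 a' b'"
  using assms by (auto elim: same_type.cases)

lemma same_type_sym: "same_type a0 b0 a b \<Longrightarrow> same_type b0 a0 b a"
proof (induction rule: same_type.induct)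
  case (1 a b)
  show ?case
    by (rule same_type.intros) (use 1 in blast)+
qed

lemma same_type_unique: "same_type a0 b0 a b \<Longrightarrow> same_type a0 b0 a b' \<Longrightarrow> b = b'"
proof (induction a arbitrary: b b' rule: less_induct)
  case (less a)
  have False if *: "same_type a0 b0 a b" "same_type a0 b0 a b'" "b < b'" for b b'
  proof -
    obtain a' where a': "a0 \<le> a'" "a' < a" "same_type a0 b0 a' b"
      using same_typeD(4)[OF *(2) _ *(3)] same_typeD(2)[OF *(1)] by blast
    then obtain b'' where "b'' < b" "same_type a0 b0 a' b''"
      using same_typeD(3)[OF *(1)] by blast
    then show False using less.IH[OF a'(2) a'(3)] by blast
  qed
  then show ?case using less.prems by (meson linorder_cases)
qed

lemma same_type_less:
  "same_type a0 b0 a b \<Longrightarrow> same_type a0 b0 a' b' \<Longrightarrow> a < a' \<Longrightarrow> b < b'"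
  using same_typeD(1) same_typeD(3) same_type_unique by metis

lemma same_type_le:
  "same_type a0 b0 a b \<Longrightarrow> same_type a0 b0 a' b' \<Longrightarrow> a \<le> a' \<Longrightarrow> b \<le> b'"
  using same_type_less same_type_unique by (metis order_le_less)

lemma same_type_succ:
  assumes "same_type a0 b0 a b" "is_succ s a" "a0 \<le> s"
  obtains u where "is_succ u b" "same_type a0 b0 s u"
proof -
  from assms have "s < a" by (simp add: is_succ_def)
  then obtain u where u: "u < b" "same_type a0 b0 s u" using same_typeD(3) assms by blast
  have False if v: "u < v" "v < b" for v
  proof -
    have "b0 \<le> v" using same_typeD(2)[OF u(2)] v by simp
    then obtain s' where s': "s' < a" "same_type a0 b0 s' v"
      using same_typeD(4) assms(1) v by blast
    then have "s' \<le> s" using assms(2) is_succ_le by blast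
    then show False using same_type_le[OF s'(2) u(2)] v by simp
  qed
  then show ?thesis using that u by (auto simp: is_succ_def)
qed

lemma same_type_total:
  assumes "a0 \<le> a"
  shows "(\<exists>b. same_type a0 b0 a b) \<or> (\<forall>b\<ge>b0. \<exists>a'. a0 \<le> a' \<and> a' < a \<and> same_type a0 b0 a' b)"
  using assms
proof (induction a rule: less_induct)
  case (less a)
  show ?case
  proof (rule disjCI)
    assume "\<not> (\<forall>b\<ge>b0. \<exists>a'. a0 \<le> a' \<and> a' < a \<and> same_type a0 b0 a' b)"
    then have ex: "\<exists>b. b0 \<le> b \<and> (\<forall>a'. a0 \<le> a' \<and> a' < a \<longrightarrow> \<not> same_type a0 b0 a' b)" by blast
    define b where "b = (LEAST b. b0 \<le> b \<and> (\<forall>a'. a0 \<le> a' \<and> a' < a \<longrightarrow> \<not> same_type a0 b0 a' b))"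
    have b: "b0 \<le> b" "\<And>a'. a0 \<le> a' \<Longrightarrow> a' < a \<Longrightarrow> \<not> same_type a0 b0 a' b"
      using LeastI_ex[OF ex] unfolding b_def by blast+
    have below: "\<exists>a'. a0 \<le> a' \<and> a' < a \<and> same_type a0 b0 a' b'" if "b0 \<le> b'" "b' < b" for b'
      using not_less_Least[OF that(2)[unfolded b_def]] that(1) by blast
    have "same_type a0 b0 a b"
    proof (rule same_type.intros[OF less.prems b(1) _ below])
      fix a' assume a': "a0 \<le> a'" "a' < a"
      have "\<not> (\<forall>b\<ge>b0. \<exists>a''. a0 \<le> a'' \<and> a'' < a' \<and> same_type a0 b0 a'' b)"
        using b a' by (meson less_trans)
      then obtain b' where b': "same_type a0 b0 a' b'" using less.IH[OF a'(2,1)] by blast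
      have "b' < b"
      proof (rule ccontr)
        assume "\<not> b' < b"
        then have "b' = b \<or> b < b'" by auto
        then show False
          using b' b a' same_typeD(4)[OF b' b(1)] by (meson less_trans)
      qed
      then show "\<exists>b'. b0 \<le> b' \<and> b' < b \<and> same_type a0 b0 a' b'"
        using b' same_typeD(2) by blast
    qed
    then show "\<exists>b. same_type a0 b0 a b" ..
  qed
qed

lemma same_type_liminf:
  fixes f :: "'a::wellorder \<Rightarrow> nat" and g :: "'b::wellorder \<Rightarrow> nat"
  assumes ab: "same_type a0 b0 a b" and "a0 < a"
    and fg: "\<And>a' b'. same_type a0 b0 a' b' \<Longrightarrow> a' < a \<Longrightarrow> f a' = g b'"
  shows "liminf_below f a \<le> liminf_below g b"
proof (rule liminf_below_mono)
  fix s assume "s < a"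
  then have s: "a0 \<le> max s a0" "max s a0 < a" using assms by auto
  then obtain s' where s': "b0 \<le> s'" "s' < b" "same_type a0 b0 (max s a0) s'"
    using same_typeD(3)[OF ab] by blast
  have "\<exists>u'. s \<le> u' \<and> u' < a \<and> f u' = g u" if u: "s' \<le> u" "u < b" for u
  proof -
    obtain u' where u': "u' < a" "same_type a0 b0 u' u"
      using same_typeD(4)[OF ab, of u] s' u by (meson order_trans)
    have "\<not> u' < max s a0" using same_type_less[OF u'(2) s'(3)] u by auto
    then have "s \<le> u'" by (simp add: not_less)
    then show ?thesis using fg[OF u'(2,1)] u'(1) by blast
  qed
  then show "\<exists>s'<b. \<forall>u. s' \<le> u \<and> u < b \<longrightarrow> (\<exists>u'. s \<le> u' \<and> u' < a \<and> f u' = g u)"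
    using s' by blast
qed

lemma same_type_limit_value:
  fixes f :: "'a::wellorder \<Rightarrow> nat" and g :: "'b::wellorder \<Rightarrow> nat"
  assumes ab: "same_type a0 b0 a b" and "a0 < a" "b0 < b"
    and fg: "\<And>a' b'. same_type a0 b0 a' b' \<Longrightarrow> a' < a \<Longrightarrow> f a' = g b'"
  shows "limit_value f a = limit_value g b"
proof -
  have "g b' = f a'" if "same_type b0 a0 b' a'" "b' < b" for a' b'
  proof -
    note st = same_type_sym[OF that(1)]
    have "a' < a" using same_type_less[OF that(1) same_type_sym[OF ab] that(2)] .
    then show ?thesis using fg[OF st] by simp
  qed
  then have "liminf_below g b \<le> liminf_below f a"
    using same_type_liminf[OF same_type_sym[OF ab] assms(3), of g f] by blast
  moreover have "liminf_below f a \<le> liminf_below g b"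
    by (rule same_type_liminf[OF ab assms(2)]) (rule fg)
  ultimately show ?thesis
    by (simp add: limit_value_def)
qed

lemma run_transport:
  assumes C: "is_run P z i C" and D: "is_run P z j D" and "C a0 = D b0"
    and "same_type a0 b0 a b"
  shows "C a = D b"
  using assms(4)
proof (induction a arbitrary: b rule: less_induct)
  case (less a)
  note ab = less.prems
  have ge: "a0 \<le> a" "b0 \<le> b" using same_typeD[OF ab] by auto
  show ?case
  proof (cases "a = a0")
    case True
    then have "b = b0"
      using ge same_typeD(4)[OF ab, of b0] by force
    then show ?thesis using True assms by simp
  next
    case False
    then have a: "a0 < a" using ge by simp
    then have b: "b0 < b" using same_typeD(3)[OF ab, of a0] by auto
    show ?thesis
    proof (cases a rule: time_cases)
      case least
      then show ?thesis using a by (meson leD)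
    next
      case (succ s)
      then have "a0 \<le> s" using a is_succ_le by blast
      then obtain u where "is_succ u b" "same_type a0 b0 s u"
        using same_type_succ[OF ab succ] by blast
      then show ?thesis
        using is_runD(2)[OF C succ] is_runD(2)[OF D] less.IH[of s u] succ by (auto simp: is_succ_def)
    next
      case limit
      have "is_limit b"
      proof (cases b rule: time_cases)
        case least
        then show ?thesis using b by (meson leD)
      next
        case (succ s)
        then have "b0 \<le> s" using b is_succ_le by blast
        then obtain u where "is_succ u a"
          using same_type_succ[OF same_type_sym[OF ab] succ] by blast
        then show ?thesis using limit by (auto simp: is_limit_def)
      qed
      moreover have "limit_value (\<lambda>s. fst (C s)) a = limit_value (\<lambda>s. fst (D s)) b"
        by (rule same_type_limit_value[OF ab a b]) (simp add: less.IH)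
      moreover have "limit_value (\<lambda>s. snd (C s) m) a = limit_value (\<lambda>s. snd (D s) m) b" for m
        by (rule same_type_limit_value[OF ab a b]) (simp add: less.IH)
      ultimately show ?thesis
        using C D limit unfolding is_run_def by auto
    qed
  qed
qed

lemma limit_valueI:
  assumes "is_limit t" "\<And>s. s < t \<Longrightarrow> g s = 0" shows "limit_value g t = (0::nat)"
proof -
  obtain s where "s < t" using assms by (auto simp: is_limit_def)
  then show ?thesis by (rule limit_value_eqI) (use assms in auto)
qed

lemma countable_run:
  assumes C: "is_run P z i C"
  shows "countable (range C)"
proof -
  define regs where "regs I = (case I of Zero m \<Rightarrow> m | Succ m \<Rightarrow> m | Copy m n \<Rightarrow> n
    | JumpEq m n k \<Rightarrow> 0 | Oracle m \<Rightarrow> m)" for I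
  define N where "N = Suc (\<Sum>I\<leftarrow>P. regs I)"
  have N: "regs I < N" if "I \<in> set P" for I
    using that unfolding N_def by (simp add: member_le_sum_list less_Suc_eq_le)
  have exec: "snd (exec z I c) m = snd c m" if "regs I < m" for I c m
    using that by (cases I; cases c) (auto simp: regs_def)
  have supp: "snd (C t) m = 0" if "N \<le> m" for t m
  proof (induction t rule: less_induct)
    case (less t)
    show ?case
    proof (cases t rule: time_cases)
      case least
      then show ?thesis using is_runD(1)[OF C] that by (simp add: init_def N_def)
    next
      case (succ s)
      then have "s < t" by (simp add: is_succ_def)
      then show ?thesis
        using is_runD(2)[OF C succ] less[of s] that N[of "P ! fst (C s)"]
        by (auto simp: step_def halted_def not_le exec)
    next
      case limit
      then show ?thesis
        using is_runD(4)[OF C limit] limit_valueI[OF limit] less by simp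
    qed
  qed
  have "inj_on (\<lambda>(l, R). (l, map R [0..<N])) (range C)"
  proof (rule inj_onI, clarsimp)
    fix l R l' R' s t
    assume *: "(l, R) = C s" "(l', R') = C t" and eq: "\<forall>x\<in>{0..<N}. R x = R' x"
    have "R m = R' m" for m
      using supp[of m s] supp[of m t] eq *[symmetric] by (cases "m < N") auto
    then show "R = R'" by blast
  qed
  then show ?thesis
    by (rule countableI')
qed

lemma halting_time_countable:
  fixes C :: "'t::wellorder \<Rightarrow> config"
  assumes C: "is_run P z i C" and t: "halted P (C t)" and least: "\<And>s. s < t \<Longrightarrow> \<not> halted P (C s)"
  shows "countable {..<t}"
proof (rule ccontr)
  assume unc: "\<not> countable {..<t}"
  define a where "a = (LEAST a :: 't. \<not> countable {..<a})"
  have a: "\<not> countable {..<a}" "a \<le> t" and below: "\<And>s. s < a \<Longrightarrow> countable {..<s}"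
    unfolding a_def using LeastI[of "\<lambda>a. \<not> countable {..<a}", OF unc]
      Least_le[of "\<lambda>a. \<not> countable {..<a}", OF unc] not_less_Least by blast+
  have bound: "\<exists>b<a. \<forall>s\<in>S. s < b" if S: "countable S" "\<And>s. s \<in> S \<Longrightarrow> s < a" for S
  proof (rule ccontr)
    assume *: "\<not> ?thesis"
    have "{..<a} \<subseteq> (\<Union>s\<in>S. insert s {..<s})"
    proof
      fix x assume "x \<in> {..<a}"
      then obtain s where "s \<in> S" "x \<le> s" using * by (meson lessThan_iff not_less)
      then show "x \<in> (\<Union>s\<in>S. insert s {..<s})" by (auto simp: order_le_less)
    qed
    moreover have "countable (\<Union>s\<in>S. insert s {..<s})"
      using S below by (intro countable_UN) auto
    ultimately show False using a countable_subset by blast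
  qed
  define E where "E = {d. \<forall>s<a. \<exists>u. s \<le> u \<and> u < a \<and> C u = d}"
  have occ: "\<exists>u. s \<le> u \<and> u < a \<and> C u = d" if "d \<in> E" "s < a" for d s
    using that by (auto simp: E_def)
  have a_ne: "\<exists>s. s < a" using bound[of "{}"] by auto
  have "E \<subseteq> range C" using a_ne occ by blast
  then have cE: "countable E" using countable_run[OF C] countable_subset by blast
  obtain b where b: "b < a" "\<And>u. b \<le> u \<Longrightarrow> u < a \<Longrightarrow> C u \<in> E"
  proof -
    have "\<forall>d\<in>range C - E. \<exists>s<a. \<forall>u. s \<le> u \<and> u < a \<longrightarrow> C u \<noteq> d" by (auto simp: E_def)
    then obtain f where f: "\<And>d. d \<in> range C - E \<Longrightarrow> f d < a"
      "\<And>d u. d \<in> range C - E \<Longrightarrow> f d \<le> u \<Longrightarrow> u < a \<Longrightarrow> C u \<noteq> d" by metis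
    have "countable (f ` (range C - E))" using countable_run[OF C] by simp
    then obtain b where "b < a" "\<forall>s\<in>f ` (range C - E). s < b"
      using bound[of "f ` (range C - E)"] f(1) by blast
    then have "b < a" "\<And>d. d \<in> range C - E \<Longrightarrow> f d < b" by blast+
    moreover from this have "C u \<in> E" if "b \<le> u" "u < a" for u
      using f(2)[of "C u" u] that by (meson DiffI less_imp_le order_trans rangeI)
    ultimately show ?thesis using that by blast
  qed
  have "\<exists>s'. s < s' \<and> s' < a \<and> (\<forall>d\<in>E. \<exists>u. s \<le> u \<and> u < s' \<and> C u = d)" if s: "s < a" for s
  proof -
    obtain f where f: "\<And>d. d \<in> E \<Longrightarrow> s \<le> f d \<and> f d < a \<and> C (f d) = d"
      using occ[OF _ s] by metis
    have "countable (insert s (f ` E))" using cE by simp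
    then obtain s' where "s' < a" "\<forall>u\<in>insert s (f ` E). u < s'"
      using bound[of "insert s (f ` E)"] f s by blast
    then show ?thesis using f by blast
  qed
  then obtain nxt where nxt: "\<And>s. s < a \<Longrightarrow> s < nxt s \<and> nxt s < a"
    "\<And>s d. s < a \<Longrightarrow> d \<in> E \<Longrightarrow> \<exists>u. s \<le> u \<and> u < nxt s \<and> C u = d" by metis
  define del where "del n = (nxt ^^ n) b" for n
  have del_a: "del n < a" for n by (induction n) (use b nxt in \<open>auto simp: del_def\<close>)
  have "\<exists>v. v < a \<and> (\<forall>n. del n < v)" using bound[of "range del"] del_a by auto
  then obtain v where v: "v < a" "\<forall>n. del n < v" by blast
  define dd where "dd = (LEAST v. \<forall>n. del n < v)"
  have dd: "\<And>n. del n < dd" and "dd \<le> v" and dd_least: "\<And>s. s < dd \<Longrightarrow> \<exists>n. s \<le> del n"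
    unfolding dd_def using LeastI[of "\<lambda>v. \<forall>n. del n < v", OF v(2)]
      Least_le[of "\<lambda>v. \<forall>n. del n < v", OF v(2)] not_less_Least not_less by blast+
  then have dd_a: "dd < a" using v by simp
  have b_dd: "b < dd" using dd[of 0] by (simp add: del_def)
  have occ_dd: "\<exists>u. s \<le> u \<and> u < dd \<and> C u = d" if d: "d \<in> E" and s: "s < dd" for d s
  proof -
    obtain n where n: "s \<le> del n" using dd_least s by blast
    obtain u where "del n \<le> u" "u < nxt (del n)" "C u = d" using nxt(2)[OF del_a d] by blast
    moreover have "nxt (del n) = del (Suc n)" by (simp add: del_def)
    ultimately show ?thesis using dd[of "Suc n"] n by (intro exI[of _ u]) auto
  qed
  have E_ne: "E \<noteq> {}" using b by blast
  have min_ex: "\<exists>d\<in>E. \<forall>d'\<in>E. f d \<le> f d'" for f :: "config \<Rightarrow> nat"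
    using E_ne ex_has_least_nat[of "\<lambda>d. d \<in> E" _ f] by blast
  have is_lim: "is_limit s" if "v < s" "\<And>r. r < s \<Longrightarrow> \<exists>u. r < u \<and> u < s" for s v :: 't
    using that unfolding is_limit_def is_succ_def by blast
  have dd_lim: "is_limit dd"
  proof (rule is_lim[OF b_dd])
    fix r assume "r < dd"
    then obtain n where "r \<le> del n" using dd_least by blast
    also have "del n < del (Suc n)" using nxt(1)[OF del_a] by (simp add: del_def)
    finally show "\<exists>u. r < u \<and> u < dd" using dd by blast
  qed
  define M where "M = C dd"
  have M_E: "M \<in> E" using b b_dd dd_a by (auto simp: M_def)
  have M_min_aux: "limit_value (\<lambda>s. f (C s)) dd \<le> f d" if d: "d \<in> E" for d and f :: "config \<Rightarrow> nat"
  proof -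
    obtain e where e: "e \<in> E" "\<forall>d'\<in>E. f e \<le> f d'" using min_ex by blast
    have "limit_value (\<lambda>s. f (C s)) dd = f e"
    proof (rule limit_value_eqI[OF b_dd])
      fix u assume "b \<le> u" "u < dd"
      then show "f e \<le> f (C u)" using e b dd_a by (meson less_trans)
    next
      fix s assume "s < dd"
      then show "\<exists>u. s \<le> u \<and> u < dd \<and> f (C u) = f e" using occ_dd[OF e(1)] by blast
    qed
    then show ?thesis using e d by simp
  qed
  have M_min: "fst M \<le> fst d" "snd M m \<le> snd d m" if "d \<in> E" for d m
    using M_min_aux[OF that, of fst] M_min_aux[OF that, of "\<lambda>d. snd d m"]
      is_runD(3,4)[OF C dd_lim] by (simp_all add: M_def)
  have lim_M: "C s = M"
    if "is_limit s" "dd < s" "\<And>u. dd \<le> u \<Longrightarrow> u < s \<Longrightarrow> C u \<in> E"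
      "\<And>r. r < s \<Longrightarrow> \<exists>u. r \<le> u \<and> u < s \<and> C u = M" for s
  proof -
    have "limit_value (\<lambda>s. fst (C s)) s = fst M"
      by (rule limit_value_eqI[OF that(2)]) (use M_min that in blast)+
    moreover have "limit_value (\<lambda>s. snd (C s) m) s = snd M m" for m
      by (rule limit_value_eqI[OF that(2)]) (use M_min that in blast)+
    ultimately show ?thesis
      using is_runD(3,4)[OF C that(1)] by (auto intro!: prod_eqI ext)
  qed
  obtain dd' where dd': "dd < dd'" "dd' < a" "C dd' = M"
  proof -
    obtain s where s: "dd < s" "s < a" using bound[of "{dd}"] dd_a by auto
    obtain u where "s \<le> u" "u < a" "C u = M" using occ[OF M_E s(2)] by blast
    then show ?thesis using s by (intro that[of u]) auto
  qed
  have in_E: "C s \<in> E" if "dd \<le> s" for s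
    using that
  proof (induction s rule: less_induct)
    case (less s)
    show ?case
    proof (cases "s = dd")
      case True
      then show ?thesis using M_E by (simp add: M_def)
    next
      case False
      then have s: "dd < s" using less by simp
      have IH: "C u \<in> E" if "dd \<le> u" "u < s" for u using less that by blast
      show ?thesis
      proof (cases s rule: time_cases)
        case least
        then show ?thesis using s by (meson leD)
      next
        case (succ r)
        then have "dd \<le> r" "r < s" using s is_succ_le[of r s dd] by (auto simp: is_succ_def)
        then have "C r \<in> E" using IH by blast
        then obtain u where u: "b \<le> u" "u < a" "C u = C r" using occ b by blast
        then have ex: "\<exists>u'. u < u' \<and> u' < a" using bound[of "{u}"] by auto
        then obtain u0 where u0: "u < u0" "u0 < a" by blast
        define u' where "u' = (LEAST u'. u < u')"
        have "u < u'" "u' \<le> u0" "\<And>w. u < w \<Longrightarrow> \<not> w < u'"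
          unfolding u'_def using LeastI[of "\<lambda>w. u < w", OF u0(1)] Least_le[of "\<lambda>w. u < w"] u0
          by (auto simp: not_less)
        then have "is_succ u u'" "b \<le> u'" "u' < a" using u u0 by (auto simp: is_succ_def)
        then have "C u' = C s" "C u' \<in> E"
          using is_runD(2)[OF C \<open>is_succ u u'\<close>] is_runD(2)[OF C succ] u b(2)[of u'] by simp_all
        then show ?thesis by simp
      next
        case limit
        show ?thesis
        proof (cases "\<forall>r<s. \<exists>u. r \<le> u \<and> u < s \<and> C u = M")
          case True
          then have "C s = M" using lim_M[OF limit s IH] by blast
          then show ?thesis using M_E by simp
        next
          case False
          then obtain r where r: "r < s" "\<And>u. r \<le> u \<Longrightarrow> u < s \<Longrightarrow> C u \<noteq> M" by blast
          define Z where "Z = {u. dd \<le> u \<and> u < s \<and> C u = M}"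
          have dd_Z: "dd \<in> Z" using s by (simp add: Z_def M_def)
          have Zr: "\<forall>u\<in>Z. u \<le> r"
          proof
            fix u assume "u \<in> Z"
            then have "u < s" "C u = M" by (auto simp: Z_def)
            then show "u \<le> r" using r(2)[of u] by (meson linear)
          qed
          define s0 where "s0 = (LEAST v. \<forall>u\<in>Z. u \<le> v)"
          have s0: "\<And>u. u \<in> Z \<Longrightarrow> u \<le> s0" "s0 \<le> r" "\<And>w. w < s0 \<Longrightarrow> \<exists>u\<in>Z. w < u"
            unfolding s0_def using LeastI[of "\<lambda>v. \<forall>u\<in>Z. u \<le> v", OF Zr]
              Least_le[of "\<lambda>v. \<forall>u\<in>Z. u \<le> v", OF Zr] not_less_Least[of _ "\<lambda>v. \<forall>u\<in>Z. u \<le> v"]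
            by (auto simp: not_le)
          have s0_s: "s0 < s" using s0(2) r by simp
          have dd_s0: "dd \<le> s0" using s0(1) dd_Z by blast
          have s0_Z: "s0 \<in> Z"
          proof (rule ccontr)
            assume nZ: "s0 \<notin> Z"
            then have lt: "\<exists>u\<in>Z. w < u \<and> u < s0" if "w < s0" for w
              using s0(3)[OF that] s0(1) by (metis order_le_less)
            have "dd < s0" using dd_s0 nZ dd_Z by (auto simp: order_le_less)
            moreover have "is_limit s0"
              by (rule is_lim[OF \<open>dd < s0\<close>]) (use lt in blast)
            ultimately have "C s0 = M"
              using lt s0_s IH by (intro lim_M) (auto simp: Z_def intro: less_imp_le)
            then show False using nZ dd_s0 s0_s by (simp add: Z_def)
          qed
          then have eq: "C s0 = C dd" by (simp add: Z_def M_def)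
          have no: False if *: "s0 \<le> w" "w < s" "same_type s0 dd w dd'" for w
          proof -
            have "C w = M" using run_transport[OF C C eq *(3)] dd' by simp
            then have "w \<in> Z" using * dd_s0 by (auto simp: Z_def)
            then have "w = s0" using s0(1)[of w] * by simp
            moreover have "same_type s0 dd s0 dd" by (rule same_type.intros) auto
            ultimately show False using same_type_unique *(3) dd'(1) by blast
          qed
          then obtain q where q: "same_type s0 dd s q"
            using same_type_total[of s0 s dd] s0_s dd' by (meson less_imp_le)
          have "q < a"
          proof (rule ccontr)
            assume "\<not> q < a"
            then have "dd' < q" using dd' by simp
            then show False using same_typeD(4)[OF q, of dd'] dd' no by (meson less_imp_le)
          qed
          then have "C q \<in> E" using same_typeD(2)[OF q] b b_dd by (meson less_imp_le order_trans)
          then show ?thesis using run_transport[OF C C eq q] by simp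
        qed
      qed
    qed
  qed
  then have "C t \<in> E" using dd_a a by simp
  then obtain u where "u < a" "C u = C t" using occ a_ne by blast
  then show False using least[of u] t a(2) by (metis less_le_trans)
qed

lemma uncountable_time:
  includes cardinal_syntax
  shows "\<not> countable (UNIV :: time set)"
proof
  assume "countable (UNIV :: time set)"
  then have "countable (Rep_time ` UNIV)" by simp
  moreover have "Rep_time ` UNIV = Field (cardSuc natLeq)"
    using type_definition.Rep_range[OF type_definition_time] by simp
  ultimately have "|Field (cardSuc natLeq)| \<le>o natLeq"
    by (metis countable_card_le_natLeq)
  moreover have "|Field (cardSuc natLeq)| =o cardSuc natLeq"
    by (simp add: card_of_Field_ordIso cardSuc_Card_order natLeq_Card_order)
  ultimately have "cardSuc natLeq \<le>o natLeq"
    using ordIso_ordLeq_trans ordIso_symmetric by blast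
  then show False
    using cardSuc_greater[OF natLeq_Card_order] not_ordLess_ordLeq by blast
qed

theorem halts_with_any_time:
  fixes C :: "'t::wellorder \<Rightarrow> config"
  assumes C: "is_run P z i C" and t: "halted P (C t)"
  shows "halts_with P z i (snd (C t) 0)"
proof -
  define t0 where "t0 = (LEAST t. halted P (C t))"
  have t0: "halted P (C t0)" "\<And>s. s < t0 \<Longrightarrow> \<not> halted P (C s)"
    unfolding t0_def using LeastI[of "\<lambda>t. halted P (C t)", OF t] not_less_Least by blast+
  have "C s = C t0" if "t0 \<le> s" for s
    using that
  proof (induction s rule: less_induct)
    case (less s)
    show ?case
    proof (cases "s = t0")
      case False
      then have s: "t0 < s" using less by simp
      show ?thesis
      proof (cases s rule: time_cases)
        case least
        then show ?thesis using s by (meson leD)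
      next
        case (succ r)
        then have "t0 \<le> r" "r < s" using s is_succ_le[of r s t0] by (auto simp: is_succ_def)
        then have "C r = C t0" using less.IH by blast
        then show ?thesis using is_runD(2)[OF C succ] t0(1) by (simp add: step_def)
      next
        case limit
        have "limit_value (\<lambda>s. f (C s)) s = f (C t0)" for f
        proof (rule limit_value_eqI[OF s])
          fix r assume "r < s"
          then show "\<exists>u. r \<le> u \<and> u < s \<and> f (C u) = f (C t0)"
            using less.IH[of "max r t0"] s by (intro exI[of _ "max r t0"]) auto
        next
          fix u assume "t0 \<le> u" "u < s"
          then have "C u = C t0" using less.IH by blast
          then show "f (C t0) \<le> f (C u)" by simp
        qed
        from this[of fst] this[of "\<lambda>c. snd c m" for m] show ?thesis
          using is_runD(3,4)[OF C limit] by (auto intro!: prod_eqI ext)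
      qed
    qed simp
  qed
  moreover have "t0 \<le> t" unfolding t0_def using t by (rule Least_le)
  ultimately have eq: "C t = C t0" by blast
  obtain D :: "time \<Rightarrow> config" where D: "is_run P z i D" using run_ex1 by blast
  define a0 :: 't where "a0 = (LEAST a. True)"
  define b0 :: time where "b0 = (LEAST b. True)"
  have a0: "a0 \<le> a" for a unfolding a0_def by (rule Least_le) simp
  have b0: "b0 \<le> b" for b unfolding b0_def by (rule Least_le) simp
  have "C a0 = D b0" using is_runD(1)[OF C] is_runD(1)[OF D] a0 b0 by metis
  moreover obtain b where "same_type a0 b0 t0 b"
  proof -
    have False if "\<forall>b\<ge>b0. \<exists>a'. a0 \<le> a' \<and> a' < t0 \<and> same_type a0 b0 a' b"
    proof -
      from that obtain f where f: "\<And>b. f b < t0 \<and> same_type a0 b0 (f b) b" using b0 by metis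
      have "inj f"
        using f same_type_unique by (metis injI)
      moreover have "countable (range f)"
        using halting_time_countable[OF C t0] f
        by (meson countable_subset image_subsetI lessThan_iff)
      ultimately show False using uncountable_time countable_image_inj_on by blast
    qed
    then show ?thesis using that same_type_total[of a0 t0 b0] a0 by blast
  qed
  ultimately have "C t0 = D b" using run_transport[OF C D] by blast
  then show ?thesis using D t0(1) eq unfolding halts_with_def by metis
qed

end

theory Submission
  imports Defs "HOL-Library.Nat_Bijection"
begin

text \<open>
  An ITRM can decide well-foundedness of trees, by a depth-first search in which an infinite
  branch makes the register holding the current node overflow. Hence it decides membership in
  sets that are inductively defined by rules with countably many premises.

  Halting of an ITRM is obtained from finitely many such inductive definitions. Up to the first
  overflow of a register, reachability is the least fixed point of a positive arithmetical
  operator; adding the jump over that overflow and iterating, the number of levels needed is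
  bounded by the number of registers. So the halting relation is decidable uniformly in the
  oracle. Moreover, the Cohen forcing relation of an inductively defined set is again inductively
  defined, so the relation \<open>p\<close> forces that \<open>P\<close> halts on \<open>i\<close> with output \<open>b\<close> is ITRM-computable.

  Now let \<open>P\<close> compute \<open>x\<close> from \<open>y\<close>. Since \<open>x\<close> is recognizable, the set of all \<open>z\<close> from which \<open>P\<close>
  computes \<open>x\<close> is decidable; it contains \<open>y\<close>, so it is not meager. Therefore some condition \<open>s\<close>
  is such that no extension of \<open>s\<close> forces a wrong value of \<open>x\<close> and the right values are forced
  densely below \<open>s\<close>, and \<open>x\<close> can be read off the forcing relation.
\<close>

section \<open>The time axis\<close>

text \<open>Two demands shape the proof. A decider for the set of all \<open>z\<close> from which
  \<open>P\<close> computes \<open>x\<close> has to halt on every oracle, although \<open>P\<close>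
  itself may run forever on some of them; so \<open>P\<close> cannot simply be run, and its halting
  relation is needed as a total decidable relation. Secondly, forcing has to be decided with no
  generic oracle at hand, so it cannot be found by simulation either. Both are met by one class,
  \<open>good\<close>: relations that are decidable uniformly in the oracle and that agree, on a
  comeager set of oracles, with an open relation read off from a decidable set of conditions
  independent of the oracle. The class is closed under Boolean operations, number quantifiers and
  inductive definitions. Closure under negation is what admits the jump, in which the earlier
  reachability relation occurs negatively, between one inductive definition and the next. Since the
  set \<open>w z\<close> extracted from \<open>P\<close> is again good, it can serve as the oracle
  of the recognizing program.\<close>

lemma countable_below_time:
  includes cardinal_syntax
  shows "countable {..<t::time}"
proof -
  let ?r = "cardSuc natLeq"
  have co: "Card_order ?r" by (rule cardSuc_Card_order[OF natLeq_Card_order])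
  have "|underS ?r (Rep_time t)| <o ?r"
    by (rule card_of_underS[OF co Rep_time])
  then have "|underS ?r (Rep_time t)| \<le>o natLeq"
    using cardSuc_ordLeq_ordLess[OF natLeq_Card_order card_of_Card_order] by blast
  then have "countable (underS ?r (Rep_time t))" by (simp add: countable_card_le_natLeq)
  moreover have "Rep_time ` {..<t} \<subseteq> underS ?r (Rep_time t)"
    by (auto simp: underS_def less_time_def less_eq_time.rep_eq Rep_time_inject)
  ultimately have "countable (Rep_time ` {..<t})" by (rule countable_subset[rotated])
  then show ?thesis
    by (rule countable_image_inj_on) (auto simp: inj_on_def Rep_time_inject)
qed

text \<open>Regularity of the first uncountable ordinal: countably many countable initial segments
  cannot exhaust an uncountable order.\<close>

lemma time_bounded:
  fixes S :: "time set"
  assumes "countable S"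
  shows "\<exists>t. \<forall>s\<in>S. s < t"
proof (rule ccontr)
  assume *: "\<not> ?thesis"
  have "UNIV \<subseteq> (\<Union>s\<in>S. insert s {..<s})"
  proof
    fix x :: time
    obtain s where "s \<in> S" "x \<le> s" using * by (meson not_less)
    then show "x \<in> (\<Union>s\<in>S. insert s {..<s})" by (auto simp: order_le_less)
  qed
  moreover have "countable (\<Union>s\<in>S. insert s {..<s})"
    using assms countable_below_time by (intro countable_UN) auto
  ultimately show False using uncountable_time countable_subset by blast
qed

lemma time_succ:
  fixes t :: time
  obtains t' where "is_succ t t'"
proof -
  obtain u where "t < u" using time_bounded[of "{t}"] by auto
  then have "t < (LEAST u. t < u)" "\<And>w. w < (LEAST u. t < u) \<Longrightarrow> \<not> t < w"
    by (auto intro: LeastI dest: not_less_Least)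
  then show ?thesis by (intro that[of "LEAST u. t < u"]) (auto simp: is_succ_def)
qed

lemma time_sup:
  fixes f :: "nat \<Rightarrow> time"
  assumes "\<And>k. f k < f (Suc k)"
  obtains t where "\<And>k. f k < t" "\<And>s. s < t \<Longrightarrow> \<exists>k. s < f k" "is_limit t"
proof -
  have ex: "\<exists>t. \<forall>k. f k < t" using time_bounded[of "range f"] by auto
  define t where "t = (LEAST t. \<forall>k. f k < t)"
  have t: "f k < t" for k unfolding t_def using LeastI_ex[OF ex] by blast
  have below: "\<exists>k. s < f k" if s: "s < t" for s
  proof -
    obtain k where "\<not> f k < s"
      using not_less_Least[of s "\<lambda>t. \<forall>k. f k < t"] s unfolding t_def by blast
    then have "s < f (Suc k)" using assms[of k] by simp
    then show ?thesis ..
  qed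
  moreover have "is_limit t"
    unfolding is_limit_def is_succ_def using t below by blast
  ultimately show ?thesis using t that by blast
qed

lemma limit_value_overflow:
  assumes "\<And>v. \<exists>s<t. \<forall>u. s \<le> u \<and> u < t \<longrightarrow> v \<le> g u"
  shows "limit_value g t = 0"
proof -
  have "enat v \<le> liminf_below g t" for v
  proof -
    obtain s where "s < t" "\<forall>u. s \<le> u \<and> u < t \<longrightarrow> v \<le> g u" using assms by blast
    then show ?thesis unfolding liminf_below_def
      by (intro SUP_upper2[of s] INF_greatest) auto
  qed
  then have "liminf_below g t = \<infinity>"
    by (metis enat_ord_code(4) enat_ord_simps(1) enat.exhaust le_antisym not_less_eq_eq order_refl)
  then show ?thesis by (simp add: limit_value_def)
qed

section \<open>Structured transfinite programs\<close>

text \<open>Limit inferior of a sequence of type omega, reset to 0 on overflow.\<close>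

definition lval :: "(nat \<Rightarrow> nat) \<Rightarrow> nat"
  where "lval f = (if \<exists>v. \<exists>\<^sub>\<infinity>k. f k = v then LEAST v. \<exists>\<^sub>\<infinity>k. f k = v else 0)"

lemma lval_const [simp]: "lval (\<lambda>_. v) = v"
  unfolding lval_def by (auto intro!: Least_equality)

lemma lval_overflow:
  assumes "\<And>v. \<exists>N. \<forall>k\<ge>N. v < f k"
  shows "lval f = 0"
proof -
  have "\<not> (\<exists>\<^sub>\<infinity>k. f k = v)" for v
    using assms[of v] unfolding INFM_nat_le by (metis less_irrefl)
  then show ?thesis unfolding lval_def by presburger
qed

lemma lval_eqI:
  assumes "\<exists>\<^sub>\<infinity>k. f k = v" "\<forall>k. v \<le> f k"
  shows "lval f = v"
proof -
  have "(LEAST v. \<exists>\<^sub>\<infinity>k. f k = v) = v"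
    using assms by (intro Least_equality) (auto simp: INFM_nat_le)
  then show ?thesis using assms(1) unfolding lval_def by presburger
qed

text \<open>If no value below \<open>v\<close> recurs, finitely many tails exclude all of them, so
  the sequence is eventually at least \<open>v\<close>. Applied to the least recurring value this
  gives the first case; if nothing recurs, it applies to every \<open>v\<close> and gives the
  second.\<close>

lemma lval_cases:
  obtains (fin) N where "\<And>k. N \<le> k \<Longrightarrow> lval f \<le> f k" "\<And>N. \<exists>k\<ge>N. f k = lval f"
  | (ovf) "\<And>v. \<exists>N. \<forall>k\<ge>N. v \<le> f k" "lval f = 0"
proof (cases "\<exists>v. \<exists>\<^sub>\<infinity>k. f k = v")
  case True
  define v where "v = lval f"
  have v_eq: "v = (LEAST v. \<exists>\<^sub>\<infinity>k. f k = v)" using True unfolding v_def lval_def by presburger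
  have v: "\<exists>\<^sub>\<infinity>k. f k = v" unfolding v_eq using True by (rule LeastI_ex)
  have least: "\<not> (\<exists>\<^sub>\<infinity>k. f k = w)" if "w < v" for w
    using not_less_Least that unfolding v_eq by blast
  have "\<forall>\<^sub>\<infinity>k. \<forall>w\<in>{..<v}. f k \<noteq> w"
    using least by (intro eventually_ball_finite) (auto simp: not_INFM)
  then obtain N where "\<forall>k\<ge>N. \<forall>w<v. f k \<noteq> w" by (auto simp: MOST_nat_le)
  then have "v \<le> f k" if "N \<le> k" for k using that linorder_not_le by blast
  then show ?thesis using fin[of N] v by (auto simp: v_def INFM_nat_le)
next
  case False
  have "\<exists>N. \<forall>k\<ge>N. v \<le> f k" for v
  proof -
    have "\<forall>\<^sub>\<infinity>k. \<forall>w\<in>{..<v}. f k \<noteq> w"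
      using False by (intro eventually_ball_finite) (auto simp: not_INFM)
    then obtain N where "\<forall>k\<ge>N. \<forall>w<v. f k \<noteq> w" by (auto simp: MOST_nat_le)
    then show ?thesis using linorder_not_le by blast
  qed
  then show ?thesis using ovf False by (simp add: lval_def)
qed

text \<open>\<open>Loop r s a\<close> repeats \<open>a\<close> while registers \<open>r\<close> and
  \<open>s\<close> differ. There is no conditional; a loop run at most once replaces it, see
  \<open>wp_once\<close>.\<close>

datatype com = Ins instr | Seq com com (infixr ";;" 60) | Loop nat nat com

type_synonym regs = "nat \<Rightarrow> nat"

fun com_len :: "com \<Rightarrow> nat" where
  "com_len (Ins I) = 1"
| "com_len (Seq a b) = com_len a + com_len b"
| "com_len (Loop r s a) = com_len a + 2"

text \<open>The head of a loop is the least line of its code. At a limit of iterations it has been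
  passed cofinally often, so the limit inferior of the program lines is the head again and the loop
  continues through limits without further code. \<open>JumpEq 0 0 n\<close> is an unconditional
  jump.\<close>

fun compile :: "nat \<Rightarrow> com \<Rightarrow> program" where
  "compile n (Ins I) = [I]"
| "compile n (Seq a b) = compile n a @ compile (n + com_len a) b"
| "compile n (Loop r s a) =
     JumpEq r s (n + com_len a + 2) # compile (Suc n) a @ [JumpEq 0 0 n]"

lemma length_compile [simp]: "length (compile n c) = com_len c"
  by (induction c arbitrary: n) auto

text \<open>
  The last argument of both relations is the componentwise minimum of the registers over the
  computation. Limits of runs of a loop are then limits inferior of these minima, so that every
  limit time of countable cofinality can be handled by a rule with countably many premises.
\<close>

inductive big_step :: "nat set \<Rightarrow> com \<Rightarrow> regs \<Rightarrow> regs \<Rightarrow> regs \<Rightarrow> bool"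
  and loop_step :: "nat set \<Rightarrow> nat \<Rightarrow> nat \<Rightarrow> com \<Rightarrow> regs \<Rightarrow> regs \<Rightarrow> regs \<Rightarrow> bool"
  for z where
  Ins: "(\<And>l. exec z I (l, R) = (Suc l, R')) \<Longrightarrow> big_step z (Ins I) R R' R"
| Seq: "big_step z a R R1 m1 \<Longrightarrow> big_step z b R1 R2 m2
    \<Longrightarrow> big_step z (Seq a b) R R2 (\<lambda>j. min (m1 j) (m2 j))"
| Exit: "R r = R s \<Longrightarrow> big_step z (Loop r s a) R R R"
| Loop: "loop_step z r s a R R1 m \<Longrightarrow> R1 r = R1 s
    \<Longrightarrow> big_step z (Loop r s a) R R1 (\<lambda>j. min (m j) (R1 j))"
| Body: "R r \<noteq> R s \<Longrightarrow> big_step z a R R1 m \<Longrightarrow> loop_step z r s a R R1 (\<lambda>j. min (m j) (R1 j))"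
| Trans: "loop_step z r s a R R1 m1 \<Longrightarrow> loop_step z r s a R1 R2 m2
    \<Longrightarrow> loop_step z r s a R R2 (\<lambda>j. min (m1 j) (m2 j))"
| Limit: "(\<And>k. loop_step z r s a (S k) (S (Suc k)) (m k))
    \<Longrightarrow> loop_step z r s a (S 0) (\<lambda>j. lval (\<lambda>k. m k j)) (\<lambda>j. INF k. m k j)"

text \<open>The lower bound on the lines is what makes a limit of segments land on the loop head.
  The minimum has to be attained, since a mere lower bound would not determine the limit
  inferior.\<close>

definition segment :: "(time \<Rightarrow> config) \<Rightarrow> time \<Rightarrow> time \<Rightarrow> nat \<Rightarrow> regs \<Rightarrow> bool" where
  "segment C t t' l m \<longleftrightarrow> t < t' \<and>
     (\<forall>u. t \<le> u \<and> u < t' \<longrightarrow> l \<le> fst (C u) \<and> (\<forall>j. m j \<le> snd (C u) j)) \<and>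
     (\<forall>j. \<exists>u. t \<le> u \<and> u < t' \<and> snd (C u) j = m j)"

lemma segment_weaken: "segment C t t' l m \<Longrightarrow> l' \<le> l \<Longrightarrow> segment C t t' l' m"
  unfolding segment_def by (meson order_trans)

lemma segment_trans:
  assumes "segment C t t' l m1" "segment C t' t'' l m2"
  shows "segment C t t'' l (\<lambda>j. min (m1 j) (m2 j))"
proof -
  have lt: "t < t'" "t' < t''" using assms by (auto simp: segment_def)
  have 1: "l \<le> fst (C u)" "min (m1 j) (m2 j) \<le> snd (C u) j" if "t \<le> u" "u < t''" for u j
  proof -
    consider "u < t'" | "t' \<le> u" by fastforce
    then have "l \<le> fst (C u) \<and> (m1 j \<le> snd (C u) j \<or> m2 j \<le> snd (C u) j)"
      using assms that unfolding segment_def by cases blast+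
    then show "l \<le> fst (C u)" "min (m1 j) (m2 j) \<le> snd (C u) j" by auto
  qed
  have 2: "\<exists>u. t \<le> u \<and> u < t'' \<and> snd (C u) j = min (m1 j) (m2 j)" for j
  proof (cases "m1 j \<le> m2 j")
    case True
    obtain u where "t \<le> u" "u < t'" "snd (C u) j = m1 j"
      using assms(1) unfolding segment_def by blast
    then show ?thesis using lt True by (intro exI[of _ u]) auto
  next
    case False
    obtain u where "t' \<le> u" "u < t''" "snd (C u) j = m2 j"
      using assms(2) unfolding segment_def by blast
    then show ?thesis using lt False by (intro exI[of _ u]) auto
  qed
  show ?thesis unfolding segment_def using 1 2 lt by auto
qed

lemma segment_step:
  assumes C: "is_run P z i C" and t: "C t = (l, R)" and l: "l < length P"
  obtains t' where "segment C t t' l R" "C t' = exec z (P ! l) (l, R)"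
proof -
  obtain t' where s: "is_succ t t'" using time_succ .
  have "C t' = exec z (P ! l) (l, R)"
    using is_runD(2)[OF C s] t l by (simp add: step_def halted_def)
  moreover have "segment C t t' l R"
    using s t unfolding segment_def by (auto simp: is_succ_def dest: is_succ_le[OF s])
  ultimately show ?thesis using that by blast
qed

text \<open>Each time before the limit lies in one of the segments, and each segment attains its
  minima; hence the limit inferior over all earlier times equals that of the sequence of minima,
  also when it is infinite.\<close>

lemma segment_limit:
  assumes C: "is_run P z i C" and seg: "\<And>k. segment C (f k) (f (Suc k)) l (m k)"
    and head: "\<And>k. fst (C (f k)) = l"
  obtains t where "segment C (f 0) t l (\<lambda>j. INF k. m k j)"
    "C t = (l, \<lambda>j. lval (\<lambda>k. m k j))"
proof -
  have inc: "f k < f (Suc k)" for k using seg unfolding segment_def by blast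
  then have sm: "strict_mono f" by (simp add: strict_mono_Suc_iff)
  obtain t where t: "\<And>k. f k < t" "\<And>s. s < t \<Longrightarrow> \<exists>k. s < f k" "is_limit t"
    using time_sup[of f] inc by blast
  have loc: "\<exists>k\<ge>n. f k \<le> u \<and> u < f (Suc k)" if "f n \<le> u" "u < t" for u n
  proof -
    have k: "\<exists>k. u < f k" using t(2) that by blast
    define k where "k = (LEAST k. u < f k)"
    have "u < f k" unfolding k_def using k by (rule LeastI_ex)
    have "n < k" using that \<open>u < f k\<close> sm by (meson le_less_trans strict_mono_less)
    then obtain k' where k': "k = Suc k'" by (cases k) auto
    then have "\<not> u < f k'" using not_less_Least[of k' "\<lambda>k. u < f k"] k_def by simp
    then show ?thesis using k' \<open>n < k\<close> \<open>u < f k\<close> by (intro exI[of _ k']) auto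
  qed
  have ge: "l \<le> fst (C u)" "\<exists>k\<ge>n. m k j \<le> snd (C u) j" if "f n \<le> u" "u < t" for u n j
    using loc[OF that] seg unfolding segment_def by blast+
  have att: "\<exists>u. f k \<le> u \<and> u < t \<and> snd (C u) j = m k j" for k j
    using seg[of k] t(1)[of "Suc k"] unfolding segment_def by (meson less_trans)
  have "fst (C t) = l"
    unfolding is_runD(3)[OF C t(3)]
  proof (rule limit_value_eqI[OF t(1)])
    fix u assume "f 0 \<le> u" "u < t" then show "l \<le> fst (C u)" using ge by blast
  next
    fix s assume "s < t"
    then show "\<exists>u. s \<le> u \<and> u < t \<and> fst (C u) = l" using t head by (meson less_imp_le)
  qed
  moreover have "snd (C t) j = lval (\<lambda>k. m k j)" for j
    unfolding is_runD(4)[OF C t(3)]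
  proof (cases "\<lambda>k. m k j" rule: lval_cases)
    case (fin N)
    show "limit_value (\<lambda>s. snd (C s) j) t = lval (\<lambda>k. m k j)"
    proof (rule limit_value_eqI[OF t(1)[of N]])
      fix u assume "f N \<le> u" "u < t"
      then show "lval (\<lambda>k. m k j) \<le> snd (C u) j" using ge(2) fin(1) by (meson order_trans)
    next
      fix s assume "s < t"
      then obtain n where "s < f n" using t by blast
      moreover obtain k where "n \<le> k" "m k j = lval (\<lambda>k. m k j)" using fin(2) by blast
      moreover obtain u where "f k \<le> u" "u < t" "snd (C u) j = m k j" using att by blast
      moreover have "f n \<le> f k" using \<open>n \<le> k\<close> sm by (simp add: strict_mono_less_eq)
      ultimately show "\<exists>u. s \<le> u \<and> u < t \<and> snd (C u) j = lval (\<lambda>k. m k j)"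
        by (intro exI[of _ u]) auto
    qed
  next
    case ovf
    show "limit_value (\<lambda>s. snd (C s) j) t = lval (\<lambda>k. m k j)"
      unfolding ovf(2)
    proof (rule limit_value_overflow)
      fix v
      obtain N where "\<forall>k\<ge>N. v \<le> m k j" using ovf(1) by blast
      then show "\<exists>s<t. \<forall>u. s \<le> u \<and> u < t \<longrightarrow> v \<le> snd (C u) j"
        using t(1)[of N] ge(2)[of N] by (meson order_trans)
    qed
  qed
  ultimately have "C t = (l, \<lambda>j. lval (\<lambda>k. m k j))" by (auto intro!: prod_eqI ext)
  moreover have "segment C (f 0) t l (\<lambda>j. INF k. m k j)"
    unfolding segment_def
  proof (intro conjI allI impI)
    show "f 0 < t" by (rule t)
    fix u j assume u: "f 0 \<le> u \<and> u < t"
    then show "l \<le> fst (C u)" using ge by blast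
    obtain k where "m k j \<le> snd (C u) j" using ge(2) u by blast
    moreover have "(INF k. m k j) \<le> m k j" by (intro cINF_lower) auto
    ultimately show "(INF k. m k j) \<le> snd (C u) j" by simp
  next
    fix j
    have "(INF k. m k j) \<in> range (\<lambda>k. m k j)" by (intro Inf_nat_def1) simp
    then obtain k where "(INF k. m k j) = m k j" by blast
    then show "\<exists>u. f 0 \<le> u \<and> u < t \<and> snd (C u) j = (INF k. m k j)"
      using att[of k j] sm by (metis order_trans strict_mono_less_eq zero_le)
  qed
  ultimately show ?thesis using that by blast
qed

definition placed :: "program \<Rightarrow> nat \<Rightarrow> com \<Rightarrow> bool" where
  "placed P n c \<longleftrightarrow> (\<exists>pre post. P = pre @ compile n c @ post \<and> length pre = n)"

lemma placed_nth:
  assumes "placed P n c" "k < com_len c"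
  shows "P ! (n + k) = compile n c ! k" "n + k < length P"
  using assms by (auto simp: placed_def nth_append)

lemma placedI: "P = pre @ compile n c @ post \<Longrightarrow> length pre = n \<Longrightarrow> placed P n c"
  unfolding placed_def by blast

lemma placed_Seq:
  assumes "placed P n (Seq a b)"
  shows "placed P n a" "placed P (n + com_len a) b"
proof -
  obtain pre post where P: "P = pre @ compile n (Seq a b) @ post" "length pre = n"
    using assms unfolding placed_def by blast
  show "placed P n a"
    by (rule placedI[of _ pre _ _ "compile (n + com_len a) b @ post"]) (use P in auto)
  show "placed P (n + com_len a) b"
    by (rule placedI[of _ "pre @ compile n a" _ _ post]) (use P in auto)
qed

lemma placed_Loop:
  assumes "placed P n (Loop r s a)"
  shows "placed P (Suc n) a"
proof -
  obtain pre post where P: "P = pre @ compile n (Loop r s a) @ post" "length pre = n"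
    using assms unfolding placed_def by blast
  show ?thesis
    by (rule placedI[of _ "pre @ [JumpEq r s (n + com_len a + 2)]" _ _ "JumpEq 0 0 n # post"])
      (use P in auto)
qed

theorem big_step_sound:
  assumes C: "is_run P z i C"
  shows "big_step z c R R' m \<Longrightarrow> placed P n c \<Longrightarrow> C t = (n, R)
      \<Longrightarrow> \<exists>t'. segment C t t' n m \<and> C t' = (n + com_len c, R')"
    and "loop_step z r s a R R' m \<Longrightarrow> placed P n (Loop r s a) \<Longrightarrow> C t = (n, R)
      \<Longrightarrow> \<exists>t'. segment C t t' n m \<and> C t' = (n, R')"
proof (induction arbitrary: n t and n t rule: big_step_loop_step.inducts)
  case (Ins I R R')
  have "P ! n = I" "n < length P" using placed_nth[OF Ins(2), of 0] by auto
  then obtain t' where "segment C t t' n R" "C t' = exec z I (n, R)"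
    using segment_step[OF C Ins(3)] by blast
  then show ?case using Ins(1) by auto
next
  case (Seq a R R1 m1 b R2 m2)
  have p: "placed P n a" "placed P (n + com_len a) b" using placed_Seq[OF Seq(5)] by blast+
  obtain t' where t': "segment C t t' n m1" "C t' = (n + com_len a, R1)"
    using Seq(2)[OF p(1) Seq(6)] by blast
  obtain t'' where "segment C t' t'' (n + com_len a) m2" "C t'' = (n + com_len a + com_len b, R2)"
    using Seq(4)[OF p(2) t'(2)] by blast
  moreover from this have "segment C t t'' n (\<lambda>j. min (m1 j) (m2 j))"
    using segment_trans[OF t'(1)] segment_weaken le_add1 by blast
  ultimately show ?case by (auto simp: add.assoc)
next
  case (Exit R r s a)
  have P: "P ! n = JumpEq r s (n + com_len a + 2)" "n < length P"
    using placed_nth[OF Exit(2), of 0] by auto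
  obtain t' where "segment C t t' n R" "C t' = exec z (P ! n) (n, R)"
    using segment_step[OF C Exit(3) P(2)] by blast
  then show ?case using P(1) Exit(1) by (auto simp: add.assoc)
next
  case (Loop r s a R R1 m)
  obtain t' where t': "segment C t t' n m" "C t' = (n, R1)" using Loop(2)[OF Loop(4,5)] by blast
  have P: "P ! n = JumpEq r s (n + com_len a + 2)" "n < length P"
    using placed_nth[OF Loop(4), of 0] by auto
  obtain t'' where t'': "segment C t' t'' n R1" "C t'' = exec z (P ! n) (n, R1)"
    using segment_step[OF C t'(2) P(2)] by blast
  then show ?case using segment_trans[OF t'(1) t''(1)] P(1) Loop(3) by (auto simp: add.assoc)
next
  case (Body R r s a R1 m)
  have P: "P ! n = JumpEq r s (n + com_len a + 2)" "n < length P"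
    using placed_nth[OF Body(4), of 0] by auto
  obtain t1 where "segment C t t1 n R" "C t1 = exec z (P ! n) (n, R)"
    using segment_step[OF C Body(5) P(2)] by blast
  then have t1: "segment C t t1 n R" "C t1 = (Suc n, R)" using P(1) Body(1) by auto
  obtain t2 where t2: "segment C t1 t2 (Suc n) m" "C t2 = (Suc n + com_len a, R1)"
    using Body(3)[OF placed_Loop[OF Body(4)] t1(2)] by blast
  have P': "P ! (Suc n + com_len a) = JumpEq 0 0 n" "Suc n + com_len a < length P"
    using placed_nth[OF Body(4), of "Suc (com_len a)"] by (auto simp: nth_append)
  obtain t3 where "segment C t2 t3 (Suc n + com_len a) R1"
    "C t3 = exec z (P ! (Suc n + com_len a)) (Suc n + com_len a, R1)"
    using segment_step[OF C t2(2) P'(2)] by blast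
  then have t3: "segment C t2 t3 (Suc n + com_len a) R1" "C t3 = (n, R1)" unfolding P' by auto
  have "segment C t1 t2 n m" "segment C t2 t3 n R1"
    using segment_weaken[OF t2(1)] segment_weaken[OF t3(1)] by simp_all
  then have "segment C t t3 n (\<lambda>j. min (min (R j) (m j)) (R1 j))"
    using segment_trans[OF segment_trans[OF t1(1)]] by blast
  \<comment> \<open>The test at the head changes no register, so the body starts with
    \<open>R\<close> and its minimum already accounts for the test. This is why the rule
    \<open>Body\<close> mentions only \<open>m\<close> and \<open>R1\<close>, the latter for the
    jump back.\<close>
  moreover have "m j \<le> R j" for j using t2(1) t1(2) unfolding segment_def by force
  then have "min (R j) (m j) = m j" for j by (simp add: min_absorb2)
  ultimately show ?case using t3(2) by auto
next
  case (Trans r s a R R1 m1 R2 m2)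
  show ?case using Trans(2)[OF Trans(5,6)] Trans(4)[OF Trans(5)] segment_trans by blast
next
  case (Limit r s a S m)
  have "\<exists>f. \<forall>k. (C (f k) = (n, S k) \<and> (k = 0 \<longrightarrow> f k = t)) \<and> segment C (f k) (f (Suc k)) n (m k)"
  proof (rule dependent_nat_choice)
    show "\<exists>u. C u = (n, S 0) \<and> (0 = (0::nat) \<longrightarrow> u = t)" using Limit(4) by blast
    fix u k assume "C u = (n, S k) \<and> (k = 0 \<longrightarrow> u = t)"
    then show "\<exists>u'. (C u' = (n, S (Suc k)) \<and> (Suc k = 0 \<longrightarrow> u' = t)) \<and> segment C u u' n (m k)"
      using Limit(2)[OF Limit(3)] by blast
  qed
  then obtain f where f: "\<And>k. C (f k) = (n, S k)" "f 0 = t" "\<And>k. segment C (f k) (f (Suc k)) n (m k)"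
    by blast
  obtain t' where "segment C (f 0) t' n (\<lambda>j. INF k. m k j)" "C t' = (n, \<lambda>j. lval (\<lambda>k. m k j))"
    by (rule segment_limit[of P z i C f n m]) (use C f in auto)
  then show ?case using f(2) by blast
qed

lemmas big_step_intros = big_step_loop_step.intros

section \<open>Relocation of programs to a block of higher registers\<close>

fun shift_instr :: "nat \<Rightarrow> instr \<Rightarrow> instr" where
  "shift_instr b (Zero m) = Zero (b + m)"
| "shift_instr b (Succ m) = Succ (b + m)"
| "shift_instr b (Copy m n) = Copy (b + m) (b + n)"
| "shift_instr b (JumpEq m n k) = JumpEq (b + m) (b + n) k"
| "shift_instr b (Oracle m) = Oracle (b + m)"

fun shift :: "nat \<Rightarrow> com \<Rightarrow> com" where
  "shift b (Ins I) = Ins (shift_instr b I)"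
| "shift b (Seq c d) = Seq (shift b c) (shift b d)"
| "shift b (Loop r s c) = Loop (b + r) (b + s) (shift b c)"

text \<open>Registers below \<open>b\<close> belong to the caller, those from \<open>b\<close> on to
  the relocated program.\<close>

definition glue :: "nat \<Rightarrow> regs \<Rightarrow> regs \<Rightarrow> regs"
  where "glue b R S j = (if j < b then R j else S (j - b))"

lemma glue_add [simp]: "glue b R S (b + j) = S j"
  by (simp add: glue_def)

lemma glue_less [simp]: "j < b \<Longrightarrow> glue b R S j = R j"
  by (simp add: glue_def)

lemma glue_min: "(\<lambda>j. min (glue b R S j) (glue b R S' j)) = glue b R (\<lambda>j. min (S j) (S' j))"
  by (auto simp: glue_def)

lemma glue_shift [simp]: "glue b R (\<lambda>j. R (b + j)) = R"
  by (auto simp: glue_def)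

lemma glue_upd [simp]: "(glue b R S)(b + m := v) = glue b R (S(m := v))"
  by (rule ext) (auto simp: glue_def)

lemma exec_shift:
  assumes "\<And>l. exec z I (l, S) = (Suc l, S')"
  shows "exec z (shift_instr b I) (l, glue b R S) = (Suc l, glue b R S')"
proof (cases I)
  case (JumpEq m n k)
  then have "S m \<noteq> S n" "S' = S" using assms[of k] assms[of "Suc k"] by (auto split: if_splits)
  then show ?thesis using JumpEq by simp
qed (use assms[of 0] in \<open>auto simp: glue_upd\<close>)

text \<open>The caller's registers stay constant, and a constant sequence has itself as infimum and
  limit inferior, so relocation is compatible with the limit rule too.\<close>

lemma big_step_shift:
  "big_step z c S S' m \<Longrightarrow> big_step z (shift b c) (glue b R S) (glue b R S') (glue b R m)"
  "loop_step z r s c S S' m \<Longrightarrow>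
     loop_step z (b + r) (b + s) (shift b c) (glue b R S) (glue b R S') (glue b R m)"
proof (induction rule: big_step_loop_step.inducts)
  case (Ins I R R')
  then show ?case by (auto intro!: big_step_intros exec_shift)
next
  case (Seq a R R1 m1 b R2 m2)
  then show ?case using big_step_intros(2) by (fastforce simp: glue_min[symmetric])
next
  case (Exit R r s a)
  then show ?case using big_step_intros(3) by simp
next
  case (Loop r s a R R1 m)
  then show ?case by (auto simp: glue_min[symmetric] intro: big_step_intros(4))
next
  case (Body R r s a R1 m)
  then show ?case by (auto simp: glue_min[symmetric] intro: big_step_intros(5))
next
  case (Trans r s a R R1 m1 R2 m2)
  then show ?case by (auto simp: glue_min[symmetric] intro: big_step_intros(6))
next
  case (Limit r s a S m)
  have "loop_step z (b + r) (b + s) (shift b a) (glue b R (S 0))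
      (\<lambda>j. lval (\<lambda>k. glue b R (m k) j)) (\<lambda>j. INF k. glue b R (m k) j)"
    by (rule big_step_intros(7)[of z _ _ _ "\<lambda>k. glue b R (S k)"]) (use Limit in blast)
  moreover have "(\<lambda>j. lval (\<lambda>k. glue b R (m k) j)) = glue b R (\<lambda>j. lval (\<lambda>k. m k j))"
    by (rule ext) (simp add: glue_def)
  moreover have "(\<lambda>j. INF k. glue b R (m k) j) = glue b R (\<lambda>j. INF k. m k j)"
    by (rule ext) (simp add: glue_def)
  ultimately show ?case by simp
qed

section \<open>Total correctness rules and computable functions\<close>

definition wp :: "nat set \<Rightarrow> com \<Rightarrow> (regs \<Rightarrow> bool) \<Rightarrow> regs \<Rightarrow> bool"
  where "wp z c Q R \<longleftrightarrow> (\<exists>R' m. big_step z c R R' m \<and> Q R')"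

lemma wp_Ins:
  "wp z (Ins (Zero k)) Q R \<longleftrightarrow> Q (R(k := 0))"
  "wp z (Ins (Succ k)) Q R \<longleftrightarrow> Q (R(k := Suc (R k)))"
  "wp z (Ins (Copy j k)) Q R \<longleftrightarrow> Q (R(k := R j))"
  "wp z (Ins (Oracle k)) Q R \<longleftrightarrow> Q (R(k := (if R k \<in> z then 1 else 0)))"
  unfolding wp_def by (auto elim: big_step.cases intro!: exI big_step_intros)

lemma wp_Seq: "wp z a (wp z b Q) R \<Longrightarrow> wp z (Seq a b) Q R"
  unfolding wp_def using big_step_intros(2) by blast

lemma wp_mono: "wp z c Q R \<Longrightarrow> (\<And>R. Q R \<Longrightarrow> Q' R) \<Longrightarrow> wp z c Q' R"
  unfolding wp_def by blast

text \<open>Only for loops that end after finitely many rounds, as witnessed by the variant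
  \<open>\<mu>\<close>; loops running through limits are treated by
  \<open>computable_iter\<close>.\<close>

lemma wp_Loop:
  fixes \<mu> :: "regs \<Rightarrow> nat"
  assumes "I R"
    and body: "\<And>R. I R \<Longrightarrow> R r \<noteq> R s \<Longrightarrow> wp z a (\<lambda>R'. I R' \<and> \<mu> R' < \<mu> R) R"
    and exit: "\<And>R. I R \<Longrightarrow> R r = R s \<Longrightarrow> Q R"
  shows "wp z (Loop r s a) Q R"
proof -
  have "(R r = R s \<and> Q R) \<or> (\<exists>R' m. loop_step z r s a R R' m \<and> R' r = R' s \<and> Q R')"
    using \<open>I R\<close>
  proof (induction "\<mu> R" arbitrary: R rule: less_induct)
    case less
    show ?case
    proof (cases "R r = R s")
      case False
      then obtain R' m where R': "big_step z a R R' m" "I R'" "\<mu> R' < \<mu> R"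
        using body[OF less.prems] unfolding wp_def by blast
      note st = big_step_intros(5)[of R r s z a R' m, OF False R'(1)]
      show ?thesis using less.hyps[OF R'(3,2)] st big_step_intros(6)[OF st] by blast
    qed (use exit less in blast)
  qed
  then show ?thesis unfolding wp_def using big_step_intros(3,4) by blast
qed

text \<open>The substitute for a conditional: the body has to make the two tested registers
  equal.\<close>

lemma wp_once:
  assumes "R r = R s \<Longrightarrow> Q R" "R r \<noteq> R s \<Longrightarrow> wp z a (\<lambda>R'. R' r = R' s \<and> Q R') R"
  shows "wp z (Loop r s a) Q R"
proof (cases "R r = R s")
  case True
  then show ?thesis unfolding wp_def using assms(1) big_step_intros(3) by blast
next
  case False
  then obtain R' m where "big_step z a R R' m" "R' r = R' s" "Q R'"
    using assms(2) unfolding wp_def by blast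
  then show ?thesis unfolding wp_def using big_step_intros(4,5) False by blast
qed

text \<open>All registers other than 0 are arbitrary at the start, so programs can be chained
  without clearing their scratch registers.\<close>

definition computable :: "(nat set \<Rightarrow> nat \<Rightarrow> nat) \<Rightarrow> bool"
  where "computable F \<longleftrightarrow> (\<exists>c. \<forall>z R. wp z c (\<lambda>R'. R' 0 = F z (R 0)) R)"

lemma computableI: "(\<And>z R. wp z c (\<lambda>R'. R' 0 = F z (R 0)) R) \<Longrightarrow> computable F"
  unfolding computable_def by blast

lemma computable_halts:
  assumes "computable F"
  obtains P where "\<And>z n. halts_with P z n (F z n)"
proof -
  obtain c where c: "\<And>z R. wp z c (\<lambda>R'. R' 0 = F z (R 0)) R"
    using assms unfolding computable_def by blast
  have "halts_with (compile 0 c) z n (F z n)" for z n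
  proof -
    let ?R = "(\<lambda>_. 0)(0 := n)"
    obtain R' m where R': "big_step z c ?R R' m" "R' 0 = F z n"
      using c[of z ?R] unfolding wp_def by auto
    obtain C :: "time \<Rightarrow> config" where C: "is_run (compile 0 c) z n C" using run_ex1 by blast
    define t where "t = (LEAST t::time. True)"
    have "C t = (0, ?R)"
      using is_runD(1)[OF C, of t] by (simp add: t_def Least_le init_def)
    moreover have "placed (compile 0 c) 0 c" by (rule placedI[of _ "[]" _ _ "[]"]) auto
    ultimately obtain t' where "C t' = (com_len c, R')"
      using big_step_sound(1)[OF C R'(1)] by fastforce
    then show ?thesis
      unfolding halts_with_def using C R'(2) by (intro exI[of _ C] exI[of _ t']) (auto simp: halted_def)
  qed
  then show ?thesis using that by blast
qed

lemma computable_id: "computable (\<lambda>z n. n)"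
  by (rule computableI[of "Ins (Copy 0 0)"]) (simp add: wp_Ins)

lemma computable_comp:
  assumes "computable F" "computable G"
  shows "computable (\<lambda>z n. G z (F z n))"
proof -
  obtain c d where c: "\<And>z R. wp z c (\<lambda>R'. R' 0 = F z (R 0)) R"
    and d: "\<And>z R. wp z d (\<lambda>R'. R' 0 = G z (R 0)) R"
    using assms unfolding computable_def by blast
  show ?thesis
    by (rule computableI[of "c ;; d"], rule wp_Seq, rule wp_mono[OF c], rule wp_mono[OF d]) simp
qed

lemma computable_Suc_reg: "computable (\<lambda>z n. Suc n)"
  by (rule computableI[of "Ins (Succ 0)"]) (simp add: wp_Ins)

lemma computable_0: "computable (\<lambda>z n. 0)"
  by (rule computableI[of "Ins (Zero 0)"]) (simp add: wp_Ins)

lemma computable_oracle: "computable (\<lambda>z n. if n \<in> z then 1 else 0)"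
  by (rule computableI[of "Ins (Oracle 0)"]) (simp add: wp_Ins)

lemmas computable_Suc = computable_comp[OF _ computable_Suc_reg]

lemma computable_const: "computable (\<lambda>z n. k)"
  by (induction k) (auto intro: computable_0 computable_Suc)

text \<open>Uses \<open>prod_encode (a, b) = triangle (a + b) + a\<close>: the first loop forms
  \<open>a + b\<close> in register 2, the nested loops sum up its triangle number in register 4, and
  the last loop adds \<open>a\<close>.\<close>

definition pair_com :: com where
  "pair_com = Ins (Copy 1 2) ;; Ins (Zero 3) ;; Loop 3 0 (Ins (Succ 2) ;; Ins (Succ 3)) ;;
     Ins (Zero 4) ;; Ins (Zero 5) ;;
     Loop 5 2 (Ins (Succ 5) ;; Ins (Zero 6) ;; Loop 6 5 (Ins (Succ 4) ;; Ins (Succ 6))) ;;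
     Ins (Zero 6) ;; Loop 6 0 (Ins (Succ 4) ;; Ins (Succ 6)) ;; Ins (Copy 4 0)"

lemma wp_pair_com: "wp z pair_com (\<lambda>R'. R' 0 = prod_encode (R 0, R 1)) R"
proof -
  let ?a = "R 0" and ?b = "R 1"
  show ?thesis unfolding pair_com_def
    apply (rule wp_Seq, simp only: wp_Ins)+
    apply (rule wp_Seq)
    apply (rule wp_Loop[where I = "\<lambda>R. R 0 = ?a \<and> R 3 \<le> ?a \<and> R 2 = ?b + R 3" and \<mu> = "\<lambda>R. ?a - R 3"])
      apply simp
     apply (rule wp_Seq, simp add: wp_Ins; arith)
    apply (rule wp_Seq, simp only: wp_Ins)+
    apply (rule wp_Seq)
    apply (rule wp_Loop[where I = "\<lambda>R. R 0 = ?a \<and> R 5 \<le> R 2 \<and> R 2 = ?a + ?b \<and> R 4 = triangle (R 5)"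
          and \<mu> = "\<lambda>R. R 2 - R 5"])
      apply simp
    subgoal for S S'
      apply (rule wp_Seq, simp only: wp_Ins)+
      apply (rule wp_Loop[where I = "\<lambda>R. R 0 = ?a \<and> R 5 = Suc (S' 5) \<and> R 2 = ?a + ?b \<and> R 6 \<le> R 5 \<and>
            R 4 = triangle (S' 5) + R 6" and \<mu> = "\<lambda>R. R 5 - R 6"])
        apply simp
       apply (rule wp_Seq, simp add: wp_Ins; arith)
      apply auto
      done
    apply (rule wp_Seq, simp only: wp_Ins)+
    apply (rule wp_Seq)
    apply (rule wp_Loop[where I = "\<lambda>R. R 0 = ?a \<and> R 6 \<le> ?a \<and> R 4 = triangle (?a + ?b) + R 6" 
          and \<mu> = "\<lambda>R. ?a - R 6"])
      apply simp
     apply (rule wp_Seq, simp add: wp_Ins; arith)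
    apply (auto simp: wp_Ins prod_encode_def)
    done
qed

text \<open>Decoding by counting: while register 1 runs up to the code, registers 2 and 3 step
  through the enumeration of pairs as in \<open>prod_decode_Suc\<close>. Register 5 receives the
  predecessor of register 3. Registers 8 and 7 collect the next pair, first set up for the case that
  register 3 is 0 and then overwritten otherwise.\<close>

definition unpair_com :: com where
  "unpair_com = Ins (Zero 1) ;; Ins (Zero 2) ;; Ins (Zero 3) ;;
     Loop 1 0 (Ins (Succ 1) ;; Ins (Zero 4) ;; Ins (Zero 5) ;;
       Loop 4 3 (Ins (Copy 4 5) ;; Ins (Succ 4)) ;;
       Ins (Succ 2) ;; Ins (Copy 2 7) ;; Ins (Zero 8) ;; Ins (Zero 6) ;;
       Loop 3 6 (Ins (Copy 5 7) ;; Ins (Copy 2 8) ;; Ins (Zero 3)) ;;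
       Ins (Copy 7 3) ;; Ins (Copy 8 2)) ;;
     Ins (Copy 2 0) ;; Ins (Copy 3 1)"

lemma prod_decode_0: "prod_decode 0 = (0, 0)"
proof -
  have "prod_decode (prod_encode (0, 0)) = (0, 0)" by (rule prod_encode_inverse)
  then show ?thesis by (simp add: prod_encode_def)
qed

lemma prod_decode_Suc:
  assumes "prod_decode n = (a, b)"
  shows "prod_decode (Suc n) = (if b = 0 then (0, Suc a) else (Suc a, b - 1))"
proof -
  have "n = prod_encode (a, b)" using assms by (metis prod_decode_inverse)
  then have "Suc n = prod_encode (if b = 0 then (0, Suc a) else (Suc a, b - 1))"
    by (cases b) (auto simp: prod_encode_def)
  then show ?thesis by (simp only: prod_encode_inverse)
qed

lemma wp_unpair_com: "wp z unpair_com (\<lambda>R'. (R' 0, R' 1) = prod_decode (R 0)) R"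
proof -
  let ?n = "R 0"
  show ?thesis unfolding unpair_com_def
    apply (rule wp_Seq, simp only: wp_Ins)+
    apply (rule wp_Seq)
    apply (rule wp_Loop[where I = "\<lambda>R. R 0 = ?n \<and> R 1 \<le> ?n \<and> prod_decode (R 1) = (R 2, R 3)"
          and \<mu> = "\<lambda>R. ?n - R 1"])
      apply (simp add: prod_decode_0)
    subgoal for S'
      apply (rule wp_Seq, simp only: wp_Ins)+
      apply (rule wp_Seq)
      apply (rule wp_Loop[where I = "\<lambda>R. R 0 = ?n \<and> R 1 = Suc (S' 1) \<and> R 2 = S' 2 \<and> R 3 = S' 3 \<and>
            R 4 \<le> R 3 \<and> R 5 = R 4 - 1" and \<mu> = "\<lambda>R. R 3 - R 4"])
        apply simp
       apply (rule wp_Seq, simp add: wp_Ins; arith)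
      apply (rule wp_Seq, simp only: wp_Ins)+
      apply (rule wp_Seq)
      apply (rule wp_once)
      subgoal by (rule wp_Seq, auto simp: wp_Ins prod_decode_Suc)
      subgoal
        apply (rule wp_Seq, simp only: wp_Ins)+
        apply (simp add: wp_Ins)
        apply (rule wp_Seq, auto simp: wp_Ins prod_decode_Suc)
        done
      done
    apply (rule wp_Seq, simp add: wp_Ins)
    done
qed

definition pfst :: "nat \<Rightarrow> nat" where "pfst n = fst (prod_decode n)"
definition psnd :: "nat \<Rightarrow> nat" where "psnd n = snd (prod_decode n)"
definition pair :: "nat \<Rightarrow> nat \<Rightarrow> nat" where "pair a b = prod_encode (a, b)"

lemma pair_simps [simp]:
  "pfst (pair a b) = a" "psnd (pair a b) = b" "pair (pfst n) (psnd n) = n"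
  "pair a b = pair c d \<longleftrightarrow> a = c \<and> b = d"
  by (simp_all add: pfst_def psnd_def pair_def)

lemma computable_pfst_reg: "computable (\<lambda>z. pfst)"
  by (rule computableI[of unpair_com], rule wp_mono[OF wp_unpair_com])
    (simp add: pfst_def fst_conv[symmetric], metis fst_conv)

lemma computable_psnd_reg: "computable (\<lambda>z. psnd)"
  by (rule computableI[of "Seq unpair_com (Ins (Copy 1 0))"], rule wp_Seq, rule wp_mono[OF wp_unpair_com])
    (simp add: psnd_def wp_Ins, metis snd_conv)

lemmas computable_pfst = computable_comp[OF _ computable_pfst_reg]
lemmas computable_psnd = computable_comp[OF _ computable_psnd_reg]

definition call :: "nat \<Rightarrow> com \<Rightarrow> nat \<Rightarrow> nat \<Rightarrow> nat \<Rightarrow> com" where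
  "call b c i i' j = Ins (Copy i b) ;; Ins (Copy i' (Suc b)) ;; shift b c ;; Ins (Copy b j)"

text \<open>The result is written by the last instruction, and minima do not count the end point, so
  even the output register has its old content as minimum. Exact minima are needed because they
  determine the registers at limits.\<close>

lemma big_step_call:
  assumes c: "\<And>R. wp z c (\<lambda>R'. R' 0 = f (R 0) (R 1)) R" and b: "i < b" "i' < b" "j < b"
  shows "\<exists>R' m. big_step z (call b c i i' j) R R' m \<and> (\<forall>k<b. m k = R k) \<and>
    (\<forall>k<b. R' k = (if k = j then f (R i) (R i') else R k))"
proof -
  define R1 where "R1 = R(b := R i)"
  define R2 where "R2 = R1(Suc b := R1 i')"
  obtain S' m where S': "big_step z c (\<lambda>j. R2 (b + j)) S' m" "S' 0 = f (R2 b) (R2 (Suc b))"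
    using c[of "\<lambda>j. R2 (b + j)"] unfolding wp_def by auto
  have "big_step z (shift b c) R2 (glue b R2 S') (glue b R2 m)"
    using big_step_shift(1)[OF S'(1), of b R2] by simp
  moreover have "big_step z (Ins (Copy i b)) R R1 R" "big_step z (Ins (Copy i' (Suc b))) R1 R2 R1"
    "big_step z (Ins (Copy b j)) (glue b R2 S') ((glue b R2 S')(j := S' 0)) (glue b R2 S')"
    by (auto intro!: big_step_intros(1) simp: R1_def R2_def glue_def)
  ultimately have "big_step z (call b c i i' j) R ((glue b R2 S')(j := S' 0))
      (\<lambda>k. min (R k) (min (R1 k) (min (glue b R2 m k) (glue b R2 S' k))))"
    unfolding call_def by (intro big_step_intros(2))
  then show ?thesis using b S'(2) by (intro exI conjI) (auto simp: R1_def R2_def)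
qed

lemma wp_call:
  assumes c: "\<And>R. wp z c (\<lambda>R'. R' 0 = f (R 0) (R 1)) R" and b: "i < b" "i' < b" "j < b"
    and Q: "\<And>R'. (\<And>k. k < b \<Longrightarrow> R' k = (if k = j then f (R i) (R i') else R k)) \<Longrightarrow> Q R'"
  shows "wp z (call b c i i' j) Q R"
  using big_step_call[OF c b, of R] Q unfolding wp_def by blast

lemma computable_binop:
  assumes c: "\<And>z R. wp z c (\<lambda>R'. R' 0 = f z (R 0) (R 1)) R" and "computable F" "computable G"
  shows "computable (\<lambda>z n. f z (F z n) (G z n))"
proof -
  obtain cF cG where F: "\<And>z R. wp z cF (\<lambda>R'. R' 0 = F z (R 0)) R"
    and G: "\<And>z R. wp z cG (\<lambda>R'. R' 0 = G z (R 0)) R"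
    using assms unfolding computable_def by blast
  show ?thesis
    apply (rule computableI[of "call 3 cF 0 0 1 ;; call 3 cG 0 0 2 ;; call 3 c 1 2 0"])
    apply (rule wp_Seq, rule wp_call[where f = "\<lambda>a b. F z a" for z, OF F], simp, simp, simp)
    apply (rule wp_Seq, rule wp_call[where f = "\<lambda>a b. G z a" for z, OF G], simp, simp, simp)
    apply (rule wp_call[where f = "f z" for z, OF c], simp, simp, simp, simp)
    done
qed

lemma computable_pair:
  "computable F \<Longrightarrow> computable G \<Longrightarrow> computable (\<lambda>z n. pair (F z n) (G z n))"
  by (rule computable_binop[of pair_com "\<lambda>z. pair"]) (simp_all add: wp_pair_com pair_def del: One_nat_def)

lemma computable_eq:
  assumes "computable F" "computable G"
  shows "computable (\<lambda>z n. if F z n = G z n then 1 else 0)"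
  apply (rule computable_binop[of "Ins (Zero 2) ;; Ins (Succ 2) ;;
     Loop 0 1 (Ins (Zero 2) ;; Ins (Copy 1 0)) ;; Ins (Copy 2 0)" "\<lambda>z a b. if a = b then 1 else 0"])
    apply (rule wp_Seq, simp only: wp_Ins)+
    apply (rule wp_Seq, rule wp_once)
     apply (simp add: wp_Ins)
    apply (rule wp_Seq, simp add: wp_Ins)
  using assms by auto

text \<open>\<open>F\<close>, \<open>G\<close> and \<open>H\<close> are total, so all three are
  evaluated and a loop run at most once selects the value.\<close>

lemma computable_if:
  assumes "computable F" "computable G" "computable H"
  shows "computable (\<lambda>z n. if F z n \<noteq> 0 then G z n else H z n)"
proof -
  obtain cF cG cH where F: "\<And>z R. wp z cF (\<lambda>R'. R' 0 = F z (R 0)) R"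
    and G: "\<And>z R. wp z cG (\<lambda>R'. R' 0 = G z (R 0)) R"
    and H: "\<And>z R. wp z cH (\<lambda>R'. R' 0 = H z (R 0)) R"
    using assms unfolding computable_def by blast
  show ?thesis
    apply (rule computableI[of "call 5 cF 0 0 1 ;; call 5 cG 0 0 2 ;; call 5 cH 0 0 3 ;; Ins (Zero 4) ;;
        Loop 1 4 (Ins (Copy 2 3) ;; Ins (Zero 1)) ;; Ins (Copy 3 0)"])
    apply (rule wp_Seq, rule wp_call[where f = "\<lambda>a b. F z a" for z, OF F], simp, simp, simp)
    apply (rule wp_Seq, rule wp_call[where f = "\<lambda>a b. G z a" for z, OF G], simp, simp, simp)
    apply (rule wp_Seq, rule wp_call[where f = "\<lambda>a b. H z a" for z, OF H], simp, simp, simp)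
    apply (rule wp_Seq, simp only: wp_Ins)
    apply (rule wp_Seq, rule wp_once)
     apply (simp add: wp_Ins)
    apply (rule wp_Seq, simp add: wp_Ins)
    done
qed

text \<open>
  Transfinite iteration of a map on pairs; the last two arguments are the minima of the two
  components over the iteration.
\<close>

inductive iter :: "(nat \<Rightarrow> nat \<Rightarrow> nat) \<Rightarrow> (nat \<Rightarrow> nat \<Rightarrow> nat) \<Rightarrow> (nat \<Rightarrow> nat \<Rightarrow> bool)
    \<Rightarrow> nat \<Rightarrow> nat \<Rightarrow> nat \<Rightarrow> nat \<Rightarrow> nat \<Rightarrow> nat \<Rightarrow> bool" for A B D where
  Step: "\<not> D a b \<Longrightarrow> iter A B D a b (A a b) (B a b) (min a (A a b)) (min b (B a b))"
| Trans: "iter A B D a b a' b' ma mb \<Longrightarrow> iter A B D a' b' a'' b'' ma' mb'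
    \<Longrightarrow> iter A B D a b a'' b'' (min ma ma') (min mb mb')"
| Limit: "(\<And>k. iter A B D (a k) (b k) (a (Suc k)) (b (Suc k)) (ma k) (mb k))
    \<Longrightarrow> iter A B D (a 0) (b 0) (lval ma) (lval mb) (INF k. ma k) (INF k. mb k)"

text \<open>Register 0 holds the input, 1 and 2 the pair, 3 the stop flag, 4 the constant 1.
  Registers 0, 3 and 4 have constant minima and so survive limits; all further registers may be
  arbitrary there, because the body is required to work from any of their contents.\<close>

lemma loop_simulates_iter:
  assumes body: "\<And>R. R 0 = n \<Longrightarrow> R 3 = 0 \<Longrightarrow> R 4 = 1 \<Longrightarrow> \<not> D (R 1) (R 2) \<Longrightarrow> \<exists>R' m. big_step z c R R' m \<and>
      R' 0 = n \<and> R' 1 = A (R 1) (R 2) \<and> R' 2 = B (R 1) (R 2) \<and> R' 3 = 0 \<and> R' 4 = 1 \<and>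
      m 0 = n \<and> m 1 = min (R 1) (R' 1) \<and> m 2 = min (R 2) (R' 2) \<and> m 3 = 0 \<and> m 4 = 1"
    and "iter A B D a b a' b' ma mb" "R 0 = n" "R 1 = a" "R 2 = b" "R 3 = 0" "R 4 = 1"
  shows "\<exists>R' m. loop_step z 3 4 c R R' m \<and> R' 0 = n \<and> R' 1 = a' \<and> R' 2 = b' \<and> R' 3 = 0 \<and> R' 4 = 1 \<and>
    m 0 = n \<and> m 1 = ma \<and> m 2 = mb \<and> m 3 = 0 \<and> m 4 = 1"
  using assms(2-)
proof (induction arbitrary: R)
  case (Step a b)
  then obtain R' m where *: "big_step z c R R' m"
      "R' 0 = n" "R' 1 = A (R 1) (R 2)" "R' 2 = B (R 1) (R 2)" "R' 3 = 0" "R' 4 = 1"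
      "m 0 = n" "m 1 = min (R 1) (R' 1)" "m 2 = min (R 2) (R' 2)" "m 3 = 0" "m 4 = 1"
    using body[of R] by auto
  have "loop_step z 3 4 c R R' (\<lambda>j. min (m j) (R' j))"
    by (rule big_step_intros(5)) (use Step * in auto)
  then show ?case using * Step by (intro exI[of _ R'] exI[of _ "\<lambda>j. min (m j) (R' j)"]) auto
next
  case (Trans a b a' b' ma mb a'' b'' ma' mb')
  obtain R1 m1 where 1: "loop_step z 3 4 c R R1 m1" "R1 0 = n" "R1 1 = a'" "R1 2 = b'" "R1 3 = 0" "R1 4 = 1"
    "m1 0 = n" "m1 1 = ma" "m1 2 = mb" "m1 3 = 0" "m1 4 = 1"
    using Trans.IH(1)[of R] Trans.prems by auto
  obtain R2 m2 where 2: "loop_step z 3 4 c R1 R2 m2" "R2 0 = n" "R2 1 = a''" "R2 2 = b''" "R2 3 = 0" "R2 4 = 1"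
    "m2 0 = n" "m2 1 = ma'" "m2 2 = mb'" "m2 3 = 0" "m2 4 = 1"
    using Trans.IH(2)[of R1] 1 by auto
  show ?case
    by (rule exI[of _ R2], rule exI[of _ "\<lambda>j. min (m1 j) (m2 j)"])
      (use 1 2 big_step_intros(6)[OF 1(1) 2(1)] in auto)
next
  case (Limit a b ma mb)
  have "\<exists>S. \<forall>k. ((k = 0 \<longrightarrow> fst (S k) = R) \<and> fst (S k) 0 = n \<and> fst (S k) 1 = a k \<and> fst (S k) 2 = b k \<and> fst (S k) 3 = 0 \<and>
      fst (S k) 4 = 1) \<and> (loop_step z 3 4 c (fst (S k)) (fst (S (Suc k))) (snd (S (Suc k))) \<and>
      snd (S (Suc k)) 0 = n \<and> snd (S (Suc k)) 1 = ma k \<and> snd (S (Suc k)) 2 = mb k \<and>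
      snd (S (Suc k)) 3 = 0 \<and> snd (S (Suc k)) 4 = 1)"
    (is "\<exists>S. ?P S")
  proof (rule dependent_nat_choice, goal_cases)
    case 1
    show ?case by (rule exI[of _ "(R, R)"]) (use Limit.prems in auto)
  next
    case (2 S k)
    then show ?case using Limit.IH[of "fst S" k] by (auto simp del: One_nat_def)
  qed
  then obtain S where S: "?P S" by blast
  have "loop_step z 3 4 c (fst (S 0)) (\<lambda>j. lval (\<lambda>k. snd (S (Suc k)) j)) (\<lambda>j. INF k. snd (S (Suc k)) j)"
    by (rule big_step_intros(7)[of z 3 4 c "\<lambda>k. fst (S k)"]) (use S in blast)
  moreover have "fst (S 0) = R" using S by blast
  ultimately show ?case
    by (intro exI[of _ "\<lambda>j. lval (\<lambda>k. snd (S (Suc k)) j)"] exI[of _ "\<lambda>j. INF k. snd (S (Suc k)) j"])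
      (simp add: S[rule_format] del: One_nat_def)
qed

theorem computable_iter:
  assumes cA: "computable (\<lambda>z u. A z (pfst u) (pfst (psnd u)) (psnd (psnd u)))"
    and cB: "computable (\<lambda>z u. B z (pfst u) (pfst (psnd u)) (psnd (psnd u)))"
    and cD: "computable (\<lambda>z u. if D z (pfst u) (pfst (psnd u)) (psnd (psnd u)) then 1 else 0)"
    and cE: "computable (\<lambda>z u. E z (pfst u) (pfst (psnd u)) (psnd (psnd u)))"
    and cia: "computable ia" and cib: "computable ib"
    and spec: "\<And>z n. \<exists>a b. (a = ia z n \<and> b = ib z n \<or>
        (\<exists>ma mb. iter (A z n) (B z n) (D z n) (ia z n) (ib z n) a b ma mb)) \<and> D z n a b \<and> E z n a b = F z n"
  shows "computable F"
proof -
  \<comment> \<open>The stop condition is evaluated in the body, but the flag is tested only at the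
    head. A stopping pair therefore costs one more round, which must leave the pair as it
    is.\<close>
  define A' where "A' z u = (if (if D z (pfst u) (pfst (psnd u)) (psnd (psnd u)) then 1 else 0) \<noteq> (0::nat)
    then pfst (psnd u) else A z (pfst u) (pfst (psnd u)) (psnd (psnd u)))" for z u
  define B' where "B' z u = (if (if D z (pfst u) (pfst (psnd u)) (psnd (psnd u)) then 1 else 0) \<noteq> (0::nat)
    then psnd (psnd u) else B z (pfst u) (pfst (psnd u)) (psnd (psnd u)))" for z u
  have "computable A'" "computable B'"
    unfolding A'_def B'_def
    by (intro computable_if cA cB cD computable_pfst computable_psnd computable_id)+
  then obtain kA kB where kA: "\<And>z R. wp z kA (\<lambda>R'. R' 0 = A' z (R 0)) R"
    and kB: "\<And>z R. wp z kB (\<lambda>R'. R' 0 = B' z (R 0)) R"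
    unfolding computable_def by blast
  obtain kD where kD: "\<And>z R. wp z kD (\<lambda>R'. R' 0 = (if D z (pfst (R 0)) (pfst (psnd (R 0))) (psnd (psnd (R 0))) then 1 else 0)) R"
    using cD unfolding computable_def by blast
  obtain kE where kE: "\<And>z R. wp z kE (\<lambda>R'. R' 0 = E z (pfst (R 0)) (pfst (psnd (R 0))) (psnd (psnd (R 0)))) R"
    using cE unfolding computable_def by blast
  obtain ka kb where ka: "\<And>z R. wp z ka (\<lambda>R'. R' 0 = ia z (R 0)) R"
    and kb: "\<And>z R. wp z kb (\<lambda>R'. R' 0 = ib z (R 0)) R"
    using cia cib unfolding computable_def by blast
  have kp: "wp z pair_com (\<lambda>R'. R' 0 = pair (R 0) (R 1)) R" for z R
    using wp_pair_com unfolding pair_def .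
  \<comment> \<open>Intermediate results go to registers 5 to 8, and registers 1 to 3 are written
    only by the final copies. Hence the minima of registers 1 and 2 over a round are those of the
    old and the new value, as \<open>iter\<close> prescribes.\<close>
  define body where "body = call 9 pair_com 1 2 5 ;; call 9 pair_com 0 5 5 ;; call 9 kD 5 5 6 ;;
     call 9 kA 5 5 7 ;; call 9 kB 5 5 8 ;; Ins (Copy 7 1) ;; Ins (Copy 8 2) ;; Ins (Copy 6 3)"
  have body: "\<exists>R' m. big_step z body R R' m \<and> R' 0 = R 0 \<and> R' 4 = R 4 \<and>
      R' 1 = (if D z (R 0) (R 1) (R 2) then R 1 else A z (R 0) (R 1) (R 2)) \<and>
      R' 2 = (if D z (R 0) (R 1) (R 2) then R 2 else B z (R 0) (R 1) (R 2)) \<and>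
      R' 3 = (if D z (R 0) (R 1) (R 2) then 1 else 0) \<and>
      m 0 = R 0 \<and> m 1 = min (R 1) (R' 1) \<and> m 2 = min (R 2) (R' 2) \<and> m 3 = R 3 \<and> m 4 = R 4" for z R
  proof -
    obtain R1 m1 where 1: "big_step z (call 9 pair_com 1 2 5) R R1 m1" "\<forall>k<9. m1 k = R k"
      "\<forall>k<9. R1 k = (if k = 5 then pair (R 1) (R 2) else R k)"
      using big_step_call[OF kp, of 1 9 2 5 z R] by (auto simp del: One_nat_def)
    obtain R2 m2 where 2: "big_step z (call 9 pair_com 0 5 5) R1 R2 m2" "\<forall>k<9. m2 k = R1 k"
      "\<forall>k<9. R2 k = (if k = 5 then pair (R1 0) (R1 5) else R1 k)"
      using big_step_call[OF kp, of 0 9 5 5 z R1] by (auto simp del: One_nat_def)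
    have r5: "R2 5 = pair (R 0) (pair (R 1) (R 2))" using 1 2 by simp
    obtain R3 m3 where 3: "big_step z (call 9 kD 5 5 6) R2 R3 m3" "\<forall>k<9. m3 k = R2 k"
      "\<forall>k<9. R3 k = (if k = 6 then (if D z (R 0) (R 1) (R 2) then 1 else 0) else R2 k)"
      using big_step_call[of z kD "\<lambda>a b. if D z (pfst a) (pfst (psnd a)) (psnd (psnd a)) then 1 else 0" 5 9 5 6 R2,
          OF kD] r5 by (auto simp del: One_nat_def)
    obtain R4 m4 where 4: "big_step z (call 9 kA 5 5 7) R3 R4 m4" "\<forall>k<9. m4 k = R3 k"
      "\<forall>k<9. R4 k = (if k = 7 then A' z (R3 5) else R3 k)"
      using big_step_call[of z kA "\<lambda>a b. A' z a" 5 9 5 7 R3, OF kA] by auto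
    obtain R5 m5 where 5: "big_step z (call 9 kB 5 5 8) R4 R5 m5" "\<forall>k<9. m5 k = R4 k"
      "\<forall>k<9. R5 k = (if k = 8 then B' z (R4 5) else R4 k)"
      using big_step_call[of z kB "\<lambda>a b. B' z a" 5 9 5 8 R4, OF kB] by auto
    define R6 where "R6 = R5(1 := R5 7)"
    define R7 where "R7 = R6(2 := R6 8)"
    have 6: "big_step z (Ins (Copy 7 1)) R5 R6 R5" "big_step z (Ins (Copy 8 2)) R6 R7 R6"
      "big_step z (Ins (Copy 6 3)) R7 (R7(3 := R7 6)) R7"
      by (auto intro!: big_step_intros(1) simp: R6_def R7_def)
    have bs: "big_step z body R (R7(3 := R7 6)) (\<lambda>k. min (m1 k) (min (m2 k) (min (m3 k) (min (m4 k) (min (m5 k)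
        (min (R5 k) (min (R6 k) (R7 k))))))))"
      unfolding body_def
      by (rule big_step_intros(2)[OF 1(1) big_step_intros(2)[OF 2(1) big_step_intros(2)[OF 3(1)
            big_step_intros(2)[OF 4(1) big_step_intros(2)[OF 5(1) big_step_intros(2)[OF 6(1)
            big_step_intros(2)[OF 6(2,3)]]]]]]])
    show ?thesis
      by (rule exI, rule exI, rule conjI[OF bs])
        (simp add: 1(2,3) 2(2,3) 3(2,3) 4(2,3) 5(2,3) R6_def R7_def A'_def B'_def)
  qed
  define prog where "prog = call 9 ka 0 0 1 ;; call 9 kb 0 0 2 ;; Ins (Zero 3) ;; Ins (Zero 4) ;; Ins (Succ 4) ;;
     Loop 3 4 body ;; call 9 pair_com 1 2 5 ;; call 9 pair_com 0 5 5 ;; call 9 kE 5 5 0"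
  have loop: "wp z (Loop 3 4 body) (\<lambda>R'. \<exists>a b. R' 0 = n \<and> R' 1 = a \<and> R' 2 = b \<and> E z n a b = F z n) R"
    if R: "R 0 = n" "R 1 = ia z n" "R 2 = ib z n" "R 3 = 0" "R 4 = 1" for z n R
  proof -
    obtain a b where ab: "a = ia z n \<and> b = ib z n \<or>
        (\<exists>ma mb. iter (A z n) (B z n) (D z n) (ia z n) (ib z n) a b ma mb)" "D z n a b" "E z n a b = F z n"
      using spec by blast
    have "\<exists>R1. (R1 = R \<or> (\<exists>m. loop_step z 3 4 body R R1 m)) \<and> R1 0 = n \<and> R1 1 = a \<and> R1 2 = b \<and>
        R1 3 = 0 \<and> R1 4 = 1"
    proof (cases "a = ia z n \<and> b = ib z n")
      case True
      then show ?thesis using R by auto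
    next
      case False
      then obtain ma mb where it: "iter (A z n) (B z n) (D z n) (ia z n) (ib z n) a b ma mb" using ab by blast
      have "\<exists>R' m. loop_step z 3 4 body R R' m \<and> R' 0 = n \<and> R' 1 = a \<and> R' 2 = b \<and> R' 3 = 0 \<and> R' 4 = 1 \<and>
          m 0 = n \<and> m 1 = ma \<and> m 2 = mb \<and> m 3 = 0 \<and> m 4 = 1"
      proof (rule loop_simulates_iter[OF _ it R])
        fix R :: regs assume "R 0 = n" "R 3 = 0" "R 4 = 1" "\<not> D z n (R 1) (R 2)"
        then show "\<exists>R' m. big_step z body R R' m \<and> R' 0 = n \<and> R' 1 = A z n (R 1) (R 2) \<and>
            R' 2 = B z n (R 1) (R 2) \<and> R' 3 = 0 \<and> R' 4 = 1 \<and>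
            m 0 = n \<and> m 1 = min (R 1) (R' 1) \<and> m 2 = min (R 2) (R' 2) \<and> m 3 = 0 \<and> m 4 = 1"
          using body[of z R] by auto
      qed
      then show ?thesis by blast
    qed
    then obtain R1 where R1: "R1 = R \<or> (\<exists>m. loop_step z 3 4 body R R1 m)" "R1 0 = n" "R1 1 = a" "R1 2 = b"
      "R1 3 = 0" "R1 4 = 1" by blast
    obtain R2 m where R2: "big_step z body R1 R2 m" "R2 0 = n" "R2 1 = a" "R2 2 = b" "R2 3 = 1" "R2 4 = 1"
      using body[of z R1] R1 ab(2) by auto
    have "loop_step z 3 4 body R1 R2 (\<lambda>j. min (m j) (R2 j))"
      by (rule big_step_intros(5)) (use R1 R2 in auto)
    then obtain m' where "loop_step z 3 4 body R R2 m'" using R1(1) big_step_intros(6) by blast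
    then have "big_step z (Loop 3 4 body) R R2 (\<lambda>j. min (m' j) (R2 j))"
      using R2 by (intro big_step_intros(4)) auto
    then show ?thesis unfolding wp_def using R2 ab(3) by blast
  qed
  show ?thesis
  proof (rule computableI[of prog])
    fix z and R :: regs
    define n where "n = R 0"
    show "wp z prog (\<lambda>R'. R' 0 = F z (R 0)) R"
      unfolding prog_def n_def[symmetric]
      apply (rule wp_Seq, rule wp_call[where f = "\<lambda>a b. ia z a", OF ka], simp, simp, simp)
      apply (rule wp_Seq, rule wp_call[where f = "\<lambda>a b. ib z a", OF kb], simp, simp, simp)
      apply (rule wp_Seq, simp only: wp_Ins)+
      apply (rule wp_Seq, rule wp_mono[OF loop[where n = n]])
           apply (simp_all add: n_def[symmetric] del: One_nat_def)[5]
      apply (elim exE conjE)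
      apply (rule wp_Seq, rule wp_call[where f = pair, OF kp], simp, simp, simp)
      apply (rule wp_Seq, rule wp_call[where f = pair, OF kp], simp, simp, simp)
      apply (rule wp_call[where f = "\<lambda>u v. E z (pfst u) (pfst (psnd u)) (psnd (psnd u))", OF kE], simp, simp, simp)
      apply simp
      done
  qed
qed

section \<open>Closure properties\<close>

definition decidable :: "(nat set \<Rightarrow> nat \<Rightarrow> bool) \<Rightarrow> bool"
  where "decidable \<phi> \<longleftrightarrow> computable (\<lambda>z n. if \<phi> z n then 1 else 0)"

lemma computable_iff:
  assumes "decidable \<phi>" "computable F" "computable G"
  shows "computable (\<lambda>z n. if \<phi> z n then F z n else G z n)"
proof -
  have "computable (\<lambda>z n. if (if \<phi> z n then 1 else 0) \<noteq> (0::nat) then F z n else G z n)"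
    using assms unfolding decidable_def by (intro computable_if)
  moreover have "(\<lambda>z n. if (if \<phi> z n then 1 else 0) \<noteq> (0::nat) then F z n else G z n) =
    (\<lambda>z n. if \<phi> z n then F z n else G z n)" by (intro ext) auto
  ultimately show ?thesis by simp
qed

lemma decidable_eq: "computable F \<Longrightarrow> computable G \<Longrightarrow> decidable (\<lambda>z n. F z n = G z n)"
  unfolding decidable_def by (rule computable_eq)

lemma decidable_mem: "computable F \<Longrightarrow> decidable (\<lambda>z n. F z n \<in> z)"
  unfolding decidable_def by (rule computable_comp[OF _ computable_oracle])

lemma decidable_if:
  assumes "decidable \<phi>" "decidable \<psi>" "decidable \<theta>"
  shows "decidable (\<lambda>z n. if \<phi> z n then \<psi> z n else \<theta> z n)"
proof -
  have "(\<lambda>z n. if if \<phi> z n then \<psi> z n else \<theta> z n then 1 else 0) =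
    (\<lambda>z n. if \<phi> z n then if \<psi> z n then 1 else 0 else if \<theta> z n then 1 else (0::nat))" by (intro ext) auto
  then show ?thesis using computable_iff[OF assms(1)] assms(2,3) unfolding decidable_def by simp
qed

lemma decidable_const: "decidable (\<lambda>z n. b)"
  unfolding decidable_def by (cases b) (auto intro: computable_const)

lemma decidable_not: "decidable \<phi> \<Longrightarrow> decidable (\<lambda>z n. \<not> \<phi> z n)"
proof -
  have "(\<lambda>z n. \<not> \<phi> z n) = (\<lambda>z n. if \<phi> z n then False else True)" by (intro ext) auto
  then show "decidable \<phi> \<Longrightarrow> ?thesis" by (simp only: decidable_if decidable_const)
qed

lemma decidable_conj: "decidable \<phi> \<Longrightarrow> decidable \<psi> \<Longrightarrow> decidable (\<lambda>z n. \<phi> z n \<and> \<psi> z n)"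
proof -
  have "(\<lambda>z n. \<phi> z n \<and> \<psi> z n) = (\<lambda>z n. if \<phi> z n then \<psi> z n else False)" by (intro ext) auto
  then show "decidable \<phi> \<Longrightarrow> decidable \<psi> \<Longrightarrow> ?thesis" by (simp only: decidable_if decidable_const)
qed

lemma decidable_disj: "decidable \<phi> \<Longrightarrow> decidable \<psi> \<Longrightarrow> decidable (\<lambda>z n. \<phi> z n \<or> \<psi> z n)"
proof -
  have "(\<lambda>z n. \<phi> z n \<or> \<psi> z n) = (\<lambda>z n. if \<phi> z n then True else \<psi> z n)" by (intro ext) auto
  then show "decidable \<phi> \<Longrightarrow> decidable \<psi> \<Longrightarrow> ?thesis" by (simp only: decidable_if decidable_const)
qed

lemma decidable_imp: "decidable \<phi> \<Longrightarrow> decidable \<psi> \<Longrightarrow> decidable (\<lambda>z n. \<phi> z n \<longrightarrow> \<psi> z n)"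
  unfolding imp_conv_disj by (intro decidable_disj decidable_not)

lemma decidable_sub: "decidable \<phi> \<Longrightarrow> computable F \<Longrightarrow> decidable (\<lambda>z n. \<phi> z (F z n))"
  unfolding decidable_def by (rule computable_comp)

lemma iter_finite:
  assumes "\<And>i. i < k \<Longrightarrow> \<not> D (f i) (g i) \<and> A (f i) (g i) = f (Suc i) \<and> B (f i) (g i) = g (Suc i)"
  shows "(f k = f 0 \<and> g k = g 0) \<or> (\<exists>ma mb. iter A B D (f 0) (g 0) (f k) (g k) ma mb)"
  using assms
proof (induction k)
  case (Suc k)
  then have "\<not> D (f k) (g k)" "A (f k) (g k) = f (Suc k)" "B (f k) (g k) = g (Suc k)" by auto
  then have "\<exists>ma mb. iter A B D (f k) (g k) (f (Suc k)) (g (Suc k)) ma mb"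
    using iter.Step[of D "f k" "g k" A B] by auto
  then show ?case using Suc iter.Trans by (metis less_SucI)
qed simp

lemma computable_rec:
  assumes g: "computable g" and b: "computable b"
    and h: "computable (\<lambda>z u. h z (pfst u) (pfst (psnd u)) (psnd (psnd u)))"
  shows "computable (\<lambda>z n. rec_nat (g z n) (h z n) (b z n))"
proof (rule computable_iter[where A = "\<lambda>z n k r. Suc k" and B = "h" and D = "\<lambda>z n k r. k = b z n"
      and E = "\<lambda>z n k r. r" and ia = "\<lambda>z n. 0" and ib = g])
  fix z n
  let ?r = "rec_nat (g z n) (h z n)"
  have "(b z n = 0 \<and> ?r (b z n) = ?r 0) \<or> (\<exists>ma mb. iter (\<lambda>k r. Suc k) (h z n) (\<lambda>k r. k = b z n) 0 (?r 0)
      (b z n) (?r (b z n)) ma mb)"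
    using iter_finite[of "b z n" "\<lambda>k r. k = b z n" "\<lambda>i. i" ?r "\<lambda>k r. Suc k" "h z n"] by auto
  then show "\<exists>a ba. (a = 0 \<and> ba = g z n \<or> (\<exists>ma mb. iter (\<lambda>k r. Suc k) (h z n) (\<lambda>k r. k = b z n) 0 (g z n) a ba ma mb)) \<and>
      a = b z n \<and> ba = rec_nat (g z n) (h z n) (b z n)"
    by auto
next
  have "decidable (\<lambda>z u. pfst (psnd u) = b z (pfst u))"
    by (intro decidable_eq computable_pfst computable_psnd computable_id computable_comp[OF _ b])
  then show "computable (\<lambda>z u. if pfst (psnd u) = b z (pfst u) then 1 else 0)" 
    unfolding decidable_def .
qed (intro assms computable_pfst computable_psnd computable_id computable_Suc computable_const)+

lemma computable_pred:
  assumes "computable F" shows "computable (\<lambda>z n. F z n - 1)"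
proof -
  have "computable (\<lambda>z n. rec_nat 0 (\<lambda>k r. k) (F z n))"
    by (intro computable_rec computable_const assms computable_pfst computable_psnd computable_id)
  moreover have "rec_nat 0 (\<lambda>k r. k) m = m - 1" for m :: nat by (cases m) auto
  ultimately show ?thesis by simp
qed

lemma computable_diff:
  assumes "computable F" "computable G" shows "computable (\<lambda>z n. F z n - G z n)"
proof -
  have "computable (\<lambda>z n. rec_nat (F z n) (\<lambda>k r. r - 1) (G z n))"
    by (intro computable_rec computable_pred assms computable_pfst computable_psnd computable_id)
  moreover have "rec_nat a (\<lambda>k r. r - 1) m = a - m" for a m :: nat by (induction m) auto
  ultimately show ?thesis by simp
qed

lemma decidable_le: "computable F \<Longrightarrow> computable G \<Longrightarrow> decidable (\<lambda>z n. F z n \<le> G z n)"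
  using decidable_eq[OF computable_diff[of F G] computable_const[of 0]] by simp

lemma decidable_less: "computable F \<Longrightarrow> computable G \<Longrightarrow> decidable (\<lambda>z n. F z n < G z n)"
  using decidable_le[OF computable_Suc[of F], of G] by (simp add: Suc_le_eq)

lemma computable_min: "computable F \<Longrightarrow> computable G \<Longrightarrow> computable (\<lambda>z n. min (F z n) (G z n))"
  unfolding min_def by (intro computable_iff decidable_le)

text \<open>The counter runs through the candidates shifted by one, so that it is 0 only after overflowing.\<close>

lemma decidable_ex:
  assumes "decidable (\<lambda>z u. \<phi> z (pfst u) (psnd u))"
  shows "decidable (\<lambda>z n. \<exists>k. \<phi> z n k)"
  unfolding decidable_def
proof (rule computable_iter[where A = "\<lambda>z n a b. Suc a" and B = "\<lambda>z n a b. 0"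
      and D = "\<lambda>z n a b. a = 0 \<or> \<phi> z n (a - 1)" and E = "\<lambda>z n a b. if a = 0 then 0 else 1"
      and ia = "\<lambda>z n. 1" and ib = "\<lambda>z n. 0"])
  have "decidable (\<lambda>z u. pfst (psnd u) = 0 \<or> \<phi> z (pfst (pair (pfst u) (pfst (psnd u) - 1)))
      (psnd (pair (pfst u) (pfst (psnd u) - 1))))"
    by (intro decidable_disj decidable_eq decidable_sub[OF assms] computable_pred
        computable_pair computable_pfst computable_psnd computable_id computable_const)
  then show "computable (\<lambda>z u. if pfst (psnd u) = 0 \<or> \<phi> z (pfst u) (pfst (psnd u) - 1) then 1 else 0)"
    unfolding decidable_def by simp
  show "computable (\<lambda>z u. if pfst (psnd u) = 0 then 0 else 1)"
    by (intro computable_iff decidable_eq computable_pfst computable_psnd computable_id computable_const)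
  fix z n
  let ?D = "\<lambda>a b::nat. a = 0 \<or> \<phi> z n (a - 1)"
  let ?it = "iter (\<lambda>a b. Suc a) (\<lambda>a b. 0) ?D"
  show "\<exists>a b. (a = 1 \<and> b = 0 \<or> (\<exists>ma mb. ?it 1 0 a b ma mb)) \<and> (a = 0 \<or> \<phi> z n (a - 1)) \<and>
      (if a = 0 then 0 else 1) = (if \<exists>k. \<phi> z n k then 1 else (0::nat))"
  proof (cases "\<exists>k. \<phi> z n k")
    case True
    define k where "k = (LEAST k. \<phi> z n k)"
    have k: "\<phi> z n k" "\<And>i. i < k \<Longrightarrow> \<not> \<phi> z n i"
      unfolding k_def using LeastI_ex[OF True] not_less_Least by blast+
    have "(Suc k = Suc 0 \<and> 0 = (0::nat)) \<or> (\<exists>ma mb. ?it (Suc 0) 0 (Suc k) 0 ma mb)"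
      by (rule iter_finite[of k ?D Suc "\<lambda>i. 0"]) (use k in auto)
    then show ?thesis using k(1) True by (intro exI[of _ "Suc k"] exI[of _ 0]) auto
  next
    case False
    have "?it (Suc k) 0 (Suc (Suc k)) 0 (Suc k) 0" for k
      using iter.Step[of ?D "Suc k" 0 "\<lambda>a b. Suc a" "\<lambda>a b. 0"] False by simp
    then have "?it 1 0 (lval Suc) (lval (\<lambda>_. 0)) (INF k. Suc k) (INF k::nat. 0)"
      using iter.Limit[of _ _ ?D Suc "\<lambda>_. 0" Suc "\<lambda>_. 0"] by simp
    moreover have "lval Suc = 0" by (rule lval_overflow) (auto intro: le_imp_less_Suc)
    ultimately show ?thesis using False by (intro exI[of _ 0]) (auto simp del: One_nat_def)
  qed
qed (intro computable_Suc computable_pfst computable_psnd computable_id computable_const)+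

lemma decidable_all:
  assumes "decidable (\<lambda>z u. \<phi> z (pfst u) (psnd u))"
  shows "decidable (\<lambda>z n. \<forall>k. \<phi> z n k)"
  using decidable_not[OF decidable_ex[OF decidable_not[OF assms]]] by simp

lemma computable_app3:
  assumes "computable (\<lambda>z u. f z (pfst u) (pfst (psnd u)) (psnd (psnd u)))"
    "computable F" "computable G" "computable H"
  shows "computable (\<lambda>z n. f z (F z n) (G z n) (H z n))"
  using computable_comp[OF computable_pair[OF assms(2) computable_pair[OF assms(3,4)]] assms(1)] by simp

lemma decidable_app2:
  assumes "decidable (\<lambda>z u. \<phi> z (pfst u) (psnd u))" "computable F" "computable G"
  shows "decidable (\<lambda>z n. \<phi> z (F z n) (G z n))"
  using decidable_sub[OF assms(1) computable_pair[OF assms(2,3)]] by simp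

lemmas computable_intros = computable_const computable_pfst computable_psnd computable_pair
  computable_Suc computable_pred computable_diff computable_min computable_iff
  decidable_not decidable_conj decidable_disj decidable_imp decidable_eq decidable_le decidable_less

lemma pfst_le: "pfst n \<le> n" and psnd_le: "psnd n \<le> n"
  using le_prod_encode_1[of "pfst n" "psnd n"] le_prod_encode_2[of "psnd n" "pfst n"]
  by (simp_all add: pair_def[symmetric])

lemma pfst_0 [simp]: "pfst 0 = 0" and psnd_0 [simp]: "psnd 0 = 0"
  using pfst_le[of 0] psnd_le[of 0] by simp_all

section \<open>Well-foundedness of trees\<close>

text \<open>
  Nodes are positive numbers. The code of a child exceeds that of its parent, so during a
  depth-first search below a node the limit inferior of the current node is that node, whereas
  along an infinite branch it overflows to 0, which is not a node.
\<close>

definition child :: "(nat \<Rightarrow> nat \<Rightarrow> nat) \<Rightarrow> nat \<Rightarrow> nat \<Rightarrow> nat"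
  where "child X u i = Suc (pair u (pair i (X u i)))"

inductive wf_node :: "(nat \<Rightarrow> nat \<Rightarrow> nat) \<Rightarrow> (nat \<Rightarrow> bool) \<Rightarrow> nat \<Rightarrow> bool" for X T where
  "(\<And>i. T (child X u i) \<Longrightarrow> wf_node X T (child X u i)) \<Longrightarrow> wf_node X T u"

text \<open>A search state is a node with an index: index \<open>i + 1\<close> means that branch
  \<open>i\<close> is to be examined next, index 0 that all branches have been dealt with. From
  index 0 the search returns to the parent, which the code of the node records.\<close>

definition next_node :: "(nat \<Rightarrow> nat \<Rightarrow> nat) \<Rightarrow> (nat \<Rightarrow> bool) \<Rightarrow> nat \<Rightarrow> nat \<Rightarrow> nat" where
  "next_node X T s i = (if i = 0 then pfst (s - 1)
     else if T (child X s (i - 1)) then child X s (i - 1) else s)"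

text \<open>On return from branch \<open>i\<close> the next branch is \<open>i + 1\<close>, whose
  index is \<open>i + 2\<close>; hence the double successor.\<close>

definition next_index :: "(nat \<Rightarrow> nat \<Rightarrow> nat) \<Rightarrow> (nat \<Rightarrow> bool) \<Rightarrow> nat \<Rightarrow> nat \<Rightarrow> nat" where
  "next_index X T s i = (if i = 0 then Suc (Suc (pfst (psnd (s - 1))))
     else if T (child X s (i - 1)) then 1 else Suc i)"

text \<open>Node 0 signals an overflow along an infinite branch; the other alternative is the root,
  coded by 1, after a complete search.\<close>

definition search_done :: "nat \<Rightarrow> nat \<Rightarrow> bool"
  where "search_done s i \<longleftrightarrow> s = 0 \<or> s = 1 \<and> i = 0"

abbreviation search where
  "search X T \<equiv> iter (next_node X T) (next_index X T) search_done"

lemma child_greater: "u < child X u i"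
  unfolding child_def pair_def using le_prod_encode_1[of u] by (simp add: less_Suc_eq_le)

text \<open>Nodes in the subtree of branch \<open>k\<close> exceed \<open>u\<close>, so the node
  minimum is \<open>u\<close>. The index minimum is 0 if the child is entered, because the index
  drops to 0 before the return to \<open>u\<close>, and \<open>Suc k\<close> otherwise.\<close>

lemma search_block:
  assumes "1 \<le> u" and "T (child X u k) \<Longrightarrow> \<exists>mb. search X T (child X u k) 1 (child X u k) 0 (child X u k) mb"
  shows "\<exists>mb. (mb = 0 \<or> mb = Suc k) \<and> search X T u (Suc k) u (Suc (Suc k)) u mb"
proof (cases "T (child X u k)")
  case False
  have "search X T u (Suc k) (next_node X T u (Suc k)) (next_index X T u (Suc k))
      (min u (next_node X T u (Suc k))) (min (Suc k) (next_index X T u (Suc k)))"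
    by (rule iter.Step) (use assms in \<open>auto simp: search_done_def\<close>)
  then show ?thesis using False by (auto simp: next_node_def next_index_def)
next
  case True
  define w where "w = child X u k"
  have w: "u < w" unfolding w_def by (rule child_greater)
  have 1: "search X T u (Suc k) w 1 u 1"
    using iter.Step[of search_done u "Suc k" "next_node X T" "next_index X T"] True assms(1) w
    by (auto simp: search_done_def next_node_def next_index_def w_def)
  obtain mb where 2: "search X T w 1 w 0 w mb" using assms(2)[OF True] unfolding w_def by blast
  have 3: "search X T w 0 u (Suc (Suc k)) u 0"
    using iter.Step[of search_done w 0 "next_node X T" "next_index X T"] assms(1) w
    by (auto simp: search_done_def next_node_def next_index_def w_def child_def)
  have "search X T u (Suc k) u (Suc (Suc k)) (min u (min w u)) (min 1 (min mb 0))"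
    by (rule iter.Trans[OF 1 iter.Trans[OF 2 3]])
  then show ?thesis using w by auto
qed

text \<open>At the limit over all branches the index becomes 0, the mark of a finished node, for one
  of two reasons: if infinitely many branches are entered, the minimum 0 recurs; if not, the index
  grows without bound and is reset.\<close>

lemma search_wf_node:
  assumes "wf_node X T u" "1 \<le> u"
  shows "\<exists>mb. search X T u 1 u 0 u mb"
  using assms
proof (induction)
  case (1 u)
  have "\<exists>mb. (mb = 0 \<or> mb = Suc k) \<and> search X T u (Suc k) u (Suc (Suc k)) u mb" for k
    by (rule search_block) (use 1 child_greater[of u X k] in auto)
  then obtain mb where mb: "\<And>k. mb k = 0 \<or> mb k = Suc k"
      "\<And>k. search X T u (Suc k) u (Suc (Suc k)) u (mb k)" by metis
  have "lval mb = 0"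
  proof (cases "\<exists>\<^sub>\<infinity>k. mb k = 0")
    case True
    then show ?thesis by (rule lval_eqI) simp
  next
    case False
    then obtain N where "\<forall>k\<ge>N. mb k \<noteq> 0" by (auto simp: not_INFM MOST_nat_le)
    then have "mb k = Suc k" if "N \<le> k" for k using that mb(1) by blast
    then have "\<exists>N. \<forall>k\<ge>N. v < mb k" for v
      by (intro exI[of _ "max N v"]) auto
    then show ?thesis by (rule lval_overflow)
  qed
  moreover have "search X T u 1 (lval (\<lambda>_. u)) (lval mb) (INF k::nat. u) (INF k. mb k)"
    using iter.Limit[of _ _ _ "\<lambda>_. u" Suc "\<lambda>_. u" mb] mb(2) by simp
  ultimately show ?case by auto
qed

text \<open>The children before the least ill-founded one are searched completely in finitely many
  blocks, none of which takes the node below \<open>u\<close>.\<close>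

lemma search_ill_founded:
  assumes "\<not> wf_node X T u" "1 \<le> u"
  shows "\<exists>i mb. \<not> wf_node X T (child X u i) \<and> T (child X u i) \<and> search X T u 1 (child X u i) 1 u mb"
proof -
  have ex: "\<exists>i. T (child X u i) \<and> \<not> wf_node X T (child X u i)"
    using assms(1) wf_node.intros by blast
  define i where "i = (LEAST i. T (child X u i) \<and> \<not> wf_node X T (child X u i))"
  have i: "T (child X u i)" "\<not> wf_node X T (child X u i)"
    using LeastI_ex[OF ex] unfolding i_def by blast+
  have below: "wf_node X T (child X u k)" if "k < i" "T (child X u k)" for k
    using not_less_Least that unfolding i_def by blast
  have "j \<le> i \<Longrightarrow> j = 0 \<or> (\<exists>mb. search X T u 1 u (Suc j) u mb)" for j
  proof (induction j)
    case (Suc j)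
    have "\<exists>mb. (mb = 0 \<or> mb = Suc j) \<and> search X T u (Suc j) u (Suc (Suc j)) u mb"
    proof (rule search_block)
      assume "T (child X u j)"
      then have "wf_node X T (child X u j)" using below Suc by simp
      then show "\<exists>mb. search X T (child X u j) 1 (child X u j) 0 (child X u j) mb"
        by (rule search_wf_node) (use assms child_greater[of u X j] in simp)
    qed (use assms in simp)
    then obtain mb where mb: "search X T u (Suc j) u (Suc (Suc j)) u mb" by blast
    show ?case
    proof (cases "j = 0")
      case True
      then show ?thesis using mb by auto
    next
      case False
      then obtain mb' where "search X T u 1 u (Suc j) u mb'" using Suc by auto
      from iter.Trans[OF this mb] show ?thesis by auto
    qed
  qed simp
  then have 1: "i = 0 \<or> (\<exists>mb. search X T u 1 u (Suc i) u mb)" by blast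
  have 2: "search X T u (Suc i) (child X u i) 1 u 1"
    using iter.Step[of search_done u "Suc i" "next_node X T" "next_index X T"] i assms(2)
      child_greater[of u X i]
    by (auto simp: search_done_def next_node_def next_index_def)
  have "\<exists>mb. search X T u 1 (child X u i) 1 u mb"
  proof (cases "i = 0")
    case True
    then show ?thesis using 2 by auto
  next
    case False
    then obtain mb where "search X T u 1 u (Suc i) u mb" using 1 by blast
    from iter.Trans[OF this 2] show ?thesis by auto
  qed
  then show ?thesis using i by blast
qed

lemma ill_founded_branch:
  assumes "\<not> wf_node X T u"
  obtains f i where "f 0 = u" "\<And>k. f (Suc k) = child X (f k) (i k)" "\<And>k. T (f (Suc k))"
proof -
  have "\<exists>f. \<forall>k. ((k = 0 \<longrightarrow> f k = u) \<and> \<not> wf_node X T (f k)) \<and>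
      (\<exists>i. f (Suc k) = child X (f k) i \<and> T (f (Suc k)))"
  proof (rule dependent_nat_choice, goal_cases)
    case 1
    then show ?case using assms by blast
  next
    case (2 w k)
    then show ?case using wf_node.intros[of T X w] by blast
  qed
  then obtain f where f: "\<forall>k. ((k = 0 \<longrightarrow> f k = u) \<and> \<not> wf_node X T (f k)) \<and>
      (\<exists>i. f (Suc k) = child X (f k) i \<and> T (f (Suc k)))" by blast
  then obtain i where "\<forall>k. f (Suc k) = child X (f k) (i k)" by metis
  then show ?thesis using that f by blast
qed

lemma search_overflow:
  assumes "\<not> wf_node X T 1"
  shows "\<exists>b ma mb. search X T 1 1 0 b ma mb"
proof -
  have "\<exists>f. \<forall>k. (\<not> wf_node X T (f k) \<and> 1 \<le> f k \<and> (k = 0 \<longrightarrow> f k = 1)) \<and>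
      (f k < f (Suc k) \<and> (\<exists>mb. search X T (f k) 1 (f (Suc k)) 1 (f k) mb))"
  proof (rule dependent_nat_choice, goal_cases)
    case 1
    then show ?case using assms by blast
  next
    case (2 u k)
    then obtain i mb where "\<not> wf_node X T (child X u i)" "search X T u 1 (child X u i) 1 u mb"
      using search_ill_founded[of X T u] by blast
    then show ?case using child_greater[of u X i] 2 by (intro exI[of _ "child X u i"]) auto
  qed
  then obtain f where f: "f 0 = 1" "\<And>k. f k < f (Suc k)"
      "\<And>k. \<exists>mb. search X T (f k) 1 (f (Suc k)) 1 (f k) mb" by blast
  from f(3) obtain mb where "\<And>k. search X T (f k) 1 (f (Suc k)) 1 (f k) (mb k)" by metis
  then have "search X T (f 0) 1 (lval f) (lval mb) (INF k. f k) (INF k. mb k)"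
    using iter.Limit[of _ _ _ f "\<lambda>_. 1" f mb] by simp
  moreover have "lval f = 0"
  proof (rule lval_overflow)
    fix v
    have "strict_mono f" using f(2) by (simp add: strict_mono_Suc_iff)
    then have "k \<le> f k" for k by (rule strict_mono_imp_increasing)
    then show "\<exists>N. \<forall>k\<ge>N. v < f k" by (intro exI[of _ "Suc v"]) (meson Suc_le_lessD le_trans)
  qed
  ultimately show ?thesis using f(1) by auto
qed

lemma decidable_wf_node:
  assumes X: "computable (\<lambda>z u. X z (pfst u) (pfst (psnd u)) (psnd (psnd u)))"
    and T: "decidable (\<lambda>z u. T z (pfst u) (psnd u))"
  shows "decidable (\<lambda>z n. wf_node (X z n) (T z n) 1)"
  unfolding decidable_def
proof (rule computable_iter[where A = "\<lambda>z n. next_node (X z n) (T z n)" and B = "\<lambda>z n. next_index (X z n) (T z n)"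
      and D = "\<lambda>z n. search_done" and E = "\<lambda>z n a b. if a = 0 then 0 else 1"
      and ia = "\<lambda>z n. 1" and ib = "\<lambda>z n. 1"])
  have ch: "computable (\<lambda>z u. child (X z (pfst u)) (pfst (psnd u)) (psnd (psnd u) - 1))"
    unfolding child_def
    by (intro computable_intros computable_app3[OF X] computable_id)
  have Tch: "decidable (\<lambda>z u. T z (pfst u) (child (X z (pfst u)) (pfst (psnd u)) (psnd (psnd u) - 1)))"
    by (intro decidable_app2[OF T] ch computable_pfst computable_id)
  show "computable (\<lambda>z u. next_node (X z (pfst u)) (T z (pfst u)) (pfst (psnd u)) (psnd (psnd u)))"
    unfolding next_node_def by (intro computable_intros ch Tch computable_id)
  show "computable (\<lambda>z u. next_index (X z (pfst u)) (T z (pfst u)) (pfst (psnd u)) (psnd (psnd u)))"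
    unfolding next_index_def by (intro computable_intros Tch computable_id)
  show "computable (\<lambda>z u. if search_done (pfst (psnd u)) (psnd (psnd u)) then 1 else 0)"
    unfolding search_done_def by (intro computable_intros computable_id)
  show "computable (\<lambda>z u. if pfst (psnd u) = 0 then 0 else 1)"
    by (intro computable_intros computable_id)
  fix z n
  show "\<exists>a b. (a = 1 \<and> b = 1 \<or> (\<exists>ma mb. search (X z n) (T z n) 1 1 a b ma mb)) \<and> search_done a b \<and>
      (if a = 0 then 0 else 1) = (if wf_node (X z n) (T z n) 1 then 1 else (0::nat))"
  proof (cases "wf_node (X z n) (T z n) 1")
    case True
    then have "\<exists>mb. search (X z n) (T z n) 1 1 1 0 1 mb" by (intro search_wf_node) auto
    then show ?thesis using True by (intro exI[of _ 1] exI[of _ 0]) (auto simp: search_done_def)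
  next
    case False
    then obtain b where "\<exists>ma mb. search (X z n) (T z n) 1 1 0 b ma mb" using search_overflow by blast
    then show ?thesis using False by (intro exI[of _ 0] exI[of _ b]) (auto simp: search_done_def)
  qed
qed (intro computable_intros)+

section \<open>Inductive definitions\<close>

inductive derivable :: "(nat \<Rightarrow> bool) \<Rightarrow> (nat \<Rightarrow> nat \<Rightarrow> nat \<Rightarrow> nat) \<Rightarrow> nat \<Rightarrow> bool" for Ax h where
  Axiom: "Ax a \<Longrightarrow> derivable Ax h a"
| Rule: "(\<And>i. derivable Ax h (h a e i)) \<Longrightarrow> derivable Ax h a"

text \<open>
  A failed derivation of \<open>a\<close> is an infinite branch of a tree: a sequence of statements starting
  with \<open>a\<close>, none of them an axiom, which contains, for each of its members and each rule, an
  underivable premise of that rule. The pair \<open>(j, e)\<close> coded by the length of a node names the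
  member and the rule to be dealt with next.
\<close>

definition node_len :: "nat \<Rightarrow> nat" where "node_len s = pfst (psnd (psnd (s - 1)))"
definition node_val :: "nat \<Rightarrow> nat" where "node_val s = psnd (psnd (psnd (s - 1)))"
definition ancestor :: "nat \<Rightarrow> nat \<Rightarrow> nat" where "ancestor s k = rec_nat s (\<lambda>_ r. pfst (r - 1)) k"
definition item :: "nat \<Rightarrow> nat \<Rightarrow> nat \<Rightarrow> nat"
  where "item a s j = (if j = 0 then a else node_val (ancestor s (node_len s - j)))"
definition refutation :: "(nat \<Rightarrow> nat \<Rightarrow> nat \<Rightarrow> nat) \<Rightarrow> nat \<Rightarrow> nat \<Rightarrow> nat \<Rightarrow> nat" where
  "refutation h a s i =
     pair (Suc (node_len s)) (h (item a s (pfst (node_len s))) (psnd (node_len s)) i)"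

lemma ancestor_Suc: "ancestor s (Suc k) = ancestor (pfst (s - 1)) k"
  by (induction k) (auto simp: ancestor_def)

lemma node_len_child: "node_len (child (refutation h a) s i) = Suc (node_len s)"
  by (simp add: node_len_def child_def refutation_def)

lemma node_len_root: "node_len 1 = 0"
  by (simp add: node_len_def)

lemma item_child:
  "j \<le> node_len s \<Longrightarrow> item a (child (refutation h a) s i) j = item a s j"
  "item a (child (refutation h a) s i) (Suc (node_len s)) =
     h (item a s (pfst (node_len s))) (psnd (node_len s)) i"
  unfolding item_def node_len_child
  by (simp_all add: Suc_diff_le ancestor_Suc)
    (simp_all add: child_def refutation_def ancestor_def node_val_def item_def)

text \<open>The axiom case is separate because \<open>wf_node\<close> tests only proper descendants
  of the root. An infinite branch yields a sequence without axioms that contains a premise of every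
  rule for each member; induction on derivations then keeps derivable statements out of it.
  Conversely, induction on the tree gives a derivable member at every well-founded node: otherwise
  the rule named by the length has an underivable premise, and the child appending that premise has
  no derivable member.\<close>

lemma derivable_iff_wf_node:
  "derivable Ax h a \<longleftrightarrow> Ax a \<or> wf_node (refutation h a) (\<lambda>s. \<not> Ax (node_val s)) 1"
proof
  have last: "node_val (child (refutation h a) s i) =
      h (item a s (pfst (node_len s))) (psnd (node_len s)) i" for s i
    by (simp add: child_def refutation_def node_val_def)
  assume a: "derivable Ax h a"
  show "Ax a \<or> wf_node (refutation h a) (\<lambda>s. \<not> Ax (node_val s)) 1"
  proof (rule ccontr)
    assume "\<not> ?thesis"
    then have "\<not> Ax a" and ill: "\<not> wf_node (refutation h a) (\<lambda>s. \<not> Ax (node_val s)) 1" by auto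
    obtain f i where f: "f 0 = 1" "\<And>k. f (Suc k) = child (refutation h a) (f k) (i k)"
        "\<And>k. \<not> Ax (node_val (f (Suc k)))"
      using ill_founded_branch[OF ill] by metis
    have len: "node_len (f k) = k" for k
      by (induction k) (simp_all add: f node_len_child node_len_root del: One_nat_def)
    define x where "x k = item a (f k) k" for k
    have stable: "item a (f k) j = x j" if "j \<le> k" for j k
      using that
    proof (induction k)
      case (Suc k)
      then show ?case
        using item_child(1)[of j "f k" a h "i k"] len by (cases "j = Suc k") (auto simp: x_def f)
    qed (simp add: x_def)
    have x_Suc: "x (Suc k) = h (x (pfst k)) (psnd k) (i k)" for k
      using item_child(2)[of a h "f k" "i k"] stable[of "pfst k" k] pfst_le[of k]
      by (simp add: x_def f len)
    have nAx: "\<not> Ax (x k)" for k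
    proof (cases k)
      case 0
      then show ?thesis using \<open>\<not> Ax a\<close> by (simp add: x_def item_def)
    next
      case (Suc k)
      then show ?thesis using f(3)[of k] last[of "f k" "i k"] x_Suc[of k] stable[of "pfst k" k] pfst_le[of k]
        by (simp add: f len)
    qed
    have "derivable Ax h b \<Longrightarrow> b \<noteq> x j" for b j
    proof (induction arbitrary: j rule: derivable.induct)
      case (Axiom b)
      then show ?case using nAx by blast
    next
      case (Rule b e)
      \<comment> \<open>Stage \<open>pair j e\<close> appends a premise of rule \<open>e\<close> for
        member \<open>j\<close>; that member exists by then because
        \<open>j \<le> pair j e\<close>.\<close>
      then show ?case using x_Suc[of "pair j e"] by (metis pair_simps(1,2))
    qed
    moreover have "x 0 = a" by (simp add: x_def item_def)
    ultimately show False using a by blast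
  qed
next
  have "wf_node (refutation h a) (\<lambda>s. \<not> Ax (node_val s)) s \<Longrightarrow>
      \<exists>j\<le>node_len s. derivable Ax h (item a s j)" for s
  proof (induction rule: wf_node.induct)
    case (1 s)
    show ?case
    proof (rule ccontr)
      assume n: "\<not> ?case"
      then have "\<not> derivable Ax h (item a s (pfst (node_len s)))" using pfst_le by blast
      then obtain i where i: "\<not> derivable Ax h (h (item a s (pfst (node_len s))) (psnd (node_len s)) i)"
        using derivable.Rule by blast
      define w where "w = child (refutation h a) s i"
      have "node_val w = h (item a s (pfst (node_len s))) (psnd (node_len s)) i"
        by (simp add: w_def child_def refutation_def node_val_def)
      then have "\<not> Ax (node_val w)" using i derivable.Axiom by metis
      then obtain j where "j \<le> node_len w" "derivable Ax h (item a w j)"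
        using 1 unfolding w_def by blast
      then show False
        using n i item_child(1)[of j s a h i] item_child(2)[of a h s i] unfolding w_def node_len_child
        by (metis le_Suc_eq)
    qed
  qed
  from this[of 1] show "Ax a \<or> wf_node (refutation h a) (\<lambda>s. \<not> Ax (node_val s)) 1 \<Longrightarrow> derivable Ax h a"
    using derivable.Axiom by (auto simp: node_len_root item_def simp del: One_nat_def)
qed

lemma decidable_derivable:
  assumes Ax: "decidable Ax" and h: "computable (\<lambda>z u. h z (pfst u) (pfst (psnd u)) (psnd (psnd u)))"
  shows "decidable (\<lambda>z a. derivable (Ax z) (h z) a)"
proof -
  have "computable (\<lambda>z u. item (pfst u) (pfst (psnd u)) (pfst (node_len (pfst (psnd u)))))"
    unfolding item_def node_val_def ancestor_def node_len_def
    by (intro computable_intros computable_rec computable_id)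
  then have "computable (\<lambda>z u. refutation (h z) (pfst u) (pfst (psnd u)) (psnd (psnd u)))"
    unfolding refutation_def
    by (intro computable_intros computable_app3[OF h] computable_id)
      (auto simp: node_len_def intro!: computable_intros computable_id)
  moreover have "decidable (\<lambda>z u. \<not> Ax z (node_val (psnd u)))"
    unfolding node_val_def by (intro decidable_not decidable_sub[OF Ax] computable_intros computable_id)
  ultimately show ?thesis
    unfolding derivable_iff_wf_node by (intro decidable_disj Ax decidable_wf_node)
qed

section \<open>Coding of finitely supported sequences\<close>

text \<open>A sequence is coded by iterated pairs. Codes are not unique (0 and 1 both code the zero
  sequence), which is why states and minima are compared entrywise throughout.\<close>

definition entry :: "nat \<Rightarrow> nat \<Rightarrow> nat" where "entry c j = pfst (rec_nat c (\<lambda>_ r. psnd r) j)"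

lemma entry_0 [simp]: "entry c 0 = pfst c" and entry_Suc: "entry c (Suc j) = entry (psnd c) j"
proof -
  have "rec_nat c (\<lambda>_ r. psnd r) (Suc j) = rec_nat (psnd c) (\<lambda>_ r. psnd r) j" for c j
    by (induction j) auto
  then show "entry c (Suc j) = entry (psnd c) j" unfolding entry_def by simp
qed (simp add: entry_def)

lemma computable_entry:
  "computable F \<Longrightarrow> computable G \<Longrightarrow> computable (\<lambda>z n. entry (F z n) (G z n))"
  unfolding entry_def by (intro computable_intros computable_rec computable_id)

lemma code_exists:
  assumes "\<exists>N. \<forall>j\<ge>N. f j = 0"
  shows "\<exists>c. \<forall>j. entry c j = f j"
proof -
  have "\<forall>j\<ge>N. f j = 0 \<Longrightarrow> \<exists>c. \<forall>j. entry c j = f j" for N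
  proof (induction N arbitrary: f)
    case 0
    have "entry 0 j = 0" for j by (induction j) (auto simp: entry_Suc)
    then show ?case using 0 by (intro exI[of _ 0]) auto
  next
    case (Suc N)
    then have "\<forall>j\<ge>N. f (Suc j) = 0" by simp
    then obtain c where "\<forall>j. entry c j = f (Suc j)" using Suc.IH[of "\<lambda>j. f (Suc j)"] by blast
    then have "\<forall>j. entry (pair (f 0) c) j = f j" by (intro allI, rename_tac j, case_tac j) (auto simp: entry_Suc)
    then show ?case by blast
  qed
  then show ?thesis using assms by blast
qed

section \<open>Cohen conditions and category\<close>

text \<open>
  A condition is a pair of a length and a code of a sequence, of which only the entries below
  the length matter; codes of conditions are therefore not unique.
\<close>

definition cyl :: "nat \<Rightarrow> nat set set"
  where "cyl p = {z. \<forall>i<pfst p. i \<in> z \<longleftrightarrow> entry (psnd p) i \<noteq> 0}"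

definition extends :: "nat \<Rightarrow> nat \<Rightarrow> bool" where
  "extends q p \<longleftrightarrow> pfst p \<le> pfst q \<and> (\<forall>i. i < pfst p \<longrightarrow> (entry (psnd q) i \<noteq> 0 \<longleftrightarrow> entry (psnd p) i \<noteq> 0))"

lemma extends_refl [simp]: "extends p p"
  by (simp add: extends_def)

lemma extends_trans: "extends r q \<Longrightarrow> extends q p \<Longrightarrow> extends r p"
  unfolding extends_def by auto

lemma extends_0 [simp]: "extends p 0"
  by (simp add: extends_def)

lemma cyl_0 [simp]: "cyl 0 = UNIV"
  by (simp add: cyl_def)

lemma cyl_mono: "extends q p \<Longrightarrow> z \<in> cyl q \<Longrightarrow> z \<in> cyl p"
  by (auto simp: extends_def cyl_def)

lemma extendsI: "z \<in> cyl p \<Longrightarrow> z \<in> cyl q \<Longrightarrow> pfst p \<le> pfst q \<Longrightarrow> extends q p"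
  unfolding extends_def cyl_def by force

lemma common_extension:
  assumes "z \<in> cyl p" "z \<in> cyl q"
  obtains r where "z \<in> cyl r" "extends r p" "extends r q"
  using assms extendsI extends_refl by (metis linear)

lemma cyl_prefix:
  obtains p where "z \<in> cyl p" "pfst p = n"
proof -
  obtain c where "\<forall>j. entry c j = (if j < n \<and> j \<in> z then 1 else 0)"
    using code_exists[of "\<lambda>j. if j < n \<and> j \<in> z then 1 else 0"] by (meson leD)
  then show ?thesis by (intro that[of "pair n c"]) (auto simp: cyl_def)
qed

lemma cyl_nonempty: "\<exists>z. z \<in> cyl p"
  by (intro exI[of _ "{i. entry (psnd p) i \<noteq> 0}"]) (simp add: cyl_def)

lemma decidable_extends:
  assumes "computable F" "computable G"
  shows "decidable (\<lambda>z n. extends (F z n) (G z n))"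
proof -
  have "decidable (\<lambda>z u. extends (pfst u) (psnd u))"
    unfolding extends_def iff_conv_conj_imp
    by (intro decidable_all computable_intros computable_entry computable_id)
  then show ?thesis using assms by (rule decidable_app2)
qed

text \<open>Comeagerness within a cylinder, witnessed by countably many dense sets of conditions.\<close>

definition comeager_via :: "(nat \<Rightarrow> nat set) \<Rightarrow> nat \<Rightarrow> (nat set \<Rightarrow> bool) \<Rightarrow> bool" where
  "comeager_via D p \<phi> \<longleftrightarrow> (\<forall>k q. extends q p \<longrightarrow> (\<exists>r. extends r q \<and> r \<in> D k)) \<and>
     (\<forall>z\<in>cyl p. (\<forall>k. \<exists>r\<in>D k. z \<in> cyl r) \<longrightarrow> \<phi> z)"

definition almost :: "nat \<Rightarrow> (nat set \<Rightarrow> bool) \<Rightarrow> bool"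
  where "almost p \<phi> \<longleftrightarrow> (\<exists>D. comeager_via D p \<phi>)"

lemma comeager_viaD:
  assumes "comeager_via D p \<phi>"
  shows "extends q p \<Longrightarrow> \<exists>r. extends r q \<and> r \<in> D k"
    "z \<in> cyl p \<Longrightarrow> (\<And>k. \<exists>r\<in>D k. z \<in> cyl r) \<Longrightarrow> \<phi> z"
  using assms unfolding comeager_via_def by auto

lemma almostI:
  fixes D :: "nat \<Rightarrow> nat set"
  assumes "\<And>k q. extends q p \<Longrightarrow> \<exists>r. extends r q \<and> r \<in> D k"
    "\<And>z. z \<in> cyl p \<Longrightarrow> (\<And>k. \<exists>r\<in>D k. z \<in> cyl r) \<Longrightarrow> \<phi> z"
  shows "almost p \<phi>"
proof -
  have "comeager_via D p \<phi>" unfolding comeager_via_def using assms by auto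
  then show ?thesis unfolding almost_def by blast
qed

lemma almost_always:
  assumes "\<And>z. z \<in> cyl p \<Longrightarrow> \<phi> z"
  shows "almost p \<phi>"
proof (rule almostI[of _ "\<lambda>_. UNIV"])
  show "\<exists>r. extends r q \<and> r \<in> UNIV" for q by (rule exI[of _ q]) simp
qed (rule assms)

lemma almost_mono:
  assumes "almost p \<phi>" "\<And>z. z \<in> cyl p \<Longrightarrow> \<phi> z \<Longrightarrow> \<psi> z"
  shows "almost p \<psi>"
proof -
  obtain D where D: "comeager_via D p \<phi>" using assms(1) unfolding almost_def by blast
  show ?thesis by (rule almostI[of _ D]) (use comeager_viaD[OF D] assms(2) in auto)
qed

lemma almost_extends:
  assumes "almost p \<phi>" "extends q p"
  shows "almost q \<phi>"
proof -
  obtain D where D: "comeager_via D p \<phi>" using assms(1) unfolding almost_def by blast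
  show ?thesis
  proof (rule almostI[of _ D])
    show "\<exists>r. extends r q' \<and> r \<in> D k" if "extends q' q" for q' k
      using comeager_viaD(1)[OF D extends_trans[OF that assms(2)]] .
    show "\<phi> z" if "z \<in> cyl q" "\<And>k. \<exists>r\<in>D k. z \<in> cyl r" for z
      using comeager_viaD(2)[OF D cyl_mono[OF assms(2) that(1)] that(2)] .
  qed
qed

lemma almost_all:
  assumes "\<And>i::nat. almost p (\<phi> i)"
  shows "almost p (\<lambda>z. \<forall>i. \<phi> i z)"
proof -
  obtain D where D: "\<And>i. comeager_via (D i) p (\<phi> i)" using assms unfolding almost_def by metis
  show ?thesis
  proof (rule almostI[of _ "\<lambda>n. D (pfst n) (psnd n)"])
    show "\<exists>r. extends r q \<and> r \<in> D (pfst n) (psnd n)" if "extends q p" for q n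
      using comeager_viaD(1)[OF D that] .
    fix z assume z: "z \<in> cyl p" "\<And>k. \<exists>r\<in>D (pfst k) (psnd k). z \<in> cyl r"
    show "\<forall>i. \<phi> i z"
    proof
      fix i
      have "\<exists>r\<in>D i k. z \<in> cyl r" for k using z(2)[of "pair i k"] by simp
      then show "\<phi> i z" by (rule comeager_viaD(2)[OF D z(1)])
    qed
  qed
qed

lemma almost_conj:
  assumes "almost p \<phi>" "almost p \<psi>"
  shows "almost p (\<lambda>z. \<phi> z \<and> \<psi> z)"
proof -
  have "almost p (\<lambda>z. \<forall>i::nat. (if i = 0 then \<phi> else \<psi>) z)"
    by (rule almost_all) (use assms in auto)
  then show ?thesis by (rule almost_mono) (metis one_neq_zero)
qed

lemma almost_meets:
  assumes "\<And>q. extends q p \<Longrightarrow> \<exists>r. extends r q \<and> r \<in> D"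
  shows "almost p (\<lambda>z. \<exists>r\<in>D. z \<in> cyl r)"
  by (rule almostI[of _ "\<lambda>_. D"], rule assms)

text \<open>A form of the Banach category theorem. There are only countably many conditions
  \<open>r\<close>, so their dense sets can be met simultaneously once they are made dense
  everywhere: the sets belonging to \<open>r\<close> are enlarged by all conditions incompatible
  with \<open>r\<close>.\<close>

lemma almost_glue:
  assumes "\<And>q. extends q p \<Longrightarrow> \<exists>r. extends r q \<and> almost r \<phi>"
  shows "almost p \<phi>"
proof -
  have "\<forall>r. \<exists>D. almost r \<phi> \<longrightarrow> comeager_via D r \<phi>" unfolding almost_def by blast
  then obtain D where D': "\<And>r. almost r \<phi> \<Longrightarrow> comeager_via (D r) r \<phi>" by metis
  have D: "\<exists>t. extends t q \<and> t \<in> D r k" if "almost r \<phi>" "extends q r" for r k q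
    using comeager_viaD(1)[OF D'[OF that(1)] that(2)] .
  have D2: "\<phi> z" if "almost r \<phi>" "z \<in> cyl r" "\<And>k. \<exists>t\<in>D r k. z \<in> cyl t" for r z
    using comeager_viaD(2)[OF D'[OF that(1)] that(2,3)] .
  let ?E = "{r. almost r \<phi>}"
  let ?D = "\<lambda>r k. if almost r \<phi> then {t. cyl t \<inter> cyl r = {}} \<union> D r k else UNIV"
  have "\<exists>t. extends t q \<and> t \<in> ?D r k" if "extends q p" for q r k
  proof (cases "almost r \<phi> \<and> cyl q \<inter> cyl r \<noteq> {}")
    case True
    then obtain z where "z \<in> cyl q" "z \<in> cyl r" by blast
    then obtain u where "extends u q" "extends u r" using common_extension by blast
    then obtain t where "extends t u" "t \<in> D r k" using D True by blast
    then show ?thesis using \<open>extends u q\<close> extends_trans True by auto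
  qed (auto intro: exI[of _ q])
  then have "almost p (\<lambda>z. \<exists>t\<in>?D r k. z \<in> cyl t)" for r k by (intro almost_meets) blast
  then have "almost p (\<lambda>z. \<forall>r k. \<exists>t\<in>?D r k. z \<in> cyl t)" by (intro almost_all)
  moreover have "almost p (\<lambda>z. \<exists>r\<in>?E. z \<in> cyl r)" using assms by (intro almost_meets) auto
  ultimately have "almost p (\<lambda>z. (\<forall>r k. \<exists>t\<in>?D r k. z \<in> cyl t) \<and> (\<exists>r\<in>?E. z \<in> cyl r))"
    by (rule almost_conj)
  then show ?thesis
  proof (rule almost_mono)
    fix z assume z: "(\<forall>r k. \<exists>t\<in>?D r k. z \<in> cyl t) \<and> (\<exists>r\<in>?E. z \<in> cyl r)"
    then obtain r where r: "almost r \<phi>" "z \<in> cyl r" by blast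
    have "\<exists>t\<in>D r k. z \<in> cyl t" for k
    proof -
      obtain t where "t \<in> ?D r k" "z \<in> cyl t" using z by blast
      then show ?thesis using r by auto
    qed
    then show "\<phi> z" using D2 r by blast
  qed
qed

section \<open>Generically decided families\<close>

text \<open>For each \<open>a\<close>, \<open>W\<close> codes an open set of oracles that agrees
  with \<open>\<phi>\<close> up to a meager set, with one comeager set serving all \<open>a\<close>.
  The code itself does not depend on the oracle.\<close>

definition names :: "(nat \<Rightarrow> nat \<Rightarrow> bool) \<Rightarrow> (nat set \<Rightarrow> nat \<Rightarrow> bool) \<Rightarrow> bool" where
  "names W \<phi> \<longleftrightarrow> decidable (\<lambda>z u. W (pfst u) (psnd u)) \<and> (\<forall>p q a. W p a \<longrightarrow> extends q p \<longrightarrow> W q a) \<and>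
     almost 0 (\<lambda>z. \<forall>a. \<phi> z a \<longleftrightarrow> (\<exists>p. z \<in> cyl p \<and> W p a))"

definition good :: "(nat set \<Rightarrow> nat \<Rightarrow> bool) \<Rightarrow> bool"
  where "good \<phi> \<longleftrightarrow> decidable \<phi> \<and> (\<exists>W. names W \<phi>)"

lemma namesD:
  assumes "names W \<phi>"
  shows "decidable (\<lambda>z u. W (pfst u) (psnd u))" "W p a \<Longrightarrow> extends q p \<Longrightarrow> W q a"
    "almost 0 (\<lambda>z. \<forall>a. \<phi> z a \<longleftrightarrow> (\<exists>p. z \<in> cyl p \<and> W p a))"
  using assms unfolding names_def by blast+

lemma good_decidable: "good \<phi> \<Longrightarrow> decidable \<phi>"
  by (simp add: good_def)

lemma good_mem: "good (\<lambda>z a. a \<in> z)"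
proof -
  let ?W = "\<lambda>p a. a < pfst p \<and> entry (psnd p) a \<noteq> 0"
  have "names ?W (\<lambda>z a. a \<in> z)"
    unfolding names_def
  proof (intro conjI allI impI)
    show "decidable (\<lambda>z u. ?W (pfst u) (psnd u))"
      by (intro computable_intros computable_entry computable_id)
    have *: "a \<in> z \<longleftrightarrow> (\<exists>p. z \<in> cyl p \<and> ?W p a)" for a z
    proof
      obtain p where "z \<in> cyl p" "pfst p = Suc a" using cyl_prefix .
      then show "a \<in> z \<Longrightarrow> \<exists>p. z \<in> cyl p \<and> ?W p a" by (intro exI[of _ p]) (auto simp: cyl_def)
    qed (auto simp: cyl_def)
    show "almost 0 (\<lambda>z. \<forall>a. a \<in> z \<longleftrightarrow> (\<exists>p. z \<in> cyl p \<and> ?W p a))"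
      by (rule almost_always) (use * in blast)
  qed (auto simp: extends_def)
  then show ?thesis unfolding good_def using decidable_mem[OF computable_id] by blast
qed

lemma good_abs:
  assumes "decidable (\<lambda>z. \<psi>)"
  shows "good (\<lambda>z. \<psi>)"
proof -
  have "names (\<lambda>p. \<psi>) (\<lambda>z. \<psi>)"
    unfolding names_def
  proof (intro conjI allI impI)
    show "decidable (\<lambda>z u. \<psi> (psnd u))" by (intro decidable_sub[OF assms] computable_psnd computable_id)
    have "\<exists>p. z \<in> cyl p" for z by (intro exI[of _ 0]) simp
    then show "almost 0 (\<lambda>z. \<forall>a. \<psi> a \<longleftrightarrow> (\<exists>p. z \<in> cyl p \<and> \<psi> a))"
      by (intro almost_always) blast
  qed auto
  then show ?thesis unfolding good_def using assms by blast
qed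

text \<open>Cohen forcing of a negation. The conditions deciding \<open>a\<close> one way or the
  other are dense, so almost every oracle meets one for each \<open>a\<close>; by compatibility it
  cannot meet both kinds.\<close>

lemma good_not:
  assumes "good \<phi>"
  shows "good (\<lambda>z a. \<not> \<phi> z a)"
proof -
  obtain W where W: "names W \<phi>" using assms unfolding good_def by blast
  let ?N = "\<lambda>p a. \<forall>q. extends q p \<longrightarrow> \<not> W q a"
  have "names ?N (\<lambda>z a. \<not> \<phi> z a)"
    unfolding names_def
  proof (intro conjI allI impI)
    have w: "decidable (\<lambda>z u. W (psnd u) (psnd (pfst u)))"
      by (intro decidable_app2[OF namesD(1)[OF W]] computable_intros computable_id)
    show "decidable (\<lambda>z u. \<forall>q. extends q (pfst u) \<longrightarrow> \<not> W q (psnd u))"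
      by (intro decidable_all decidable_imp decidable_extends w computable_intros computable_id)
    have "almost 0 (\<lambda>z. \<forall>a. \<exists>p\<in>{p. W p a \<or> ?N p a}. z \<in> cyl p)"
      by (intro almost_all almost_meets) (use extends_refl in blast)
    with namesD(3)[OF W] have "almost 0 (\<lambda>z. (\<forall>a. \<phi> z a \<longleftrightarrow> (\<exists>p. z \<in> cyl p \<and> W p a)) \<and>
        (\<forall>a. \<exists>p\<in>{p. W p a \<or> ?N p a}. z \<in> cyl p))" by (rule almost_conj)
    then show "almost 0 (\<lambda>z. \<forall>a. (\<not> \<phi> z a) \<longleftrightarrow> (\<exists>p. z \<in> cyl p \<and> ?N p a))"
    proof (rule almost_mono, intro allI)
      fix z a assume z: "(\<forall>a. \<phi> z a \<longleftrightarrow> (\<exists>p. z \<in> cyl p \<and> W p a)) \<and> (\<forall>a. \<exists>p\<in>{p. W p a \<or> ?N p a}. z \<in> cyl p)"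
      have False if "z \<in> cyl p" "?N p a" "z \<in> cyl q" "W q a" for p q
        using common_extension[OF that(1,3)] that namesD(2)[OF W] by metis
      then show "(\<not> \<phi> z a) \<longleftrightarrow> (\<exists>p. z \<in> cyl p \<and> ?N p a)" using z by blast
    qed
  qed (use extends_trans in blast)
  then show ?thesis using assms decidable_not unfolding good_def by blast
qed

lemma good_conj:
  assumes "good \<phi>" "good \<psi>"
  shows "good (\<lambda>z a. \<phi> z a \<and> \<psi> z a)"
proof -
  obtain V W where V: "names V \<phi>" and W: "names W \<psi>" using assms unfolding good_def by blast
  have "names (\<lambda>p a. V p a \<and> W p a) (\<lambda>z a. \<phi> z a \<and> \<psi> z a)"
    unfolding names_def
  proof (intro conjI allI impI)
    show "decidable (\<lambda>z u. V (pfst u) (psnd u) \<and> W (pfst u) (psnd u))"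
      by (intro decidable_conj namesD(1)[OF V] namesD(1)[OF W])
    show "almost 0 (\<lambda>z. \<forall>a. (\<phi> z a \<and> \<psi> z a) \<longleftrightarrow> (\<exists>p. z \<in> cyl p \<and> V p a \<and> W p a))"
    proof (rule almost_mono[OF almost_conj[OF namesD(3)[OF V] namesD(3)[OF W]]], intro allI)
      fix z a
      assume z: "(\<forall>a. \<phi> z a \<longleftrightarrow> (\<exists>p. z \<in> cyl p \<and> V p a)) \<and> (\<forall>a. \<psi> z a \<longleftrightarrow> (\<exists>p. z \<in> cyl p \<and> W p a))"
      have "\<exists>r. z \<in> cyl r \<and> V r a \<and> W r a" if "z \<in> cyl p" "V p a" "z \<in> cyl q" "W q a" for p q
        using common_extension[OF that(1,3)] that namesD(2)[OF W] namesD(2)[OF V] by metis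
      then show "(\<phi> z a \<and> \<psi> z a) \<longleftrightarrow> (\<exists>p. z \<in> cyl p \<and> V p a \<and> W p a)" using z by blast
    qed
  qed (use namesD(2)[OF W] namesD(2)[OF V] in blast)+
  then show ?thesis using assms decidable_conj unfolding good_def by blast
qed

lemma good_ex:
  assumes "good (\<lambda>z u. \<phi> z (pfst u) (psnd u))"
  shows "good (\<lambda>z a. \<exists>k. \<phi> z a k)"
proof -
  obtain W where W: "names W (\<lambda>z u. \<phi> z (pfst u) (psnd u))" using assms unfolding good_def by blast
  have "names (\<lambda>p a. \<exists>k. W p (pair a k)) (\<lambda>z a. \<exists>k. \<phi> z a k)"
    unfolding names_def
  proof (intro conjI allI impI)
    show "decidable (\<lambda>z u. \<exists>k. W (pfst u) (pair (psnd u) k))"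
      by (intro decidable_ex decidable_app2[OF namesD(1)[OF W]] computable_intros computable_id)
    show "almost 0 (\<lambda>z. \<forall>a. (\<exists>k. \<phi> z a k) \<longleftrightarrow> (\<exists>p. z \<in> cyl p \<and> (\<exists>k. W p (pair a k))))"
    proof (rule almost_mono[OF namesD(3)[OF W]], intro allI)
      fix z a assume "\<forall>u. \<phi> z (pfst u) (psnd u) \<longleftrightarrow> (\<exists>p. z \<in> cyl p \<and> W p u)"
      then have "\<phi> z a k \<longleftrightarrow> (\<exists>p. z \<in> cyl p \<and> W p (pair a k))" for k by (metis pair_simps(1,2))
      then show "(\<exists>k. \<phi> z a k) \<longleftrightarrow> (\<exists>p. z \<in> cyl p \<and> (\<exists>k. W p (pair a k)))" by blast
    qed
  qed (use namesD(2)[OF W] in blast)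
  then show ?thesis using assms decidable_ex unfolding good_def by blast
qed

lemma good_sub:
  assumes "good \<phi>" "computable (\<lambda>z. g)"
  shows "good (\<lambda>z a. \<phi> z (g a))"
proof -
  obtain W where W: "names W \<phi>" using assms unfolding good_def by blast
  have "names (\<lambda>p a. W p (g a)) (\<lambda>z a. \<phi> z (g a))"
    unfolding names_def
  proof (intro conjI allI impI)
    show "decidable (\<lambda>z u. W (pfst u) (g (psnd u)))"
      by (intro decidable_app2[OF namesD(1)[OF W]] computable_comp[OF _ assms(2)] computable_intros computable_id)
    show "almost 0 (\<lambda>z. \<forall>a. \<phi> z (g a) \<longleftrightarrow> (\<exists>p. z \<in> cyl p \<and> W p (g a)))"
      by (rule almost_mono[OF namesD(3)[OF W]]) blast
  qed (use namesD(2)[OF W] in blast)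
  then show ?thesis using assms decidable_sub[OF good_decidable[OF assms(1)] assms(2)] unfolding good_def by blast
qed

text \<open>The forcing relation of an inductively defined set is itself inductively defined.\<close>

inductive forced :: "(nat \<Rightarrow> nat \<Rightarrow> bool) \<Rightarrow> (nat \<Rightarrow> nat \<Rightarrow> nat \<Rightarrow> nat) \<Rightarrow> nat \<Rightarrow> nat \<Rightarrow> bool" for W h where
  Axiom: "W p a \<Longrightarrow> forced W h p a"
| Rule: "(\<And>i q. extends q p \<Longrightarrow> \<exists>r. extends r q \<and> forced W h r (h a e i)) \<Longrightarrow> forced W h p a"

text \<open>
  A statement of kind 0 says that a condition forces \<open>a\<close>, one of kind 1 that some extension
  of it does, and the statement of kind 2 is trivially true.
\<close>

definition forced_axiom :: "(nat \<Rightarrow> nat \<Rightarrow> bool) \<Rightarrow> nat \<Rightarrow> bool" where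
  "forced_axiom W v \<longleftrightarrow> pfst v = 2 \<or> pfst v = 0 \<and> W (pfst (psnd v)) (psnd (psnd v))"

text \<open>The quantifiers over conditions in \<open>forced\<close> are distributed over two rules.
  For kind 0 the universal choice of an extension is part of the premise index, together with a
  premise \<open>pfst i\<close> of the original rule; for kind 1 the existential choice is the rule
  \<open>e\<close>. A wrong extension gives a trivial premise in the first case and the useless
  premise \<open>v\<close> itself in the second.\<close>

definition forced_rule :: "(nat \<Rightarrow> nat \<Rightarrow> nat \<Rightarrow> nat) \<Rightarrow> nat \<Rightarrow> nat \<Rightarrow> nat \<Rightarrow> nat" where
  "forced_rule h v e i =
     (if pfst v = 0 then
        if extends (psnd i) (pfst (psnd v)) then pair 1 (pair (psnd i) (h (psnd (psnd v)) e (pfst i)))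
        else pair 2 0
      else if extends e (pfst (psnd v)) then pair 0 (pair e (psnd (psnd v))) else v)"

lemma forced_iff_derivable:
  "forced W h p a \<longleftrightarrow> derivable (forced_axiom W) (forced_rule h) (pair 0 (pair p a))"
proof
  assume "forced W h p a"
  then show "derivable (forced_axiom W) (forced_rule h) (pair 0 (pair p a))"
  proof (induction)
    case (Axiom p a)
    then show ?case by (intro derivable.Axiom) (simp add: forced_axiom_def)
  next
    case (Rule p a e)
    show ?case
    proof (rule derivable.Rule[of _ _ _ e])
      fix i
      show "derivable (forced_axiom W) (forced_rule h) (forced_rule h (pair 0 (pair p a)) e i)"
      proof (cases "extends (psnd i) p")
        case True
        then obtain r where r: "extends r (psnd i)"
            "derivable (forced_axiom W) (forced_rule h) (pair 0 (pair r (h a e (pfst i))))"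
          using Rule by blast
        have "derivable (forced_axiom W) (forced_rule h) (pair 1 (pair (psnd i) (h a e (pfst i))))"
          by (rule derivable.Rule[of _ _ _ r]) (use r in \<open>simp add: forced_rule_def\<close>)
        then show ?thesis using True by (simp add: forced_rule_def)
      next
        case False
        then show ?thesis by (auto simp: forced_rule_def forced_axiom_def intro!: derivable.Axiom)
      qed
    qed
  qed
next
  have "derivable (forced_axiom W) (forced_rule h) v \<Longrightarrow>
      (pfst v = 0 \<longrightarrow> forced W h (pfst (psnd v)) (psnd (psnd v))) \<and>
      (pfst v = 1 \<longrightarrow> (\<exists>r. extends r (pfst (psnd v)) \<and> forced W h r (psnd (psnd v))))" for v
  proof (induction rule: derivable.induct)
    case (Axiom v)
    then show ?case by (auto simp: forced_axiom_def intro: forced.Axiom)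
  next
    case (Rule v e)
    have "forced W h (pfst (psnd v)) (psnd (psnd v))" if v: "pfst v = 0"
    proof (rule forced.Rule[where e = e])
      fix i q assume "extends q (pfst (psnd v))"
      then have "forced_rule h v e (pair i q) = pair 1 (pair q (h (psnd (psnd v)) e i))"
        using v by (simp add: forced_rule_def)
      then show "\<exists>r. extends r q \<and> forced W h r (h (psnd (psnd v)) e i)"
        using Rule.IH[of "pair i q"] by simp
    qed
    moreover have "\<exists>r. extends r (pfst (psnd v)) \<and> forced W h r (psnd (psnd v))" if v: "pfst v = 1"
    proof (cases "extends e (pfst (psnd v))")
      case True
      then have "forced_rule h v e 0 = pair 0 (pair e (psnd (psnd v)))" using v by (simp add: forced_rule_def)
      then show ?thesis using Rule.IH[of 0] True by auto
    next
      case False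
      then have "forced_rule h v e 0 = v" using v by (simp add: forced_rule_def)
      then show ?thesis using Rule.IH[of 0] v by simp
    qed
    ultimately show ?case by blast
  qed
  then show "derivable (forced_axiom W) (forced_rule h) (pair 0 (pair p a)) \<Longrightarrow> forced W h p a"
    by fastforce
qed

text \<open>Soundness is by induction on \<open>forced\<close>, with \<open>almost_glue\<close> for
  premises that are forced only densely. For the converse, almost every \<open>z\<close> meets all
  the dense sets \<open>?D a e\<close> of conditions that either force all premises densely or
  exclude one of them for good. Induction on a derivation relative to \<open>z\<close> rules out the
  second alternative.\<close>

lemma good_derivable:
  assumes B: "good B" and h: "computable (\<lambda>z u. h (pfst u) (pfst (psnd u)) (psnd (psnd u)))"
  shows "good (\<lambda>z a. derivable (B z) h a)"
proof -
  obtain W where W: "names W B" using B unfolding good_def by blast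
  let ?F = "forced W h"
  have mono: "?F q a" if "?F p a" "extends q p" for p q a
    using that
  proof (induction arbitrary: q)
    case (Axiom p a)
    then show ?case using namesD(2)[OF W] forced.Axiom by blast
  next
    case (Rule p a e)
    show ?case
    proof (rule forced.Rule[where e = e])
      fix i q' assume "extends q' q"
      then have "extends q' p" using extends_trans Rule.prems by blast
      from Rule.IH[OF this, of i] show "\<exists>r. extends r q' \<and> ?F r (h a e i)" by blast
    qed
  qed
  have sound: "almost p (\<lambda>z. derivable (B z) h a)" if "?F p a" for p a
    using that
  proof (induction)
    case (Axiom p a)
    have "almost p (\<lambda>z. \<forall>a. B z a \<longleftrightarrow> (\<exists>p. z \<in> cyl p \<and> W p a))"
      using namesD(3)[OF W] by (rule almost_extends) simp
    then show ?case by (rule almost_mono) (use Axiom derivable.Axiom in blast)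
  next
    case (Rule p a e)
    have "almost p (\<lambda>z. derivable (B z) h (h a e i))" for i
    proof (rule almost_glue)
      fix q assume "extends q p"
      from Rule.IH[OF this, of i] show "\<exists>r. extends r q \<and> almost r (\<lambda>z. derivable (B z) h (h a e i))" by blast
    qed
    then have "almost p (\<lambda>z. \<forall>i. derivable (B z) h (h a e i))" by (rule almost_all)
    then show ?case by (rule almost_mono) (use derivable.Rule in blast)
  qed
  have "almost 0 (\<lambda>z. \<forall>a. derivable (B z) h a \<longleftrightarrow> (\<exists>p. z \<in> cyl p \<and> ?F p a))"
  proof -
    let ?D = "\<lambda>a e. {p. (\<forall>i q. extends q p \<longrightarrow> (\<exists>r. extends r q \<and> ?F r (h a e i))) \<or>
        (\<exists>i. \<forall>q. extends q p \<longrightarrow> \<not> ?F q (h a e i))}"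
    have 1: "almost 0 (\<lambda>z. \<forall>a e. \<exists>p\<in>?D a e. z \<in> cyl p)"
    proof (intro almost_all almost_meets)
      fix a e q
      show "\<exists>r. extends r q \<and> r \<in> ?D a e"
      proof (cases "q \<in> ?D a e")
        case False
        then obtain i r where "extends r q" "\<forall>t. extends t r \<longrightarrow> \<not> ?F t (h a e i)" by blast
        then show ?thesis by blast
      qed (use extends_refl in blast)
    qed
    \<comment> \<open>\<open>sound\<close> speaks about the cylinder of \<open>p\<close> only.
      Elsewhere the implication is vacuous, so the two kinds of conditions can be glued; countably
      many pairs of \<open>p\<close> and \<open>a\<close> are then combined.\<close>
    have 2: "almost 0 (\<lambda>z. \<forall>p a. ?F p a \<longrightarrow> z \<in> cyl p \<longrightarrow> derivable (B z) h a)"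
    proof (intro almost_all)
      fix p a
      show "almost 0 (\<lambda>z. ?F p a \<longrightarrow> z \<in> cyl p \<longrightarrow> derivable (B z) h a)"
      proof (cases "?F p a")
        case True
        show ?thesis
        proof (rule almost_glue)
          fix q :: nat
          show "\<exists>r. extends r q \<and> almost r (\<lambda>z. ?F p a \<longrightarrow> z \<in> cyl p \<longrightarrow> derivable (B z) h a)"
          proof (cases "cyl p \<inter> cyl q = {}")
            case True
            have "almost q (\<lambda>z. ?F p a \<longrightarrow> z \<in> cyl p \<longrightarrow> derivable (B z) h a)"
              by (rule almost_always) (use True in blast)
            then show ?thesis using extends_refl by blast
          next
            case False
            then obtain r where "extends r p" "extends r q" using common_extension by blast
            then have "almost r (\<lambda>z. derivable (B z) h a)"
              using almost_extends[OF sound[OF \<open>?F p a\<close>]] by blast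
            then have "almost r (\<lambda>z. ?F p a \<longrightarrow> z \<in> cyl p \<longrightarrow> derivable (B z) h a)"
              by (rule almost_mono) blast
            then show ?thesis using \<open>extends r q\<close> by blast
          qed
        qed
      next
        case False
        then show ?thesis by (intro almost_always) blast
      qed
    qed
    show ?thesis
    proof (rule almost_mono[OF almost_conj[OF almost_conj[OF 1 2] namesD(3)[OF W]]], intro allI iffI)
      fix z a
      assume z: "((\<forall>a e. \<exists>p\<in>?D a e. z \<in> cyl p) \<and> (\<forall>p a. ?F p a \<longrightarrow> z \<in> cyl p \<longrightarrow> derivable (B z) h a)) \<and>
          (\<forall>a. B z a \<longleftrightarrow> (\<exists>p. z \<in> cyl p \<and> W p a))"
      show "\<exists>p. z \<in> cyl p \<and> ?F p a \<Longrightarrow> derivable (B z) h a" using z by blast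
      assume "derivable (B z) h a"
      then show "\<exists>p. z \<in> cyl p \<and> ?F p a"
      proof (induction)
        case (Axiom a)
        then show ?case using z forced.Axiom by blast
      next
        case (Rule a e)
        obtain p where p: "p \<in> ?D a e" "z \<in> cyl p" using z by blast
        have "\<exists>q. extends q p \<and> ?F q (h a e i)" for i
        proof -
          obtain q where "z \<in> cyl q" "?F q (h a e i)" using Rule.IH by blast
          then show ?thesis using common_extension[OF p(2)] mono by metis
        qed
        then have "\<forall>i q. extends q p \<longrightarrow> (\<exists>r. extends r q \<and> ?F r (h a e i))" using p(1) by blast
        then show ?case using p(2) forced.Rule by blast
      qed
    qed
  qed
  moreover have "decidable (\<lambda>z u. ?F (pfst u) (psnd u))"
  proof -
    have "decidable (\<lambda>z v. forced_axiom W v)"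
      unfolding forced_axiom_def
      by (intro computable_intros decidable_app2[OF namesD(1)[OF W]] computable_id)
    moreover have "computable (\<lambda>z u. forced_rule h (pfst u) (pfst (psnd u)) (psnd (psnd u)))"
      unfolding forced_rule_def
      by (intro computable_intros computable_app3[OF h] decidable_extends computable_id)
    ultimately have "decidable (\<lambda>z v. derivable (forced_axiom W) (forced_rule h) v)"
      by (rule decidable_derivable)
    then show ?thesis unfolding forced_iff_derivable
      by (rule decidable_sub) (intro computable_intros computable_id)
  qed
  ultimately have "names ?F (\<lambda>z a. derivable (B z) h a)" unfolding names_def using mono by blast
  moreover have "decidable (\<lambda>z a. derivable (B z) h a)"
    by (rule decidable_derivable[OF good_decidable[OF B] h])
  ultimately show ?thesis unfolding good_def by blast
qed

lemma good_disj: "good \<phi> \<Longrightarrow> good \<psi> \<Longrightarrow> good (\<lambda>z a. \<phi> z a \<or> \<psi> z a)"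
  using good_not[OF good_conj[OF good_not good_not]] by simp

lemma good_imp: "good \<phi> \<Longrightarrow> good \<psi> \<Longrightarrow> good (\<lambda>z a. \<phi> z a \<longrightarrow> \<psi> z a)"
  unfolding imp_conv_disj by (intro good_disj good_not)

lemma good_all: "good (\<lambda>z u. \<phi> z (pfst u) (psnd u)) \<Longrightarrow> good (\<lambda>z a. \<forall>k. \<phi> z a k)"
  using good_not[OF good_ex[OF good_not]] by simp

lemma good_app2:
  assumes "good (\<lambda>z u. \<phi> z (pfst u) (psnd u))" "computable (\<lambda>z. f)" "computable (\<lambda>z. g)"
  shows "good (\<lambda>z n. \<phi> z (f n) (g n))"
  using good_sub[OF assms(1) computable_pair[OF assms(2,3)]] by simp

lemma good_app3:
  assumes "good (\<lambda>z u. \<phi> z (pfst u) (pfst (psnd u)) (psnd (psnd u)))"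
    "computable (\<lambda>z. f)" "computable (\<lambda>z. g)" "computable (\<lambda>z. h)"
  shows "good (\<lambda>z n. \<phi> z (f n) (g n) (h n))"
  using good_sub[OF assms(1) computable_pair[OF assms(2) computable_pair[OF assms(3,4)]]] by simp

section \<open>Reachability by levels\<close>

text \<open>
  States are coded sequences whose entry 0 is the program line. The last argument of \<open>reach\<close> is
  the componentwise minimum over the computation, with the end point excluded. If there are
  arbitrarily long chains of computations with minimum \<open>d\<close>, then by determinism the least time
  with arbitrarily long chains below it is a limit time with state \<open>d\<close>. This makes
  the limit rule arithmetical and positive, at the price of missing the limits at which some
  register overflows.
\<close>

inductive reach :: "(nat \<Rightarrow> nat \<Rightarrow> nat \<Rightarrow> bool) \<Rightarrow> nat \<Rightarrow> nat \<Rightarrow> nat \<Rightarrow> bool"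
  and path :: "(nat \<Rightarrow> nat \<Rightarrow> nat \<Rightarrow> bool) \<Rightarrow> nat \<Rightarrow> nat \<Rightarrow> nat \<Rightarrow> bool" for T where
  Base: "T c d m \<Longrightarrow> reach T c d m"
| Trans: "reach T c c' m1 \<Longrightarrow> reach T c' d m2 \<Longrightarrow> (\<And>j. entry m j = min (entry m1 j) (entry m2 j))
    \<Longrightarrow> reach T c d m"
| Limit: "reach T c c' m1 \<Longrightarrow> (\<And>n. path T n c' d) \<Longrightarrow> (\<And>j. entry m j = min (entry m1 j) (entry d j))
    \<Longrightarrow> reach T c d m"
| Path_0: "path T 0 c d"
| Path_Suc: "reach T c c' m \<Longrightarrow> (\<And>j. entry m j = entry d j) \<Longrightarrow> path T n c' d \<Longrightarrow> path T (Suc n) c d"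

text \<open>
  The jump of a reachability relation passes to the first time it misses, where some component
  diverges.
\<close>

definition diverges :: "(nat \<Rightarrow> nat \<Rightarrow> nat \<Rightarrow> bool) \<Rightarrow> nat \<Rightarrow> nat \<Rightarrow> bool" where
  "diverges R c j \<longleftrightarrow> (\<forall>v. \<exists>x m. R c x m \<and> (\<forall>y m'. R x y m' \<longrightarrow> v \<le> entry y j))"

definition settles :: "(nat \<Rightarrow> nat \<Rightarrow> nat \<Rightarrow> bool) \<Rightarrow> nat \<Rightarrow> nat \<Rightarrow> nat \<Rightarrow> bool" where
  "settles R c j v \<longleftrightarrow> (\<exists>x m. R c x m \<and> (\<forall>y m'. R x y m' \<longrightarrow> v \<le> entry y j) \<and>
     (\<forall>y m'. R x y m' \<longrightarrow> (\<exists>y' m''. R y y' m'' \<and> entry y' j = v)))"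

definition minimum :: "(nat \<Rightarrow> nat \<Rightarrow> nat \<Rightarrow> bool) \<Rightarrow> nat \<Rightarrow> nat \<Rightarrow> nat \<Rightarrow> bool" where
  "minimum R c j v \<longleftrightarrow> v \<le> entry c j \<and> (\<forall>y m'. R c y m' \<longrightarrow> v \<le> entry y j) \<and>
     (entry c j = v \<or> (\<exists>y m'. R c y m' \<and> entry y j = v))"

definition jump :: "(nat \<Rightarrow> nat \<Rightarrow> nat \<Rightarrow> bool) \<Rightarrow> nat \<Rightarrow> nat \<Rightarrow> nat \<Rightarrow> bool" where
  "jump R c d m \<longleftrightarrow> (\<exists>j. diverges R c j) \<and>
     (\<forall>j. (diverges R c j \<and> entry d j = 0) \<or> settles R c j (entry d j)) \<and>
     (\<forall>j. minimum R c j (entry m j))"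

primrec level :: "(nat \<Rightarrow> nat \<Rightarrow> nat \<Rightarrow> bool) \<Rightarrow> nat \<Rightarrow> nat \<Rightarrow> nat \<Rightarrow> nat \<Rightarrow> bool" where
  "level T 0 = T"
| "level T (Suc k) = (\<lambda>c d m. level T k c d m \<or> jump (reach (level T k)) c d m)"

lemma level_mono:
  assumes "level T k c d m" "k \<le> k'"
  shows "level T k' c d m"
  using assms(2,1) by (induction rule: dec_induct) auto

definition overflows :: "(time \<Rightarrow> nat) \<Rightarrow> time \<Rightarrow> bool"
  where "overflows g t \<longleftrightarrow> (\<forall>v. \<exists>u<t. \<forall>u'. u \<le> u' \<and> u' < t \<longrightarrow> v \<le> g u')"

lemma limit_above:
  assumes "is_limit t" "u < t"
  obtains u' where "u < u'" "u' < t"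
  using assms unfolding is_limit_def is_succ_def by blast

lemma limit_attained:
  fixes t :: time
  assumes t: "is_limit t" and n: "\<not> overflows g t"
  shows "\<exists>s<t. \<forall>u. s \<le> u \<and> u < t \<longrightarrow> limit_value g t \<le> g u"
    and "\<forall>s<t. \<exists>u. s \<le> u \<and> u < t \<and> g u = limit_value g t"
proof -
  obtain v0 where v0: "\<And>u. u < t \<Longrightarrow> \<exists>u'. u \<le> u' \<and> u' < t \<and> g u' < v0"
    using n unfolding overflows_def by (auto simp: not_le)
  have low: "\<exists>s<t. \<forall>u. s \<le> u \<and> u < t \<longrightarrow> v \<le> g u"
    if "\<And>w. w < v \<Longrightarrow> \<not> (\<forall>s<t. \<exists>u. s \<le> u \<and> u < t \<and> g u = w)" for v
    using that
  proof (induction v)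
    case 0
    then show ?case using t unfolding is_limit_def by auto
  next
    case (Suc v)
    obtain s1 where s1: "s1 < t" "\<forall>u. s1 \<le> u \<and> u < t \<longrightarrow> v \<le> g u" using Suc.IH Suc.prems less_SucI by blast
    obtain s2 where s2: "s2 < t" "\<forall>u. s2 \<le> u \<and> u < t \<longrightarrow> g u \<noteq> v" using Suc.prems[of v] by blast
    have "Suc v \<le> g u" if "max s1 s2 \<le> u" "u < t" for u
    proof -
      have "v \<le> g u" "g u \<noteq> v" using s1(2) s2(2) that by auto
      then show ?thesis by simp
    qed
    then show ?case using s1(1) s2(1) by (intro exI[of _ "max s1 s2"]) auto
  qed
  let ?P = "\<lambda>v. \<forall>s<t. \<exists>u. s \<le> u \<and> u < t \<and> g u = v"
  have ex: "\<exists>v. ?P v"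
  proof (rule ccontr)
    assume "\<not> ?thesis"
    then obtain s where s: "s < t" "\<forall>u. s \<le> u \<and> u < t \<longrightarrow> v0 \<le> g u" using low by blast
    then show False using v0 by (meson not_le)
  qed
  define v where "v = (LEAST v. ?P v)"
  have v: "?P v" unfolding v_def using ex by (rule LeastI_ex)
  obtain s where s: "s < t" "\<forall>u. s \<le> u \<and> u < t \<longrightarrow> v \<le> g u"
    using low[of v] not_less_Least[of _ ?P] unfolding v_def by blast
  have "limit_value g t = v"
    by (rule limit_value_eqI[OF s(1)]) (use s v in auto)
  then show "\<exists>s<t. \<forall>u. s \<le> u \<and> u < t \<longrightarrow> limit_value g t \<le> g u"
    and "\<forall>s<t. \<exists>u. s \<le> u \<and> u < t \<and> g u = limit_value g t" using s v by auto
qed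

text \<open>\<open>V t\<close> is the configuration at time \<open>t\<close> as one sequence,
  program line first; \<open>T\<close> is a single step on codes. The minimum of a step is its
  starting state because end points are excluded.\<close>

locale itrm_run =
  fixes V :: "time \<Rightarrow> nat \<Rightarrow> nat" and T :: "nat \<Rightarrow> nat \<Rightarrow> nat \<Rightarrow> bool" and N :: nat
  assumes succ: "\<And>s t c d m. is_succ s t \<Longrightarrow> entry c = V s \<Longrightarrow> T c d m \<longleftrightarrow> entry d = V t \<and> entry m = V s"
    and limit: "\<And>t j. is_limit t \<Longrightarrow> V t j = limit_value (\<lambda>s. V s j) t"
    and support: "\<And>t j. N \<le> j \<Longrightarrow> V t j = 0"
begin

text \<open>
  A critical time of rank \<open>k + 1\<close> is an overflow time that is a limit of critical times of rank
  \<open>k\<close>. A register that overflows at such a time is eventually positive before it, hence differs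
  from all registers that overflow at the critical times shortly before. This bounds the rank by
  the number of registers.
\<close>

primrec crit :: "nat \<Rightarrow> time \<Rightarrow> bool" where
  "crit 0 t \<longleftrightarrow> True"
| "crit (Suc k) t \<longleftrightarrow> is_limit t \<and> (\<exists>j. overflows (\<lambda>s. V s j) t) \<and> (\<forall>u<t. \<exists>u'. u < u' \<and> u' < t \<and> crit k u')"

lemma crit_Suc_imp: "crit (Suc k) t \<Longrightarrow> crit k t"
proof (induction k arbitrary: t)
  case (Suc k)
  then show ?case by (metis crit.simps(2))
qed simp

lemma overflow_support: "overflows (\<lambda>s. V s j) t \<Longrightarrow> is_limit t \<Longrightarrow> j < N"
proof (rule ccontr)
  assume "overflows (\<lambda>s. V s j) t" "is_limit t" "\<not> j < N"
  then obtain u where "u < t" "1 \<le> V u j" unfolding overflows_def by (meson order_refl)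
  then show False using support \<open>\<not> j < N\<close> by simp
qed

lemma overflow_value: "overflows (\<lambda>s. V s j) t \<Longrightarrow> is_limit t \<Longrightarrow> V t j = 0"
  using limit[of t j] limit_value_overflow[of t "\<lambda>s. V s j"] unfolding overflows_def by metis

lemma crit_zeros:
  assumes "crit k t" "t0 < t"
  shows "\<exists>J\<subseteq>{..<N}. k \<le> card J \<and> (\<forall>j\<in>J. \<exists>u. t0 < u \<and> u \<le> t \<and> V u j = 0)"
  using assms
proof (induction k arbitrary: t t0)
  case 0
  then show ?case by auto
next
  case (Suc k)
  then obtain j where lim: "is_limit t" and j: "overflows (\<lambda>s. V s j) t" by auto
  then obtain u where u: "u < t" "\<forall>u'. u \<le> u' \<and> u' < t \<longrightarrow> 1 \<le> V u' j" unfolding overflows_def by blast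
  define t1 where "t1 = max u t0"
  have "t1 < t" using u Suc by (simp add: t1_def)
  then obtain t2 where t2: "t1 < t2" "t2 < t" "crit k t2" using Suc.prems by auto
  obtain J where J: "J \<subseteq> {..<N}" "k \<le> card J" "\<forall>j\<in>J. \<exists>u. t1 < u \<and> u \<le> t2 \<and> V u j = 0"
    using Suc.IH[OF t2(3,1)] by blast
  have "j \<notin> J"
  proof
    assume "j \<in> J"
    then obtain u' where "t1 < u'" "u' \<le> t2" "V u' j = 0" using J by blast
    moreover from this have "u \<le> u'" "u' < t" using t2 by (auto simp: t1_def)
    ultimately show False using u(2) by force
  qed
  moreover have "finite J" using J(1) finite_subset by blast
  ultimately have "Suc k \<le> card (insert j J)" using J(2) by simp
  moreover have "insert j J \<subseteq> {..<N}" using J(1) overflow_support[OF j lim] by simp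
  moreover have "\<exists>u. t0 < u \<and> u \<le> t \<and> V u i = 0" if i: "i \<in> insert j J" for i
  proof (cases "i = j")
    case True
    then show ?thesis using overflow_value[OF j lim] Suc.prems by blast
  next
    case False
    then obtain u' where "t1 < u'" "u' \<le> t2" "V u' i = 0" using J i by blast
    then show ?thesis using t2 by (intro exI[of _ u']) (auto simp: t1_def)
  qed
  ultimately show ?case by blast
qed

lemma not_crit: "\<not> crit (Suc N) t"
proof
  assume *: "crit (Suc N) t"
  then obtain t0 where "t0 < t" by (auto simp: is_limit_def)
  then obtain J where "J \<subseteq> {..<N}" "Suc N \<le> card J" using crit_zeros[OF *] by blast
  then show False using card_mono[of "{..<N}" J] by simp
qed

section \<open>Minima over half-open intervals and the meaning of the levels\<close>

definition is_min :: "time \<Rightarrow> time \<Rightarrow> (nat \<Rightarrow> nat) \<Rightarrow> bool" where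
  "is_min s t f \<longleftrightarrow> (\<forall>u j. s \<le> u \<and> u < t \<longrightarrow> f j \<le> V u j) \<and> (\<forall>j. \<exists>u. s \<le> u \<and> u < t \<and> V u j = f j)"

lemma is_min_unique: "is_min s t f \<Longrightarrow> is_min s t g \<Longrightarrow> f = g"
  unfolding is_min_def by (metis le_antisym ext)

lemma is_min_trans:
  assumes "is_min s t f" "is_min t t' g" "s < t" "t < t'"
  shows "is_min s t' (\<lambda>j. min (f j) (g j))"
proof -
  have "min (f j) (g j) \<le> V u j" if "s \<le> u" "u < t'" for u j
  proof (cases "u < t")
    case True
    then have "f j \<le> V u j" using assms(1) that unfolding is_min_def by blast
    then show ?thesis by simp
  next
    case False
    then have "g j \<le> V u j" using assms(2) that unfolding is_min_def by (meson not_le)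
    then show ?thesis by simp
  qed
  moreover have "\<exists>u. s \<le> u \<and> u < t' \<and> V u j = min (f j) (g j)" for j
  proof (cases "f j \<le> g j")
    case True
    obtain u where "s \<le> u" "u < t" "V u j = f j" using assms(1) unfolding is_min_def by blast
    then show ?thesis using assms True by (intro exI[of _ u]) auto
  next
    case False
    obtain u where "t \<le> u" "u < t'" "V u j = g j" using assms(2) unfolding is_min_def by blast
    then show ?thesis using assms False by (intro exI[of _ u]) auto
  qed
  ultimately show ?thesis unfolding is_min_def by blast
qed

lemma min_code:
  assumes "s < t"
  obtains m where "is_min s t (entry m)"
proof -
  define f where "f j = (LEAST v. \<exists>u. s \<le> u \<and> u < t \<and> V u j = v)" for j
  have f: "\<exists>u. s \<le> u \<and> u < t \<and> V u j = f j" for j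
    unfolding f_def by (rule LeastI[of _ "V s j"]) (use assms in auto)
  have "f j \<le> V u j" if "s \<le> u" "u < t" for u j
    unfolding f_def by (rule Least_le) (use that in auto)
  then have "is_min s t f" unfolding is_min_def using f by blast
  moreover have "\<exists>N. \<forall>j\<ge>N. f j = 0" using f support by metis
  then obtain m where "\<forall>j. entry m j = f j" using code_exists by blast
  ultimately show ?thesis using that by (metis ext)
qed

lemma state_code:
  obtains c where "entry c = V t"
  using code_exists[of "V t"] support by (metis ext)

lemma is_min_succ:
  assumes "is_succ s t"
  shows "is_min s t (V s)"
proof -
  have "s < t" "\<And>u. s \<le> u \<Longrightarrow> u < t \<Longrightarrow> u = s"
    using assms is_succ_le[OF assms] by (auto simp: is_succ_def intro: antisym)
  then show ?thesis unfolding is_min_def by auto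
qed

text \<open>Rank \<open>k + 1\<close> is the first rank that \<open>level T k\<close> cannot pass:
  already \<open>level T 0\<close> passes limits without overflow, and each jump gains one rank. The
  start \<open>s\<close> itself may be critical.\<close>

definition free :: "nat \<Rightarrow> time \<Rightarrow> time \<Rightarrow> bool"
  where "free k s t \<longleftrightarrow> (\<forall>u. s < u \<and> u \<le> t \<longrightarrow> \<not> crit (Suc k) u)"

lemma free_refl: "free k s s"
  unfolding free_def by (meson leD)

lemma free_sub: "free k s t \<Longrightarrow> s \<le> s' \<Longrightarrow> t' \<le> t \<Longrightarrow> free k s' t'"
  unfolding free_def by (meson le_less_trans order_trans)

lemma free_trans: "free k s t \<Longrightarrow> free k t t' \<Longrightarrow> free k s t'"
  unfolding free_def by (meson not_le)

text \<open>Required for every time \<open>s\<close> at which the state coded by \<open>c\<close>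
  occurs: states may recur, and their codes carry no time.\<close>

definition sound :: "nat \<Rightarrow> bool" where
  "sound k \<longleftrightarrow> (\<forall>c d m s. reach (level T k) c d m \<longrightarrow> entry c = V s \<longrightarrow>
     (\<exists>t>s. entry d = V t \<and> is_min s t (entry m) \<and> free k s t))"

definition complete :: "nat \<Rightarrow> bool" where
  "complete k \<longleftrightarrow> (\<forall>s t c d m. s < t \<longrightarrow> free k s t \<longrightarrow> entry c = V s \<longrightarrow> entry d = V t \<longrightarrow>
     is_min s t (entry m) \<longrightarrow> reach (level T k) c d m)"

section \<open>The jump and the next critical time\<close>

lemma reach_before_crit:
  assumes "sound k" "complete k" "s \<le> u" "u < l" "crit (Suc k) l"
    and no: "\<And>u. s < u \<Longrightarrow> u < l \<Longrightarrow> \<not> crit (Suc k) u" and x: "entry x = V u"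
  shows "(\<exists>m. reach (level T k) x y m) \<longleftrightarrow> (\<exists>u'. u < u' \<and> u' < l \<and> entry y = V u')"
proof
  assume "\<exists>m. reach (level T k) x y m"
  then obtain m where m: "reach (level T k) x y m" by blast
  obtain u' where u': "u < u'" "entry y = V u'" "free k u u'"
    using assms(1) m x unfolding sound_def by blast
  have "u' < l"
  proof (rule ccontr)
    assume "\<not> u' < l"
    then show False using u'(3) assms(4,5) unfolding free_def by (meson not_le)
  qed
  then show "\<exists>u'. u < u' \<and> u' < l \<and> entry y = V u'" using u' by blast
next
  assume "\<exists>u'. u < u' \<and> u' < l \<and> entry y = V u'"
  then obtain u' where u': "u < u'" "u' < l" "entry y = V u'" by blast
  have "free k u u'" unfolding free_def using no assms(3) u' by (meson le_less_trans)
  moreover obtain m where "is_min u u' (entry m)" using min_code[OF u'(1)] .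
  ultimately show "\<exists>m. reach (level T k) x y m"
    using assms(2) u' x unfolding complete_def by blast
qed

text \<open>By \<open>reach_before_crit\<close>, what level \<open>k\<close> reaches from a state at
  a time \<open>u\<close> before \<open>l\<close> are exactly the states strictly between
  \<open>u\<close> and \<open>l\<close>. So quantifiers over reachable states range over final
  segments below \<open>l\<close>: divergence becomes overflow at \<open>l\<close>, and settling
  becomes a limit inferior that is attained cofinally.\<close>

lemma jump_iff:
  assumes sc: "sound k" "complete k" and sl: "s < l" and cr: "crit (Suc k) l"
    and no: "\<And>u. s < u \<Longrightarrow> u < l \<Longrightarrow> \<not> crit (Suc k) u" and c: "entry c = V s"
  shows "jump (reach (level T k)) c d m \<longleftrightarrow> entry d = V l \<and> is_min s l (entry m)"
proof -
  let ?R = "reach (level T k)"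
  note rb = reach_before_crit[OF sc _ _ cr no]
  have lim: "is_limit l" using cr by simp
  have R_c: "(\<exists>m. ?R c y m) \<longleftrightarrow> (\<exists>u'. s < u' \<and> u' < l \<and> entry y = V u')" for y
    using rb[of s s c y] sl c by simp
  have R_x: "(\<exists>m. ?R x y m) \<longleftrightarrow> (\<exists>u'. u < u' \<and> u' < l \<and> entry y = V u')"
    if "s < u" "u < l" "entry x = V u" for x y u
    using rb[of s u x y] that by simp
  have all_R: "(\<forall>y m'. ?R x y m' \<longrightarrow> Q y) \<longleftrightarrow> (\<forall>u'. u < u' \<and> u' < l \<longrightarrow> (\<forall>y. entry y = V u' \<longrightarrow> Q y))"
    if "s < u" "u < l" "entry x = V u" for x u Q
    using R_x[OF that] by blast
  have div: "diverges ?R c j \<longleftrightarrow> overflows (\<lambda>s. V s j) l" for j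
  proof
    assume d: "diverges ?R c j"
    show "overflows (\<lambda>s. V s j) l"
      unfolding overflows_def
    proof
      fix v
      obtain x mx where x: "?R c x mx" "\<forall>y m'. ?R x y m' \<longrightarrow> v \<le> entry y j"
        using d unfolding diverges_def by blast
      then obtain u where u: "s < u" "u < l" "entry x = V u" using R_c by blast
      obtain u' where u': "u < u'" "u' < l" using limit_above[OF lim u(2)] .
      have "v \<le> V u'' j" if "u' \<le> u''" "u'' < l" for u''
      proof -
        obtain y where y: "entry y = V u''" using state_code .
        then have "\<exists>m. ?R x y m" using R_x[OF u] that u' by (meson less_le_trans)
        then show ?thesis using x(2) y by metis
      qed
      then show "\<exists>u<l. \<forall>u'. u \<le> u' \<and> u' < l \<longrightarrow> v \<le> V u' j" using u' by blast
    qed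
  next
    assume o: "overflows (\<lambda>s. V s j) l"
    show "diverges ?R c j"
      unfolding diverges_def
    proof
      fix v
      obtain u where u: "u < l" "\<forall>u'. u \<le> u' \<and> u' < l \<longrightarrow> v \<le> V u' j" using o unfolding overflows_def by blast
      obtain u1 where u1: "max u s < u1" "u1 < l" using limit_above[OF lim, of "max u s"] u sl by auto
      obtain x where x: "entry x = V u1" using state_code .
      have "\<exists>m. ?R c x m" using R_c u1 x by auto
      moreover have "\<forall>y m'. ?R x y m' \<longrightarrow> v \<le> entry y j"
        by (subst all_R[of u1]) (use u1 x u in auto)
      ultimately show "\<exists>x m. ?R c x m \<and> (\<forall>y m'. ?R x y m' \<longrightarrow> v \<le> entry y j)" by blast
    qed
  qed
  have set1: "V l j = v" if st: "settles ?R c j v" for j v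
  proof -
    obtain x mx where x: "?R c x mx" "\<forall>y m'. ?R x y m' \<longrightarrow> v \<le> entry y j"
        "\<forall>y m'. ?R x y m' \<longrightarrow> (\<exists>y' m''. ?R y y' m'' \<and> entry y' j = v)"
      using st unfolding settles_def by blast
    then obtain u where u: "s < u" "u < l" "entry x = V u" using R_c by blast
    obtain u' where u': "u < u'" "u' < l" using limit_above[OF lim u(2)] .
    show ?thesis unfolding limit[OF lim]
    proof (rule limit_value_eqI[OF u'(2)])
      fix w assume w: "u' \<le> w" "w < l"
      obtain y where y: "entry y = V w" using state_code .
      then have "\<exists>m. ?R x y m" using R_x[OF u] w u' by (meson less_le_trans)
      then show "v \<le> V w j" using x(2) y by metis
    next
      fix w assume w: "w < l"
      have w': "u < max w u'" "max w u' < l" using w u' by (auto simp: less_max_iff_disj)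
      obtain y where y: "entry y = V (max w u')" using state_code .
      then have "\<exists>m. ?R x y m" using R_x[OF u] w' by blast
      then obtain y' m'' where y': "?R y y' m''" "entry y' j = v" using x(3) by blast
      then obtain w'' where "max w u' < w''" "w'' < l" "entry y' = V w''"
        using R_x[of "max w u'" y y'] w' u y by (meson less_trans)
      then show "\<exists>w'. w \<le> w' \<and> w' < l \<and> V w' j = v" using y'(2) by (intro exI[of _ w'']) auto
    qed
  qed
  have set2: "settles ?R c j (V l j)" if no: "\<not> overflows (\<lambda>s. V s j) l" for j
  proof -
    obtain s1 where s1: "s1 < l" "\<forall>u. s1 \<le> u \<and> u < l \<longrightarrow> V l j \<le> V u j"
      using limit_attained(1)[OF lim no] limit[OF lim] by auto
    have hit: "\<exists>u. r \<le> u \<and> u < l \<and> V u j = V l j" if "r < l" for r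
      using limit_attained(2)[OF lim no] limit[OF lim] that by auto
    obtain u where u: "max s1 s < u" "u < l" using limit_above[OF lim, of "max s1 s"] s1 sl by auto
    then have su: "s < u" by simp
    obtain x where x: "entry x = V u" using state_code .
    have "\<exists>m. ?R c x m" using R_c su u x by auto
    moreover have "\<forall>y m'. ?R x y m' \<longrightarrow> V l j \<le> entry y j"
      by (subst all_R[OF su u(2) x]) (use u s1 in auto)
    moreover have "\<exists>y' m''. ?R y y' m'' \<and> entry y' j = V l j" if y: "?R x y m'" for y m'
    proof -
      obtain w where w: "u < w" "w < l" "entry y = V w" using R_x[OF su u(2) x] y by blast
      obtain w1 where w1: "w < w1" "w1 < l" using limit_above[OF lim w(2)] .
      obtain w2 where w2: "w1 \<le> w2" "w2 < l" "V w2 j = V l j" using hit[OF w1(2)] by blast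
      obtain y' where y': "entry y' = V w2" using state_code .
      have "w < w2" using w1 w2 by simp
      then have "\<exists>m. ?R y y' m" using R_x[of w y y'] w w2 su y' by (meson less_trans)
      then show ?thesis using y' w2(3) by auto
    qed
    ultimately show ?thesis unfolding settles_def by blast
  qed
  have mn: "(\<forall>j. minimum ?R c j (entry m j)) \<longleftrightarrow> is_min s l (entry m)"
  proof -
    have "minimum ?R c j v \<longleftrightarrow> (\<forall>u. s \<le> u \<and> u < l \<longrightarrow> v \<le> V u j) \<and> (\<exists>u. s \<le> u \<and> u < l \<and> V u j = v)" for j v
    proof -
      have "(\<forall>y m'. ?R c y m' \<longrightarrow> v \<le> entry y j) \<longleftrightarrow> (\<forall>u. s < u \<and> u < l \<longrightarrow> v \<le> V u j)"
        using R_c state_code by metis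
      moreover have "(\<exists>y m'. ?R c y m' \<and> entry y j = v) \<longleftrightarrow> (\<exists>u. s < u \<and> u < l \<and> V u j = v)"
        using R_c state_code by metis
      ultimately show ?thesis
        unfolding minimum_def c using sl by (auto simp: order_le_less)
    qed
    then show ?thesis unfolding is_min_def by blast
  qed
  have "(\<forall>j. (diverges ?R c j \<and> entry d j = 0) \<or> settles ?R c j (entry d j)) \<longleftrightarrow> entry d = V l"
  proof
    assume "\<forall>j. (diverges ?R c j \<and> entry d j = 0) \<or> settles ?R c j (entry d j)"
    then show "entry d = V l" using div overflow_value[OF _ lim] set1 by (metis ext)
  next
    assume "entry d = V l"
    then show "\<forall>j. (diverges ?R c j \<and> entry d j = 0) \<or> settles ?R c j (entry d j)"
      using div overflow_value[OF _ lim] set2 by metis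
  qed
  moreover have "\<exists>j. diverges ?R c j" using div cr by auto
  ultimately show ?thesis unfolding jump_def using mn by blast
qed

lemma jump_sound:
  assumes sc: "sound k" "complete k" and c: "entry c = V s" and j: "jump (reach (level T k)) c d m"
  shows "\<exists>t>s. entry d = V t \<and> is_min s t (entry m) \<and> free (Suc k) s t"
proof -
  let ?R = "reach (level T k)"
  \<comment> \<open>Without a further critical time level \<open>k\<close> would reach all later
    times. The countably many witnesses of divergence lie below one time \<open>u\<close>, at which
    component \<open>j\<close> would have to exceed every number.\<close>
  have ex: "\<exists>l. s < l \<and> crit (Suc k) l"
  proof (rule ccontr)
    assume n: "\<not> ?thesis"
    then have fr: "free k u u'" if "s \<le> u" for u u' using that unfolding free_def by (meson le_less_trans)
    obtain j where "diverges ?R c j" using j unfolding jump_def by blast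
    then obtain x where x: "\<And>v. \<exists>m. ?R c (x v) m" "\<And>v y m'. ?R (x v) y m' \<Longrightarrow> v \<le> entry y j"
      unfolding diverges_def by metis
    have "\<exists>t>s. entry (x v) = V t" for v using sc(1) x(1) c unfolding sound_def by metis
    then obtain t where t: "\<And>v. s < t v" "\<And>v. entry (x v) = V (t v)" by metis
    obtain u where u: "\<And>v. t v < u" using time_bounded[of "range t"] by auto
    obtain y where y: "entry y = V u" using state_code .
    have "v \<le> V u j" for v
    proof -
      obtain m where "is_min (t v) u (entry m)" using min_code[OF u] .
      then have "?R (x v) y m"
        using sc(2) u t fr[of "t v" u] y unfolding complete_def by (meson less_imp_le)
      then show ?thesis using x(2) y by metis
    qed
    from this[of "Suc (V u j)"] show False by simp
  qed
  define l where "l = (LEAST l. s < l \<and> crit (Suc k) l)"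
  have l: "s < l" "crit (Suc k) l" using LeastI_ex[OF ex] unfolding l_def by blast+
  have no: "\<not> crit (Suc k) u" if "s < u" "u < l" for u
    using not_less_Least[of u "\<lambda>l. s < l \<and> crit (Suc k) l"] that unfolding l_def by blast
  have "entry d = V l" "is_min s l (entry m)" using jump_iff[OF sc l no c] j by blast+
  moreover have "free (Suc k) s l"
    unfolding free_def
  proof (intro allI impI)
    fix u assume u: "s < u \<and> u \<le> l"
    show "\<not> crit (Suc (Suc k)) u"
    proof (cases "u = l")
      case True
      \<comment> \<open>A time of rank \<open>k + 2\<close> is a limit of times of rank
        \<open>k + 1\<close>, but there are none between \<open>s\<close> and
        \<open>l\<close>.\<close>
      then show ?thesis using no l(1) by (metis crit.simps(2))
    next
      case False
      then show ?thesis using no[of u] u crit_Suc_imp by (metis order_le_less)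
    qed
  qed
  ultimately show ?thesis using l by blast
qed

section \<open>Limits without overflow\<close>

primrec blocks :: "nat \<Rightarrow> (nat \<Rightarrow> nat) \<Rightarrow> time \<Rightarrow> time \<Rightarrow> bool" where
  "blocks 0 f s t \<longleftrightarrow> s = t"
| "blocks (Suc n) f s t \<longleftrightarrow> (\<exists>s'. s < s' \<and> is_min s s' f \<and> blocks n f s' t)"

lemma blocks_le: "blocks n f s t \<Longrightarrow> s \<le> t"
proof (induction n arbitrary: s)
  case (Suc n)
  then obtain s' where "s < s'" "blocks n f s' t" by auto
  then show ?case using Suc.IH[of s'] by simp
qed simp

lemma blocks_ge: "blocks n f s t \<Longrightarrow> s \<le> u \<Longrightarrow> u < t \<Longrightarrow> f j \<le> V u j"
proof (induction n arbitrary: s)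
  case (Suc n)
  then obtain s' where "s < s'" "is_min s s' f" "blocks n f s' t" by auto
  then show ?case using Suc.IH[of s'] Suc.prems unfolding is_min_def by (meson not_le)
qed auto

lemma blocks_last: "blocks (Suc n) f s t \<Longrightarrow> \<exists>t0. blocks n f s t0 \<and> t0 < t \<and> is_min t0 t f"
proof (induction n arbitrary: s)
  case (Suc n)
  then obtain s' where "s < s'" "is_min s s' f" "blocks (Suc n) f s' t" by auto
  then show ?case using Suc.IH[of s'] by auto
qed auto

text \<open>\<open>l\<close> is the least time up to which chains of every length fit. If no chain
  of \<open>n\<close> blocks ends by \<open>u < l\<close>, then in a chain of \<open>n + 1\<close>
  blocks the last block starts after \<open>u\<close>; so every component returns cofinally to its
  value in \<open>f\<close> and never falls below it.\<close>

lemma blocks_limit: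
  assumes b: "\<And>n. \<exists>t. blocks n f s t \<and> free k s t"
  shows "\<exists>l>s. V l = f \<and> is_min s l f \<and> free k s l"
proof -
  obtain t where t: "\<And>n. blocks n f s (t n)" "\<And>n. free k s (t n)" using b by metis
  let ?P = "\<lambda>l. \<forall>n. \<exists>t\<le>l. blocks n f s t"
  obtain u where "\<And>n. t n < u" using time_bounded[of "range t"] by auto
  then have P: "?P u" using t by (meson less_imp_le)
  define l where "l = (LEAST l. ?P l)"
  have l: "?P l" unfolding l_def using P by (rule LeastI)
  have below: "\<exists>n. \<not> (\<exists>t\<le>u. blocks n f s t)" if "u < l" for u
    using not_less_Least[of u ?P] that unfolding l_def by blast
  have hit: "\<exists>t0 t1. u < t0 \<and> blocks n f s t0 \<and> t0 < t1 \<and> t1 \<le> l \<and> is_min t0 t1 f"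
    if "\<not> (\<exists>t\<le>u. blocks n f s t)" for u n
    using l[rule_format, of "Suc n"] blocks_last[of n f s] that by (meson not_le)
  have sl: "s < l"
    using l[rule_format, of 1] by (metis One_nat_def blocks.simps(2) blocks_le less_le_trans)
  have ge: "f j \<le> V u j" if "s \<le> u" "u < l" for u j
    using below[OF that(2)] hit blocks_ge that(1) by metis
  have at: "\<exists>u'. u < u' \<and> u' < l \<and> V u' j = f j" if u: "u < l" for u j
  proof -
    obtain n where "\<not> (\<exists>t\<le>u. blocks n f s t)" using below[OF u] by blast
    then obtain t0 t1 where t: "u < t0" "t0 < t1" "t1 \<le> l" "is_min t0 t1 f" using hit by blast
    then obtain u' where "t0 \<le> u'" "u' < t1" "V u' j = f j" unfolding is_min_def by blast
    then show ?thesis using t by (intro exI[of _ u']) auto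
  qed
  have lim: "is_limit l" unfolding is_limit_def is_succ_def using sl at by blast
  have "V l j = f j" for j
    unfolding limit[OF lim]
    by (rule limit_value_eqI[OF sl]) (use ge at in \<open>blast intro: less_imp_le\<close>)+
  moreover have "is_min s l f" unfolding is_min_def using ge at[OF sl] by (meson less_imp_le)
  moreover have "free k s l"
    unfolding free_def
  proof (intro allI impI)
    fix u assume u: "s < u \<and> u \<le> l"
    show "\<not> crit (Suc k) u"
    proof (cases "u = l")
      case True
      have "\<not> overflows (\<lambda>s. V s j) l" for j
      proof
        assume "overflows (\<lambda>s. V s j) l"
        then obtain u where "u < l" "\<forall>u'. u \<le> u' \<and> u' < l \<longrightarrow> Suc (f j) \<le> V u' j"
          unfolding overflows_def by blast
        then show False using at[of u j] by (metis Suc_n_not_le_n less_imp_le)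
      qed
      then show ?thesis using True by auto
    next
      case False
      then obtain n where "\<not> (\<exists>t\<le>u. blocks n f s t)" using below u by (meson order_le_less)
      then have "u < t n" using t(1) by (meson not_le)
      then show ?thesis using t(2)[of n] u unfolding free_def by (meson less_imp_le)
    qed
  qed
  ultimately show ?thesis using sl by blast
qed

lemma sound_from_level:
  assumes lv: "\<And>c d m s. level T k c d m \<Longrightarrow> entry c = V s \<Longrightarrow>
      \<exists>t>s. entry d = V t \<and> is_min s t (entry m) \<and> free k s t"
  shows "sound k"
proof -
  have "reach (level T k) c d m \<Longrightarrow> entry c = V s \<Longrightarrow>
      \<exists>t>s. entry d = V t \<and> is_min s t (entry m) \<and> free k s t"
    and "path (level T k) n c d \<Longrightarrow> entry c = V s \<Longrightarrow> \<exists>t. blocks n (entry d) s t \<and> free k s t"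
    for c d m n s
  proof (induction arbitrary: s and s rule: reach_path.inducts)
    case (Base c d m)
    then show ?case using lv by blast
  next
    case (Trans c c' m1 d m2 m)
    obtain t where t: "s < t" "entry c' = V t" "is_min s t (entry m1)" "free k s t"
      using Trans(2)[OF Trans(6)] by blast
    obtain t' where t': "t < t'" "entry d = V t'" "is_min t t' (entry m2)" "free k t t'"
      using Trans(4)[OF t(2)] by blast
    have "is_min s t' (\<lambda>j. min (entry m1 j) (entry m2 j))" by (rule is_min_trans[OF t(3) t'(3) t(1) t'(1)])
    moreover have "(\<lambda>j. min (entry m1 j) (entry m2 j)) = entry m" using Trans(5) by auto
    ultimately show ?case using t t' free_trans by (metis less_trans)
  next
    case (Limit c c' m1 d m)
    obtain t where t: "s < t" "entry c' = V t" "is_min s t (entry m1)" "free k s t"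
      using Limit(2)[OF Limit(6)] by blast
    have "\<exists>t'. blocks n (entry d) t t' \<and> free k t t'" for n using Limit(4)[OF t(2)] .
    from blocks_limit[OF this] obtain t' where t': "t < t'" "V t' = entry d" "is_min t t' (entry d)" "free k t t'"
      by blast
    have "is_min s t' (\<lambda>j. min (entry m1 j) (entry d j))" by (rule is_min_trans[OF t(3) t'(3) t(1) t'(1)])
    moreover have "(\<lambda>j. min (entry m1 j) (entry d j)) = entry m" using Limit(5) by auto
    ultimately show ?case using t t' free_trans by (metis less_trans)
  next
    case (Path_0 c d)
    show ?case using free_refl by (intro exI[of _ s]) simp
  next
    case (Path_Suc c c' m d n)
    obtain t where t: "s < t" "entry c' = V t" "is_min s t (entry m)" "free k s t"
      using Path_Suc(2)[OF Path_Suc(6)] by blast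
    obtain t' where t': "blocks n (entry d) t t'" "free k t t'" using Path_Suc(4)[OF t(2)] by blast
    have "entry m = entry d" using Path_Suc(5) by auto
    then show ?case using t t' free_trans by (intro exI[of _ t']) auto
  qed
  then show ?thesis unfolding sound_def by blast
qed

text \<open>Only \<open>N\<close> components can be nonzero, so finitely many thresholds have to be
  passed, and the maximum of finitely many times below a limit is below it.\<close>

lemma block_exists:
  assumes lim: "is_limit t" and no: "\<And>j. \<not> overflows (\<lambda>s. V s j) t"
  shows "\<exists>s1<t. \<forall>u. s1 \<le> u \<and> u < t \<longrightarrow> (\<exists>u'. u < u' \<and> u' < t \<and> is_min u u' (V t)) \<and> is_min u t (V t)"
proof -
  have "\<exists>s. s < t \<and> (\<forall>u. s \<le> u \<and> u < t \<longrightarrow> V t j \<le> V u j)" for j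
    using limit_attained(1)[OF lim no] limit[OF lim] by auto
  then obtain s where s: "\<And>j. s j < t" "\<And>j u. s j \<le> u \<Longrightarrow> u < t \<Longrightarrow> V t j \<le> V u j" by metis
  obtain r where r: "r < t" using lim by (auto simp: is_limit_def)
  define s1 where "s1 = Max (insert r (s ` {..<N}))"
  have s1: "s1 < t" unfolding s1_def using s r by (subst Max_less_iff) auto
  have s1j: "s j \<le> s1" if "j < N" for j unfolding s1_def using that by (intro Max_ge) auto
  have ge: "V t j \<le> V u j" if "s1 \<le> u" "u < t" for u j
  proof (cases "j < N")
    case True
    then show ?thesis using s(2) s1j that by (meson order_trans)
  qed (simp add: support)
  have hit: "\<exists>v. u \<le> v \<and> v < t \<and> V v j = V t j" if "u < t" for u j
    using limit_attained(2)[OF lim no] limit[OF lim] that by auto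
  have "\<exists>u'. u < u' \<and> u' < t \<and> is_min u u' (V t)" if u: "s1 \<le> u" "u < t" for u
  proof -
    obtain v where v: "\<And>j. u \<le> v j" "\<And>j. v j < t" "\<And>j. V (v j) j = V t j" using hit[OF u(2)] by metis
    have "Max (insert u (v ` {..<N})) < t" using u v by (subst Max_less_iff) auto
    then obtain u' where u': "Max (insert u (v ` {..<N})) < u'" "u' < t" using limit_above[OF lim] by blast
    then have "u < u'" and vu: "\<And>j. j < N \<Longrightarrow> v j < u'" by (auto simp: Max_less_iff)
    have "\<exists>w. u \<le> w \<and> w < u' \<and> V w j = V t j" for j
    proof (cases "j < N")
      case True
      then show ?thesis using v vu by blast
    next
      case False
      then show ?thesis using \<open>u < u'\<close> support by (intro exI[of _ u]) auto
    qed
    then have "is_min u u' (V t)" unfolding is_min_def using ge u u' by (meson less_trans order_trans)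
    then show ?thesis using \<open>u < u'\<close> u' by blast
  qed
  moreover have "is_min u t (V t)" if u: "s1 \<le> u" "u < t" for u
    unfolding is_min_def using ge u hit by (meson order_trans)
  ultimately show ?thesis using s1 by blast
qed

text \<open>Induction on the end point \<open>t\<close>: the computation is cut at a time before
  \<open>t\<close> from which a single step, one application of the limit rule or a single jump
  leads to \<open>t\<close>.\<close>

lemma complete_step:
  assumes sc: "\<And>k'. k' < k \<Longrightarrow> sound k' \<and> complete k'"
  shows "complete k"
proof -
  have "reach (level T k) c d m"
    if "s < t" "free k s t" "entry c = V s" "entry d = V t" "is_min s t (entry m)" for s t c d m
    using that
  proof (induction t arbitrary: s c d m rule: less_induct)
    case (less t)
    note st = less.prems(1) and fr = less.prems(2) and c = less.prems(3) and d = less.prems(4)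
      and m = less.prems(5)
    have combine: "reach (level T k) c d m"
      if r: "s < r" "r < t" and m2: "is_min r t (entry m2)" and st2: "\<And>x. entry x = V r \<Longrightarrow> level T k x d m2" for r m2
    proof -
      obtain x where x: "entry x = V r" using state_code .
      obtain m1 where m1: "is_min s r (entry m1)" using min_code[OF r(1)] .
      have "reach (level T k) c x m1"
        using less.IH[OF r(2,1) _ c x m1] fr free_sub r(2) by (meson less_imp_le order_refl)
      moreover have "reach (level T k) x d m2" using st2[OF x] reach_path.Base by blast
      moreover have "entry m = (\<lambda>j. min (entry m1 j) (entry m2 j))"
        using is_min_unique[OF m is_min_trans[OF m1 m2 r]] .
      ultimately show ?thesis using reach_path.Trans by (metis (mono_tags))
    qed
    show ?case
    proof (cases t rule: time_cases)
      case least
      then show ?thesis using st by (meson leD)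
    next
      case (succ r)
      have lv: "level T k x d m2" if "entry x = V r" "entry m2 = V r" for x m2
        by (rule level_mono[of T 0]) (use itrm_run.succ[OF itrm_run_axioms succ that(1), of d m2] d that in auto)
      have "s \<le> r" using is_succ_le[OF succ st] .
      show ?thesis
      proof (cases "s = r")
        case True
        then have "entry m = V r" using is_min_unique[OF m] is_min_succ[OF succ] by simp
        then show ?thesis using lv[of c m] c True reach_path.Base by blast
      next
        case False
        obtain m2 where m2: "entry m2 = V r" using state_code .
        show ?thesis
        proof (rule combine)
          show "s < r" "r < t" using False \<open>s \<le> r\<close> succ by (auto simp: is_succ_def)
          show "is_min r t (entry m2)" using is_min_succ[OF succ] m2 by simp
        qed (use lv m2 in blast)
      qed
    next
      case limit
      show ?thesis
      proof (cases "\<exists>j. overflows (\<lambda>s. V s j) t")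
        case False
        then obtain s1 where s1: "s1 < t" "\<And>u. s1 \<le> u \<Longrightarrow> u < t \<Longrightarrow> \<exists>u'. u < u' \<and> u' < t \<and> is_min u u' (V t)"
            "\<And>u. s1 \<le> u \<Longrightarrow> u < t \<Longrightarrow> is_min u t (V t)"
          using block_exists[OF limit] by blast
        have path: "path (level T k) n x d" if "s1 \<le> u" "s \<le> u" "u < t" "entry x = V u" for n x u
          using that
        proof (induction n arbitrary: x u)
          case 0
          show ?case by (rule reach_path.Path_0)
        next
          case (Suc n)
          obtain u' where u': "u < u'" "u' < t" "is_min u u' (V t)" using s1(2) Suc.prems by blast
          obtain x' where x': "entry x' = V u'" using state_code .
          have "free k u u'" using fr free_sub Suc.prems u' by (meson less_imp_le)
          then have "reach (level T k) x x' d"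
            using less.IH[OF u'(2,1) _ Suc.prems(4) x', of d] u'(3) d by simp
          moreover have "path (level T k) n x' d" using Suc.IH[of u' x'] Suc.prems u' x' by auto
          ultimately show ?case using reach_path.Path_Suc by blast
        qed
        obtain r where r: "max s1 s < r" "r < t" using limit_above[OF limit, of "max s1 s"] s1 st by auto
        then have sr: "s < r" by simp
        obtain x where x: "entry x = V r" using state_code .
        obtain m1 where m1: "is_min s r (entry m1)" using min_code[OF sr] .
        have 1: "reach (level T k) c x m1"
          using less.IH[OF r(2) sr _ c x m1] fr free_sub r(2) by (meson less_imp_le order_refl)
        have 2: "path (level T k) n x d" for n by (rule path) (use r x in auto)
        have "is_min r t (entry d)" using s1(3)[of r] r d by auto
        then have 3: "entry m = (\<lambda>j. min (entry m1 j) (entry d j))"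
          using is_min_unique[OF m is_min_trans[OF m1 _ sr r(2)]] by blast
        show ?thesis by (rule reach_path.Limit[OF 1 2]) (simp add: 3)
      next
        case True
        have "\<not> crit (Suc k) t" using fr st unfolding free_def by blast
        \<comment> \<open>\<open>n\<close> is the exact rank of \<open>t\<close>, positive because
          \<open>t\<close> is an overflow time. With \<open>n = k' + 1\<close>, the time
          \<open>t\<close> is not a limit of times of rank \<open>n\<close>, so from some
          \<open>r\<close> on it is the next such time and the jump over level \<open>k' < k\<close>
          leads to it.\<close>
        define n where "n = (LEAST n. \<not> crit (Suc n) t)"
        have n: "\<not> crit (Suc n) t" unfolding n_def using \<open>\<not> crit (Suc k) t\<close> by (rule LeastI)
        have "n \<le> k" unfolding n_def using \<open>\<not> crit (Suc k) t\<close> by (rule Least_le)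
        have "crit (Suc 0) t" using limit True limit_above[OF limit] by (metis crit.simps)
        then obtain k' where k': "n = Suc k'" using n by (cases n) auto
        have cr: "crit (Suc k') t"
          using not_less_Least[of k' "\<lambda>n. \<not> crit (Suc n) t"] k' unfolding n_def by auto
        have sck: "sound k'" "complete k'" using sc[of k'] \<open>n \<le> k\<close> k' by auto
        obtain u where u: "u < t" "\<And>u'. u < u' \<Longrightarrow> u' < t \<Longrightarrow> \<not> crit (Suc k') u'"
          using n k' limit True by (metis crit.simps(2))
        define r where "r = max u s"
        have r: "r < t" "\<And>u'. r < u' \<Longrightarrow> u' < t \<Longrightarrow> \<not> crit (Suc k') u'" "s \<le> r"
          using u st by (auto simp: r_def)
        have lv: "level T k x d m2" if "entry x = V r" "is_min r t (entry m2)" for x m2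
        proof -
          have "jump (reach (level T k')) x d m2"
            using jump_iff[OF sck r(1) cr r(2) that(1)] d that(2) by blast
          then have "level T (Suc k') x d m2" by simp
          then show ?thesis by (rule level_mono) (use \<open>n \<le> k\<close> k' in simp)
        qed
        show ?thesis
        proof (cases "r = s")
          case True
          then show ?thesis using lv[of c m] c m reach_path.Base by blast
        next
          case False
          obtain m2 where m2: "is_min r t (entry m2)" using min_code[OF r(1)] .
          show ?thesis by (rule combine[of r m2]) (use False r m2 lv in auto)
        qed
      qed
    qed
  qed
  then show ?thesis unfolding complete_def by blast
qed

lemma level_sound:
  assumes sc: "\<And>k'. k' < k \<Longrightarrow> sound k' \<and> complete k'"
    and "level T k c d m" "entry c = V s"
  shows "\<exists>t>s. entry d = V t \<and> is_min s t (entry m) \<and> free k s t"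
  using assms
proof (induction k)
  case 0
  obtain t where t: "is_succ s t" using time_succ .
  have *: "entry d = V t" "entry m = V s" using succ[OF t 0(3), of d m] 0(2) by auto
  have "free 0 s t" unfolding free_def
    using t is_succ_le[OF t] by (auto simp: is_limit_def) (metis is_succ_le leD order_le_less t)
  then show ?case using * is_min_succ[OF t] t by (auto simp: is_succ_def)
next
  case (Suc k)
  from Suc.prems(2) consider "level T k c d m" | "jump (reach (level T k)) c d m" by auto
  then show ?case
  proof cases
    case 1
    then obtain t where "s < t" "entry d = V t" "is_min s t (entry m)" "free k s t"
      using Suc by (metis less_SucI)
    moreover from this have "free (Suc k) s t" unfolding free_def using crit_Suc_imp by blast
    ultimately show ?thesis by blast
  next
    case 2
    then show ?thesis using jump_sound Suc.prems by blast
  qed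
qed

lemma sound_complete: "sound k \<and> complete k"
proof (induction k rule: less_induct)
  case (less k)
  then show ?case using sound_from_level level_sound complete_step by blast
qed

theorem reach_iff:
  assumes "entry c = V s"
  shows "(\<exists>m. reach (level T N) c d m) \<longleftrightarrow> (\<exists>t>s. entry d = V t)"
proof
  show "\<exists>m. reach (level T N) c d m \<Longrightarrow> \<exists>t>s. entry d = V t"
    using sound_complete[of N] assms unfolding sound_def by blast
next
  assume "\<exists>t>s. entry d = V t"
  then obtain t where t: "s < t" "entry d = V t" by blast
  obtain m where "is_min s t (entry m)" using min_code[OF t(1)] .
  moreover have "free N s t" unfolding free_def using not_crit by blast
  ultimately show "\<exists>m. reach (level T N) c d m"
    using sound_complete[of N] assms t unfolding complete_def by blast
qed

end

section \<open>Halting as a generically decided family\<close>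

definition reach_node :: "nat \<Rightarrow> nat \<Rightarrow> nat \<Rightarrow> nat"
  where "reach_node c d m = pair 0 (pair c (pair d m))"

definition path_node :: "nat \<Rightarrow> nat \<Rightarrow> nat \<Rightarrow> nat"
  where "path_node n c d = pair 1 (pair n (pair c d))"

definition reach_axiom :: "(nat \<Rightarrow> nat \<Rightarrow> nat \<Rightarrow> bool) \<Rightarrow> nat \<Rightarrow> bool" where
  "reach_axiom T v \<longleftrightarrow>
     pfst v = 0 \<and> T (pfst (psnd v)) (pfst (psnd (psnd v))) (psnd (psnd (psnd v))) \<or>
     pfst v = 1 \<and> pfst (psnd v) = 0"

text \<open>A rule whose side condition fails gets its own conclusion as premise.\<close>

definition reach_rule :: "nat \<Rightarrow> nat \<Rightarrow> nat \<Rightarrow> nat" where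
  "reach_rule v e i =
    (if pfst v = 0 then
       if pfst e = 0 then
         if \<forall>j. entry (psnd (psnd (psnd v))) j =
             min (entry (pfst (psnd (psnd e))) j) (entry (psnd (psnd (psnd e))) j)
         then if i = 0 then reach_node (pfst (psnd v)) (pfst (psnd e)) (pfst (psnd (psnd e)))
           else reach_node (pfst (psnd e)) (pfst (psnd (psnd v))) (psnd (psnd (psnd e)))
         else v
       else
         if \<forall>j. entry (psnd (psnd (psnd v))) j =
             min (entry (psnd (psnd e)) j) (entry (pfst (psnd (psnd v))) j)
         then if i = 0 then reach_node (pfst (psnd v)) (pfst (psnd e)) (psnd (psnd e))
           else path_node (i - 1) (pfst (psnd e)) (pfst (psnd (psnd v)))
         else v
     else
       if \<forall>j. entry (psnd e) j = entry (psnd (psnd (psnd v))) j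
       then if i = 0 then reach_node (pfst (psnd (psnd v))) (pfst e) (psnd e)
         else path_node (pfst (psnd v) - 1) (pfst e) (psnd (psnd (psnd v)))
       else v)"

text \<open>The rule parameter carries the existential witnesses:
  \<open>pair 0 (pair c' (pair m1 m2))\<close> for transitivity, \<open>pair 1 (pair c' m1)\<close>
  for the limit rule, whose premise \<open>i + 1\<close> is the path of length \<open>i\<close>, and
  \<open>pair c' m\<close> for extending a path.\<close>

lemma derivable_if_reach:
  "reach T c d m \<Longrightarrow> derivable (reach_axiom T) reach_rule (reach_node c d m)"
  "path T n c d \<Longrightarrow> derivable (reach_axiom T) reach_rule (path_node n c d)"
proof (induction rule: reach_path.inducts)
  case (Base c d m)
  then show ?case by (intro derivable.Axiom) (simp add: reach_axiom_def reach_node_def)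
next
  case (Trans c c' m1 d m2 m)
  show ?case
    by (rule derivable.Rule[where e = "pair 0 (pair c' (pair m1 m2))"])
      (use Trans in \<open>auto simp: reach_rule_def reach_node_def\<close>)
next
  case (Limit c c' m1 d m)
  show ?case
    by (rule derivable.Rule[where e = "pair 1 (pair c' m1)"])
      (use Limit in \<open>auto simp: reach_rule_def reach_node_def\<close>)
next
  case (Path_0 c d)
  show ?case by (intro derivable.Axiom) (simp add: reach_axiom_def path_node_def)
next
  case (Path_Suc c c' m d n)
  show ?case
    by (rule derivable.Rule[where e = "pair c' m"])
      (use Path_Suc in \<open>auto simp: reach_rule_def path_node_def\<close>)
qed

lemma reach_if_derivable:
  "derivable (reach_axiom T) reach_rule v \<Longrightarrow>
     (pfst v = 0 \<longrightarrow> reach T (pfst (psnd v)) (pfst (psnd (psnd v))) (psnd (psnd (psnd v)))) \<and>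
     (pfst v = 1 \<longrightarrow> path T (pfst (psnd v)) (pfst (psnd (psnd v))) (psnd (psnd (psnd v))))"
proof (induction rule: derivable.induct)
  case (Axiom v)
  then show ?case by (auto simp: reach_axiom_def intro: reach_path.intros)
next
  case (Rule v e)
  have IH0: "reach_rule v e i = reach_node c d m \<Longrightarrow> reach T c d m" for i c d m
    using Rule.IH[of i] by (simp add: reach_node_def)
  have IH1: "reach_rule v e i = path_node n c d \<Longrightarrow> path T n c d" for i n c d
    using Rule.IH[of i] by (simp add: path_node_def)
  have self: "reach_rule v e 0 = v \<Longrightarrow> ?case" using Rule.IH[of 0] by simp
  show ?case
  proof (cases "pfst v = 0")
    case v: True
    show ?thesis
    proof (cases "pfst e = 0")
      case e: True
      show ?thesis
      proof (cases "\<forall>j. entry (psnd (psnd (psnd v))) j =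
             min (entry (pfst (psnd (psnd e))) j) (entry (psnd (psnd (psnd e))) j)")
        case True
        have "reach T (pfst (psnd v)) (pfst (psnd e)) (pfst (psnd (psnd e)))"
          by (rule IH0[of 0]) (use v e True in \<open>simp add: reach_rule_def\<close>)
        moreover have "reach T (pfst (psnd e)) (pfst (psnd (psnd v))) (psnd (psnd (psnd e)))"
          by (rule IH0[of 1]) (use v e True in \<open>simp add: reach_rule_def\<close>)
        ultimately show ?thesis using reach_path.Trans True v by simp
      next
        case False
        show ?thesis by (rule self) (simp only: reach_rule_def v e False simp_thms if_True if_False)
      qed
    next
      case e: False
      show ?thesis
      proof (cases "\<forall>j. entry (psnd (psnd (psnd v))) j =
             min (entry (psnd (psnd e)) j) (entry (pfst (psnd (psnd v))) j)")
        case True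
        have "reach T (pfst (psnd v)) (pfst (psnd e)) (psnd (psnd e))"
          by (rule IH0[of 0]) (use v e True in \<open>simp add: reach_rule_def\<close>)
        moreover have "path T n (pfst (psnd e)) (pfst (psnd (psnd v)))" for n
          by (rule IH1[of "Suc n"]) (use v e True in \<open>simp add: reach_rule_def\<close>)
        ultimately show ?thesis using reach_path.Limit True v by simp
      next
        case False
        show ?thesis by (rule self) (simp only: reach_rule_def v e False simp_thms if_True if_False)
      qed
    qed
  next
    case v: False
    show ?thesis
    proof (cases "\<forall>j. entry (psnd e) j = entry (psnd (psnd (psnd v))) j")
      case True
      have 1: "reach T (pfst (psnd (psnd v))) (pfst e) (psnd e)"
        by (rule IH0[of 0]) (use v True in \<open>simp add: reach_rule_def\<close>)
      have 2: "path T (pfst (psnd v) - 1) (pfst e) (psnd (psnd (psnd v)))"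
        by (rule IH1[of 1]) (use v True in \<open>simp add: reach_rule_def\<close>)
      \<comment> \<open>The rule can also conclude a path of length 0, with \<open>0 - 1 = 0\<close>
        in its premise; such a path holds by \<open>Path_0\<close>.\<close>
      show ?thesis
        using v reach_path.Path_Suc[OF 1 _ 2] True reach_path.Path_0 by (cases "pfst (psnd v)") auto
    next
      case False
      show ?thesis by (rule self) (simp only: reach_rule_def v False simp_thms if_True if_False)
    qed
  qed
qed

lemma reach_iff_derivable: "reach T c d m \<longleftrightarrow> derivable (reach_axiom T) reach_rule (reach_node c d m)"
  using derivable_if_reach(1)[of T c d m] reach_if_derivable[of T "reach_node c d m"]
  by (auto simp: reach_node_def)

lemma good_eq: "computable (\<lambda>z. f) \<Longrightarrow> computable (\<lambda>z. g) \<Longrightarrow> good (\<lambda>z n. f n = g n)"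
  by (rule good_abs) (rule decidable_eq)

lemma good_le: "computable (\<lambda>z. f) \<Longrightarrow> computable (\<lambda>z. g) \<Longrightarrow> good (\<lambda>z n. f n \<le> g n)"
  by (rule good_abs) (rule decidable_le)

lemmas good_intros = good_conj good_disj good_imp good_not good_ex good_all good_eq good_le

abbreviation good3 :: "(nat set \<Rightarrow> nat \<Rightarrow> nat \<Rightarrow> nat \<Rightarrow> bool) \<Rightarrow> bool"
  where "good3 R \<equiv> good (\<lambda>z u. R z (pfst u) (pfst (psnd u)) (psnd (psnd u)))"

lemma good_reach:
  assumes "good3 T"
  shows "good3 (\<lambda>z. reach (T z))"
proof -
  have "good (\<lambda>z v. reach_axiom (T z) v)"
    unfolding reach_axiom_def by (intro good_intros good_app3[OF assms] computable_intros computable_id)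
  moreover have "computable (\<lambda>z u. reach_rule (pfst u) (pfst (psnd u)) (psnd (psnd u)))"
    unfolding reach_rule_def reach_node_def path_node_def
    by (intro computable_intros decidable_all computable_entry computable_id)
  ultimately have "good (\<lambda>z v. derivable (reach_axiom (T z)) reach_rule v)" by (rule good_derivable)
  then show ?thesis unfolding reach_iff_derivable
    by (rule good_sub) (unfold reach_node_def, intro computable_intros computable_id)
qed

lemma good_jump:
  assumes R: "good3 R"
  shows "good3 (\<lambda>z. jump (R z))"
proof -
  have d: "good (\<lambda>z u. diverges (R z) (pfst u) (psnd u))"
    unfolding diverges_def
    by (intro good_intros good_app3[OF R] computable_entry computable_intros computable_id)
  have s: "good3 (\<lambda>z. settles (R z))"
    unfolding settles_def
    by (intro good_intros good_app3[OF R] computable_entry computable_intros computable_id)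
  have m: "good3 (\<lambda>z. minimum (R z))"
    unfolding minimum_def
    by (intro good_intros good_app3[OF R] computable_entry computable_intros computable_id)
  show ?thesis
    unfolding jump_def
    by (intro good_intros good_app2[OF d] good_app3[OF s] good_app3[OF m] computable_entry
        computable_intros computable_id)
qed

lemma good_level:
  assumes "good3 T"
  shows "good3 (\<lambda>z. level (T z) k)"
proof (induction k)
  case (Suc k)
  show ?case unfolding level.simps by (intro good_disj Suc good_jump good_reach)
qed (simp add: assms)

section \<open>Machine configurations as coded states\<close>

definition component :: "config \<Rightarrow> nat \<Rightarrow> nat"
  where "component c j = (case j of 0 \<Rightarrow> fst c | Suc k \<Rightarrow> snd c k)"

definition decode_config :: "nat \<Rightarrow> config"
  where "decode_config c = (entry c 0, \<lambda>j. entry c (Suc j))"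

lemma component_simps [simp]: "component (l, R) 0 = l" "component (l, R) (Suc k) = R k"
  by (simp_all add: component_def)

lemma component_decode: "component (decode_config c) = entry c"
  by (rule ext) (simp add: component_def decode_config_def split: nat.split)

lemma decode_component: "entry c = component C \<Longrightarrow> decode_config c = C"
  by (auto simp: decode_config_def component_def prod_eq_iff fun_eq_iff split: nat.splits)

definition step_rel :: "program \<Rightarrow> nat set \<Rightarrow> nat \<Rightarrow> nat \<Rightarrow> nat \<Rightarrow> bool" where
  "step_rel Q w c d m \<longleftrightarrow> (\<forall>j. component (step Q w (decode_config c)) j = entry d j) \<and>
     (\<forall>j. entry m j = entry c j)"

lemma good_finite_ex:
  fixes n :: nat
  shows "(\<And>l. l < n \<Longrightarrow> good (\<phi> l)) \<Longrightarrow> good (\<lambda>z a. \<exists>l<n. \<phi> l z a)"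
proof (induction n)
  case 0
  show ?case using good_abs[OF decidable_const[of False]] by simp
next
  case (Suc n)
  then have "good (\<lambda>z a. \<phi> n z a \<or> (\<exists>l<n. \<phi> l z a))" by (intro good_disj) auto
  moreover have "(\<lambda>z a. \<phi> n z a \<or> (\<exists>l<n. \<phi> l z a)) = (\<lambda>z a. \<exists>l<Suc n. \<phi> l z a)"
    by (intro ext) (auto simp: less_Suc_eq)
  ultimately show ?case by simp
qed

lemma component_exec:
  "component (exec w (Zero m) (decode_config c)) j =
     (if j = 0 then Suc (entry c 0) else if j = Suc m then 0 else entry c j)"
  "component (exec w (Succ m) (decode_config c)) j =
     (if j = 0 then Suc (entry c 0) else if j = Suc m then Suc (entry c (Suc m)) else entry c j)"
  "component (exec w (Copy m n) (decode_config c)) j =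
     (if j = 0 then Suc (entry c 0) else if j = Suc n then entry c (Suc m) else entry c j)"
  "component (exec w (JumpEq m n k) (decode_config c)) j =
     (if j = 0 then if entry c (Suc m) = entry c (Suc n) then k else Suc (entry c 0) else entry c j)"
  "component (exec w (Oracle m) (decode_config c)) j =
     (if j = 0 then Suc (entry c 0) else if j = Suc m then if entry c (Suc m) \<in> w then 1 else 0 else entry c j)"
  by (cases j; simp add: decode_config_def)+

lemma good_exec:
  assumes w: "good (\<lambda>z i. i \<in> w z)"
  shows "good3 (\<lambda>z c j v. component (exec (w z) I (decode_config c)) j = v)"
proof (cases I)
  case (Oracle m)
  have *: "component (exec w (Oracle m) (decode_config c)) j = v \<longleftrightarrow>
      (entry c (Suc m) \<in> w \<and> (if j = 0 then Suc (entry c 0) else if j = Suc m then 1 else entry c j) = v) \<or>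
      (entry c (Suc m) \<notin> w \<and> (if j = 0 then Suc (entry c 0) else if j = Suc m then 0 else entry c j) = v)"
    for w c j v unfolding component_exec by auto
  show ?thesis unfolding Oracle *
    by (intro good_intros good_sub[OF w] computable_entry computable_intros computable_id)
qed (simp only: component_exec, intro good_eq computable_entry computable_intros computable_id)+

lemma good_step_rel:
  assumes w: "good (\<lambda>z i. i \<in> w z)"
  shows "good3 (\<lambda>z. step_rel Q (w z))"
proof -
  have *: "component (step Q w (decode_config c)) j = v \<longleftrightarrow>
      (length Q \<le> entry c 0 \<and> entry c j = v) \<or>
      (\<exists>l<length Q. entry c 0 = l \<and> component (exec w (Q ! l) (decode_config c)) j = v)" for w c j v
  proof -
    have "halted Q (decode_config c) \<longleftrightarrow> length Q \<le> entry c 0"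
      by (simp add: halted_def decode_config_def)
    moreover have "fst (decode_config c) = entry c 0" by (simp add: decode_config_def)
    ultimately show ?thesis by (auto simp: step_def component_decode not_le)
  qed
  show ?thesis unfolding step_rel_def *
    by (intro good_conj good_disj good_all good_finite_ex good_app3[OF good_exec[OF w]]
        good_eq good_le computable_entry computable_intros computable_id)
qed

fun target :: "instr \<Rightarrow> nat" where
  "target (Zero m) = m" | "target (Succ m) = m" | "target (Copy m n) = n"
| "target (JumpEq m n k) = 0" | "target (Oracle m) = m"

lemma exec_target: "target I < j \<Longrightarrow> snd (exec w I c) j = snd c j"
  by (cases I; cases c) auto

text \<open>Component \<open>k + 1\<close> is register \<open>k\<close>. The sum bounds every target
  of an instruction, and the offset 2 also leaves out register 0, which holds the input.\<close>

lemma run_support: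
  assumes C: "is_run Q w i (C :: time \<Rightarrow> config)" and j: "Suc (Suc (\<Sum>I\<leftarrow>Q. target I)) \<le> j"
  shows "component (C t) j = 0"
proof -
  obtain k where k: "j = Suc k" "(\<Sum>I\<leftarrow>Q. target I) < k" using j by (cases j) auto
  have target: "target I < k" if "I \<in> set Q" for I
    using that k(2) member_le_sum_list[of "target I" "map target Q"] by simp
  have "snd (C t) k = 0"
  proof (induction t rule: less_induct)
    case (less t)
    show ?case
    proof (cases t rule: time_cases)
      case least
      then show ?thesis using is_runD(1)[OF C] k(2) by (simp add: init_def)
    next
      case (succ s)
      then have "snd (C s) k = 0" using less by (simp add: is_succ_def)
      then show ?thesis using is_runD(2)[OF C succ] exec_target[OF target, of "Q ! fst (C s)"]
        by (simp add: step_def halted_def not_le)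
    next
      case limit
      then show ?thesis using is_runD(4)[OF C limit] limit_valueI[OF limit] less by simp
    qed
  qed
  then show ?thesis using k(1) by (simp add: component_def)
qed

lemma itrm_run_of_run:
  assumes C: "is_run Q w i (C :: time \<Rightarrow> config)"
  shows "itrm_run (\<lambda>t. component (C t)) (step_rel Q w) (Suc (Suc (\<Sum>I\<leftarrow>Q. target I)))"
proof
  fix s t :: time and c d m assume "is_succ s t" "entry c = component (C s)"
  then show "step_rel Q w c d m \<longleftrightarrow> entry d = component (C t) \<and> entry m = component (C s)"
    using is_runD(2)[OF C] decode_component[of c "C s"] unfolding step_rel_def by (auto simp: fun_eq_iff)
next
  fix t :: time and j assume t: "is_limit t"
  show "component (C t) j = limit_value (\<lambda>s. component (C s) j) t"
    using is_runD(3,4)[OF C t] by (cases j) (auto simp: component_def)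
next
  fix t :: time and j :: nat assume "Suc (Suc (\<Sum>I\<leftarrow>Q. target I)) \<le> j"
  then show "component (C t) j = 0" by (rule run_support[OF C])
qed

lemma halts_with_iff:
  "halts_with Q w i b \<longleftrightarrow> (\<exists>c d m. (\<forall>j. entry c j = (if j = 1 then i else 0)) \<and>
     reach (level (step_rel Q w) (Suc (Suc (\<Sum>I\<leftarrow>Q. target I)))) c d m \<and> length Q \<le> entry d 0 \<and> entry d 1 = b)" (is "_ \<longleftrightarrow> ?rhs")
proof -
  obtain C :: "time \<Rightarrow> config" where C: "is_run Q w i C" and unique: "\<And>C'. is_run Q w i C' \<Longrightarrow> C' = C"
    using run_ex1[where 't = time, of Q w i] by blast
  interpret itrm_run "\<lambda>t. component (C t)" "step_rel Q w" "Suc (Suc (\<Sum>I\<leftarrow>Q. target I))"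
    by (rule itrm_run_of_run[OF C])
  define t0 where "t0 = (LEAST t::time. True)"
  have least: "t0 \<le> t" for t unfolding t0_def by (rule Least_le) simp
  then have "C t0 = init i" using is_runD(1)[OF C] by blast
  then have init: "component (C t0) j = (if j = 1 then i else 0)" for j
    by (cases j) (auto simp: init_def)
  show ?thesis
  proof
    assume "halts_with Q w i b"
    then obtain t where t: "halted Q (C t)" "snd (C t) 0 = b"
      using unique unfolding halts_with_def by blast
    \<comment> \<open>\<open>reach\<close> leads to strictly later times only; since a halting
      configuration persists, its successor time serves even if the program halts at the
      start.\<close>
    obtain t' where s: "is_succ t t'" using time_succ .
    then have "C t' = C t" using is_runD(2)[OF C s] t by (simp add: step_def)
    moreover have "t0 < t'" using least[of t] s by (auto simp: is_succ_def)
    moreover obtain c where c: "entry c = component (C t0)" using state_code .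
    moreover obtain d where d: "entry d = component (C t')" using state_code .
    ultimately obtain m where "reach (level (step_rel Q w) (Suc (Suc (\<Sum>I\<leftarrow>Q. target I)))) c d m"
      using reach_iff by blast
    moreover have "length Q \<le> entry d 0" "entry d 1 = b"
      using d t \<open>C t' = C t\<close> by (auto simp: halted_def component_def)
    ultimately show ?rhs
      using c init by (intro exI[of _ c] exI[of _ d] exI[of _ m]) simp
  next
    assume ?rhs
    then obtain c d m where *: "\<forall>j. entry c j = (if j = 1 then i else 0)"
      "reach (level (step_rel Q w) (Suc (Suc (\<Sum>I\<leftarrow>Q. target I)))) c d m" "length Q \<le> entry d 0" "entry d 1 = b"
      by blast
    have "entry c = component (C t0)" using *(1) init by (intro ext) simp
    then obtain t where "entry d = component (C t)" using reach_iff *(2) by blast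
    then have "halted Q (C t)" "snd (C t) 0 = b" using *(3,4) by (auto simp: halted_def component_def)
    then show "halts_with Q w i b" unfolding halts_with_def using C by blast
  qed
qed

text \<open>With \<open>w z\<close> in place of \<open>z\<close> the result can be iterated: the
  oracle may itself be defined by the halting behaviour of another program on
  \<open>z\<close>.\<close>

theorem good_halts_with:
  assumes "good (\<lambda>z i. i \<in> w z)"
  shows "good (\<lambda>z a. halts_with Q (w z) (pfst a) (psnd a))"
  unfolding halts_with_iff
  by (intro good_ex good_all good_conj good_app3[OF good_reach[OF good_level[OF good_step_rel[OF assms]]]]
      good_eq good_le computable_entry computable_intros computable_id)

lemma halted_stays:
  assumes C: "is_run P z i (C :: time \<Rightarrow> config)" and h: "halted P (C t)" and "t \<le> u"
  shows "C u = C t"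
  using assms(3)
proof (induction u rule: less_induct)
  case (less u)
  show ?case
  proof (cases "u = t")
    case False
    then have u: "t < u" using less by simp
    show ?thesis
    proof (cases u rule: time_cases)
      case least
      then show ?thesis using u by (meson leD)
    next
      case (succ r)
      then have "t \<le> r" "r < u" using u is_succ_le[of r u t] by (auto simp: is_succ_def)
      then have "C r = C t" using less.IH by blast
      then show ?thesis using is_runD(2)[OF C succ] h by (simp add: step_def)
    next
      case limit
      have "limit_value (\<lambda>s. f (C s)) u = f (C t)" for f
      proof (rule limit_value_eqI[OF u])
        fix r assume "r < u"
        then show "\<exists>v. r \<le> v \<and> v < u \<and> f (C v) = f (C t)"
          using less.IH[of "max r t"] u by (intro exI[of _ "max r t"]) auto
      next
        fix v assume "t \<le> v" "v < u"
        then show "f (C t) \<le> f (C v)" using less.IH[of v] by simp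
      qed
      from this[of fst] this[of "\<lambda>c. snd c m" for m] show ?thesis
        using is_runD(3,4)[OF C limit] by (auto intro!: prod_eqI ext)
    qed
  qed simp
qed

lemma halts_with_unique:
  assumes "halts_with P z i a" "halts_with P z i b"
  shows "a = b"
proof -
  obtain C D :: "time \<Rightarrow> config" and s t where
    C: "is_run P z i C" "halted P (C s)" "snd (C s) 0 = a" and
    D: "is_run P z i D" "halted P (D t)" "snd (D t) 0 = b"
    using assms unfolding halts_with_def by blast
  have "C = D" using run_ex1 C(1) D(1) by blast
  then have "C (max s t) = C s" "C (max s t) = D t"
    using halted_stays[OF C(1,2), of "max s t"] halted_stays[OF D(1,2), of "max s t"] by auto
  then show ?thesis using C(3) D(3) by simp
qed

section \<open>Category\<close>

lemma open_cylinder: "open {f :: nat \<Rightarrow> bool. {n. f n} \<in> cyl p}"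
proof -
  have "open {f :: nat \<Rightarrow> bool. f i = b}" for i b
  proof -
    have "open ((\<lambda>f :: nat \<Rightarrow> bool. f i) -` {b})"
      by (rule open_vimage) (auto intro: open_discrete)
    then show ?thesis by (simp add: vimage_def)
  qed
  then have "open (\<Inter>i\<in>{..<pfst p}. {f :: nat \<Rightarrow> bool. f i = (entry (psnd p) i \<noteq> 0)})"
    by (intro open_INT) auto
  moreover have "{f :: nat \<Rightarrow> bool. {n. f n} \<in> cyl p} =
      (\<Inter>i\<in>{..<pfst p}. {f. f i = (entry (psnd p) i \<noteq> 0)})" by (auto simp: cyl_def)
  ultimately show ?thesis by simp
qed

lemma open_contains_cylinder:
  assumes "open U" "f \<in> U"
  obtains p where "{n. f n} \<in> cyl p" "\<And>g :: nat \<Rightarrow> bool. {n. g n} \<in> cyl p \<Longrightarrow> g \<in> U"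
proof -
  obtain X where X: "f \<in> Pi\<^sub>E UNIV X" "finite {i. X i \<noteq> UNIV}" "Pi\<^sub>E UNIV X \<subseteq> U"
    using product_topology_open_contains_basis[of "\<lambda>i. euclidean" UNIV U f] assms
    by (auto simp: open_fun_def)
  obtain N where N: "\<And>i. X i \<noteq> UNIV \<Longrightarrow> i < N" using finite_nat_bounded[OF X(2)] by (auto simp: subset_iff)
  obtain p where p: "{n. f n} \<in> cyl p" "pfst p = N" using cyl_prefix .
  have "g \<in> U" if g: "{n. g n} \<in> cyl p" for g
  proof -
    have "g i \<in> X i" for i
    proof (cases "i < N")
      case True
      then have "g i = f i" using g p by (auto simp: cyl_def)
      then show ?thesis using X(1) by auto
    next
      case False
      then show ?thesis using N by blast
    qed
    then show ?thesis using X(3) by auto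
  qed
  then show ?thesis using p(1) that by blast
qed

text \<open>The sets \<open>M k\<close> of points missing the \<open>k\<close>-th dense set of
  conditions are closed with empty interior; they would cover all of \<open>S\<close> if
  \<open>\<phi>\<close> failed throughout \<open>S\<close>.\<close>

lemma nonmeager_almost:
  assumes S: "\<not> meager ((\<lambda>z n. n \<in> z) ` S)" and \<phi>: "almost 0 \<phi>"
  obtains z where "z \<in> S" "\<phi> z"
proof -
  obtain D where D: "comeager_via D 0 \<phi>" using \<phi> unfolding almost_def by blast
  let ?A = "(\<lambda>z n. n \<in> z) ` S"
  define M where "M k = {f :: nat \<Rightarrow> bool. \<forall>r\<in>D k. {n. f n} \<notin> cyl r}" for k
  have "nowhere_dense (?A \<inter> M k)" for k
  proof -
    have "closed (M k)"
    proof -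
      have "- M k = (\<Union>r\<in>D k. {f. {n. f n} \<in> cyl r})" by (auto simp: M_def)
      then show ?thesis unfolding closed_def by (metis (no_types, lifting) open_UN open_cylinder)
    qed
    moreover have "interior (M k) = {}"
    proof (rule ccontr)
      assume "interior (M k) \<noteq> {}"
      then obtain f where "f \<in> interior (M k)" by blast
      then obtain p where p: "\<And>g. {n. g n} \<in> cyl p \<Longrightarrow> g \<in> interior (M k)"
        using open_contains_cylinder[OF open_interior] by metis
      obtain r where r: "extends r p" "r \<in> D k" using comeager_viaD(1)[OF D, of p k] by auto
      obtain z where z: "z \<in> cyl r" using cyl_nonempty by blast
      then have "(\<lambda>n. n \<in> z) \<in> M k" using p[of "\<lambda>n. n \<in> z"] cyl_mono[OF r(1)] interior_subset by auto
      then show False using z r(2) by (auto simp: M_def)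
    qed
    ultimately show ?thesis unfolding nowhere_dense_def
      by (metis closure_minimal inf_le2 interior_mono subset_empty)
  qed
  then have "?A \<noteq> (\<Union>k. ?A \<inter> M k)"
    using S unfolding meager_def by (metis (no_types, lifting))
  then obtain z where z: "z \<in> S" "\<forall>k. (\<lambda>n. n \<in> z) \<notin> M k" by auto
  then have "\<exists>r\<in>D k. z \<in> cyl r" for k by (auto simp: M_def)
  then have "\<phi> z" using comeager_viaD(2)[OF D] by simp
  then show ?thesis using that z(1) by blast
qed

theorem theorem12:
  fixes x y :: "nat set"
  assumes "itrm_recognizable x"
    and "itrm_random y"
    and "x \<le>\<^sub>I\<^sub>T\<^sub>R\<^sub>M y"
  shows "itrm_computable x"
proof -
  obtain Q where Q: "\<And>z. halts_with Q z 0 (if z = x then 1 else 0)"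
    using assms(1) unfolding itrm_recognizable_def by blast
  obtain P where P: "\<And>i. halts_with P y i (if i \<in> x then 1 else 0)"
    using assms(3) unfolding itrm_reducible_def by blast
  \<comment> \<open>Defined for every oracle: an input on which \<open>P\<close> does not halt, or
    halts with another output, is simply left out.\<close>
  define w where "w z = {i. halts_with P z i 1}" for z
  define S where "S = {z. halts_with Q (w z) 0 1}"
  have S_iff: "z \<in> S \<longleftrightarrow> w z = x" for z
    using Q[of "w z"] halts_with_unique[of Q "w z" 0 1 0] by (cases "w z = x") (auto simp: S_def)
  have "good (\<lambda>z a. halts_with P z (pfst a) (psnd a))" using good_halts_with[OF good_mem] .
  then have "good (\<lambda>z i. halts_with P z (pfst (pair i 1)) (psnd (pair i 1)))"
    by (rule good_sub) (intro computable_intros computable_id)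
  then have w: "good (\<lambda>z i. i \<in> w z)" by (simp add: w_def)
  from good_halts_with[OF this, of Q]
  have "good (\<lambda>z i. halts_with Q (w z) (pfst (pair 0 1)) (psnd (pair 0 1)))"
    by (rule good_sub) (intro computable_intros computable_id)
  then have "decidable (\<lambda>z i. z \<in> S)" unfolding S_def by (simp add: good_decidable)
  then obtain P' where "\<And>z n. halts_with P' z n (if z \<in> S then 1 else 0)"
    unfolding decidable_def by (rule computable_halts) blast
  then have "itrm_decidable S" unfolding itrm_decidable_def by blast
  moreover have "y \<in> S"
  proof -
    have "i \<in> w y \<longleftrightarrow> i \<in> x" for i
      using P[of i] halts_with_unique[of P y i 0 1] by (cases "i \<in> x") (auto simp: w_def)
    then show ?thesis unfolding S_iff by blast
  qed
  ultimately have S: "\<not> meager ((\<lambda>z n. n \<in> z) ` S)" using assms(2) unfolding itrm_random_def by blast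
  obtain W where W: "names W (\<lambda>z i. i \<in> w z)" using w unfolding good_def by blast
  have "\<exists>s. \<forall>i. (i \<in> x \<longrightarrow> (\<forall>q. extends q s \<longrightarrow> (\<exists>r. extends r q \<and> W r i))) \<and>
      (i \<notin> x \<longrightarrow> (\<forall>q. extends q s \<longrightarrow> \<not> W q i))"
  proof (rule ccontr)
    assume *: "\<not> ?thesis"
    \<comment> \<open>The conditions that refute \<open>w z = x\<close> at some \<open>i\<close>. If
      no \<open>s\<close> as claimed existed they would be dense, so some element of the nonmeager
      set \<open>S\<close> would meet one of them.\<close>
    let ?B = "{q. \<exists>i. (i \<in> x \<and> (\<forall>r. extends r q \<longrightarrow> \<not> W r i)) \<or> (i \<notin> x \<and> W q i)}"
    have B: "almost 0 (\<lambda>z. \<exists>q\<in>?B. z \<in> cyl q)"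
    proof (rule almost_meets)
      fix q
      from * obtain i where "(i \<in> x \<and> (\<exists>r. extends r q \<and> (\<forall>t. extends t r \<longrightarrow> \<not> W t i))) \<or>
          (i \<notin> x \<and> (\<exists>r. extends r q \<and> W r i))" by meson
      then show "\<exists>r. extends r q \<and> r \<in> ?B" by blast
    qed
    obtain z where
      z: "z \<in> S" "(\<exists>q\<in>?B. z \<in> cyl q) \<and> (\<forall>i. i \<in> w z \<longleftrightarrow> (\<exists>p. z \<in> cyl p \<and> W p i))"
      by (rule nonmeager_almost[OF S almost_conj[OF B namesD(3)[OF W]]])
    then obtain q i where q: "z \<in> cyl q" "(i \<in> x \<and> (\<forall>r. extends r q \<longrightarrow> \<not> W r i)) \<or> (i \<notin> x \<and> W q i)" by blast
    have "i \<in> x \<longleftrightarrow> (\<exists>p. z \<in> cyl p \<and> W p i)" using z S_iff by blast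
    then obtain p where "z \<in> cyl p" "W p i" "\<forall>r. extends r q \<longrightarrow> \<not> W r i" using q by blast
    then show False using common_extension[OF q(1), of p] namesD(2)[OF W] by metis
  qed
  then obtain s where s: "\<And>i. i \<in> x \<Longrightarrow> \<exists>r. extends r s \<and> W r i" "\<And>i q. i \<notin> x \<Longrightarrow> extends q s \<Longrightarrow> \<not> W q i"
    using extends_refl by blast
  \<comment> \<open>Neither \<open>W\<close> nor the fixed condition \<open>s\<close> depends on the
    oracle, so the program obtained gives the same answers with the empty oracle.\<close>
  have "decidable (\<lambda>z i. \<exists>q. extends q s \<and> W q i)"
    by (intro decidable_ex decidable_conj decidable_extends decidable_app2[OF namesD(1)[OF W]]
        computable_intros computable_id)
  moreover have "(\<exists>q. extends q s \<and> W q i) \<longleftrightarrow> i \<in> x" for i using s by blast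
  ultimately have "decidable (\<lambda>z i. i \<in> x)" by simp
  then obtain P'' where "\<And>z i. halts_with P'' z i (if i \<in> x then 1 else 0)"
    unfolding decidable_def by (rule computable_halts) blast
  then show ?thesis unfolding itrm_computable_def itrm_reducible_def by blast
qed

end
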